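(* Let $U,V$ be compact metric spaces and let $b:\mathbb{R}^n\times U\times V\to\mathbb{R}^n$, $\sigma:\mathbb{R}^n\times U\times V\to\mathbb{R}^{n\times d}$, $f:\mathbb{R}^n\times U\times V\to\mathbb{R}$ satisfy: (a) for every fixed $x\in\mathbb{R}^n$, $b(x,\cdot,\cdot),\sigma(x,\cdot,\cdot),f(x,\cdot,\cdot)$ are continuous on $U\times V$; (b) there are constants $C_b,C_f,C_\sigma$ such that for all $x,y\in\mathbb{R}^n$, $u\in U$, $v\in V$: $|b(x,u,v)-b(y,u,v)|\le C_b|x-y|$, $|f(x,u,v)-f(y,u,v)|\le C_f|x-y|$, $\|\sigma(x,u,v)-\sigma(y,u,v)\|\le C_\sigma|x-y|$; (c) there is a constant $K>(C_\sigma)^2$ such that $2\langle x-y,b(x,u,v)-b(y,u,v)\rangle\le -K|x-y|^2$ for all $(u,v)\in U\times V$, $x,y\in\mathbb{R}^n$. For $r\in(0,1]$, $x\in\mathbb{R}^n$ and $(u,v)\in\mathcal{U}\times\mathcal{V}$, let $X^{r,x,u,v}$ be the solution of $$dX_s^{r,x,u,v}=\Big[-\frac K2\big(X_s^{r,x,u,v}-X_s^{x,u,v}\big)+b(X_s^{x,u,v},u_s,v_s)\Big]ds+\sigma^r(X_s^{x,u,v},u_s,v_s)dW_s,\ s\ge0,\qquad X_0^{r,x,u,v}=x,$$ where $X^{x,u,v}$ solves $$dX_s^{x,u,v}=b(X_s^{x,u,v},u_s,v_s)ds+\sigma(X_s^{x,u,v},u_s,v_s)dB_s,\ s\ge0,\qquad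 X_0^{x,u,v}=x.$$ Then for any Borel set $D\subseteq\mathbb{R}^n$, all $(u,v)\in\mathcal{U}\times\mathcal{V}$, $x\in\mathbb{R}^n$ and $s>0$, $$P\{X_s^{r,x,u,v}\in D\}\le\Big(\frac K2\Big)^{\frac n2}r^{-n}\big[1-e^{-Ks}\big]^{-\frac n2}\mathrm{Leb}(D),$$ where $\mathrm{Leb}(D)$ is the Lebesgue measure of $D$.
   Context: $B$ is a standard $d$-dimensional Brownian motion on a complete probability space $(\Omega,\mathcal{F},P)$, $\mathbb{F}^B$ is its completed natural filtration, $B^1$ is an $n$-dimensional Brownian motion on the same space independent of $B$, and $W=(B,B^1)$. $\mathcal{U}$ (resp. $\mathcal{V}$) is the set of $U$-valued (resp. $V$-valued) $\mathbb{F}^B$-adapted (progressively measurable) processes on $[0,\infty)$. $\sigma^r$ is the $n\times(d+n)$ matrix $\sigma^r(x,u,v)=(\sigma(x,u,v),\,rI_{n\times n})$, with $I_{n\times n}$ the $n\times n$ identity matrix. $\|\cdot\|$ is the trace norm of a matrix, $\|A\|^2=\mathrm{tr}(AA^* )$, and $|\cdot|$ the Euclidean norm. *)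

theory Defs
  imports "HOL-Probability.Probability"
begin

section \<open>Filtrations and Brownian motion\<close>

text \<open>Processes are functions of type \<^typ>\<open>real \<Rightarrow> 'w \<Rightarrow> 'a\<close>; only their values at times in
  \<open>[0,\<infinity>)\<close> and at points of \<^term>\<open>space M\<close> are relevant.\<close>

definition process_events :: "'w measure \<Rightarrow> real set \<Rightarrow> (real \<Rightarrow> 'w \<Rightarrow> 'a::topological_space) \<Rightarrow> 'w set set"
  where "process_events M T Z = {Z s -` A \<inter> space M | s A. s \<in> T \<and> A \<in> sets borel}"

definition completed_natural_filtration ::
    "'w measure \<Rightarrow> (real \<Rightarrow> 'w \<Rightarrow> 'a::topological_space) \<Rightarrow> real \<Rightarrow> 'w measure"
  where "completed_natural_filtration M Z t = sigma (space M) (process_events M {0..t} Z \<union> null_sets M)"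

definition progressively_measurable ::
    "(real \<Rightarrow> 'w measure) \<Rightarrow> (real \<Rightarrow> 'w \<Rightarrow> 'a::topological_space) \<Rightarrow> bool"
  where "progressively_measurable F Z \<longleftrightarrow>
    (\<forall>t\<ge>0. (\<lambda>(s, \<omega>). Z s \<omega>) \<in> (restrict_space borel {0..t} \<Otimes>\<^sub>M F t) \<rightarrow>\<^sub>M borel)"

definition admissible_controls ::
    "'w measure \<Rightarrow> (real \<Rightarrow> 'w measure) \<Rightarrow> 'a::topological_space set \<Rightarrow> (real \<Rightarrow> 'w \<Rightarrow> 'a) set"
  where "admissible_controls M F A =
    {a. progressively_measurable F a \<and> (\<forall>s\<ge>0. \<forall>\<omega>\<in>space M. a s \<omega> \<in> A)}"

text \<open>The Gaussian density of the increments is that of \<open>N(0, (t - s) I)\<close>.\<close>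

definition brownian_motion :: "'w measure \<Rightarrow> (real \<Rightarrow> 'w \<Rightarrow> real ^ 'm) \<Rightarrow> bool"
  where "brownian_motion M W \<longleftrightarrow>
    (\<forall>t\<ge>0. W t \<in> borel_measurable M) \<and>
    (AE \<omega> in M. W 0 \<omega> = 0) \<and>
    (AE \<omega> in M. continuous_on {0..} (\<lambda>t. W t \<omega>)) \<and>
    (\<forall>s t. 0 \<le> s \<and> s < t \<longrightarrow>
      distributed M lborel (\<lambda>\<omega>. W t \<omega> - W s \<omega>)
        (\<lambda>x. ennreal (\<Prod>i\<in>UNIV. normal_density 0 (sqrt (t - s)) (x $ i)))) \<and>
    (\<forall>(k::nat) \<tau>. 0 \<le> \<tau> 0 \<and> incseq \<tau> \<longrightarrow>
      prob_space.indep_vars M (\<lambda>_. borel) (\<lambda>i \<omega>. W (\<tau> (Suc i)) \<omega> - W (\<tau> i) \<omega>) {..<k})"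

definition independent_processes ::
    "'w measure \<Rightarrow> (real \<Rightarrow> 'w \<Rightarrow> 'a::topological_space) \<Rightarrow> (real \<Rightarrow> 'w \<Rightarrow> 'b::topological_space) \<Rightarrow> bool"
  where "independent_processes M Y Z \<longleftrightarrow>
    prob_space.indep_set M (sigma_sets (space M) (process_events M {0..} Y))
                           (sigma_sets (space M) (process_events M {0..} Z))"

definition joint_process ::
    "(real \<Rightarrow> 'w \<Rightarrow> real ^ 'd) \<Rightarrow> (real \<Rightarrow> 'w \<Rightarrow> real ^ 'n) \<Rightarrow> real \<Rightarrow> 'w \<Rightarrow> real ^ ('d + 'n)"
  where "joint_process Y Z t \<omega> = (\<chi> j. case j of Inl k \<Rightarrow> Y t \<omega> $ k | Inr k \<Rightarrow> Z t \<omega> $ k)"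


section \<open>The Ito integral\<close>

definition trace_norm :: "real ^ 'm ^ 'n \<Rightarrow> real"
  where "trace_norm A = sqrt (trace (A ** transpose A))"

text \<open>The triple \<open>(k, \<tau>, \<xi>)\<close> represents the matrix-valued simple process that is constant in time, equal
  to \<open>\<xi> i\<close>, on the interval \<open>(\<tau> i, \<tau> (i + 1)]\<close> for each \<open>i < k\<close>, and is zero elsewhere.\<close>

type_synonym ('w, 'm, 'n) simple_proc = "nat \<times> (nat \<Rightarrow> real) \<times> (nat \<Rightarrow> 'w \<Rightarrow> real ^ 'm ^ 'n)"

fun is_simple_proc :: "'w measure \<Rightarrow> (real \<Rightarrow> 'w measure) \<Rightarrow> ('w, 'm::finite, 'n::finite) simple_proc \<Rightarrow> bool"
  where "is_simple_proc M F (k, \<tau>, \<xi>) \<longleftrightarrow> 0 \<le> \<tau> 0 \<and> incseq \<tau> \<and>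
    (\<forall>i<k. \<xi> i \<in> borel_measurable (F (\<tau> i)) \<and> (\<exists>c. \<forall>\<omega>\<in>space M. trace_norm (\<xi> i \<omega>) \<le> c))"

fun simple_proc_val :: "('w, 'm::finite, 'n::finite) simple_proc \<Rightarrow> real \<Rightarrow> 'w \<Rightarrow> real ^ 'm ^ 'n"
  where "simple_proc_val (k, \<tau>, \<xi>) s \<omega> = (\<Sum>i<k. indicator {\<tau> i<..\<tau> (Suc i)} s *\<^sub>R \<xi> i \<omega>)"

fun simple_integral ::
    "(real \<Rightarrow> 'w \<Rightarrow> real ^ 'm) \<Rightarrow> ('w, 'm::finite, 'n::finite) simple_proc \<Rightarrow> real \<Rightarrow> 'w \<Rightarrow> real ^ 'n"
  where "simple_integral W (k, \<tau>, \<xi>) t \<omega> =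
    (\<Sum>i<k. \<xi> i \<omega> *v (W (min t (\<tau> (Suc i))) \<omega> - W (min t (\<tau> i)) \<omega>))"

text \<open>\<open>Y\<close> is a continuous version of \<open>\<integral>\<^sub>0\<^sup>\<cdot> H dW\<close>, for progressively measurable \<open>H\<close> with almost
  surely locally square-integrable paths: \<open>Y\<^sub>t\<close> is the limit in probability of the elementary
  integrals of simple processes \<open>G\<^sub>k\<close> such that \<open>\<integral>\<^sub>0\<^sup>t \<parallel>G\<^sub>k - H\<parallel>\<^sup>2 ds \<rightarrow> 0\<close> in probability for all \<open>t\<close>.
  The pathwise integrals are taken in \<^typ>\<open>ennreal\<close> because they may be infinite on null sets.
  Together with continuity, convergence for each fixed \<open>t\<close> determines \<open>Y\<close> up to
  indistinguishability.\<close>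

definition ito_integral ::
    "'w measure \<Rightarrow> (real \<Rightarrow> 'w measure) \<Rightarrow> (real \<Rightarrow> 'w \<Rightarrow> real ^ 'm) \<Rightarrow>
     (real \<Rightarrow> 'w \<Rightarrow> real ^ 'm ^ 'n) \<Rightarrow> (real \<Rightarrow> 'w \<Rightarrow> real ^ 'n) \<Rightarrow> bool"
  where "ito_integral M F W H Y \<longleftrightarrow>
    progressively_measurable F H \<and>
    (AE \<omega> in M. \<forall>t\<ge>0. (\<integral>\<^sup>+s\<in>{0..t}. ennreal ((trace_norm (H s \<omega>))\<^sup>2) \<partial>lborel) < \<infinity>) \<and>
    (\<forall>t\<ge>0. Y t \<in> borel_measurable (F t)) \<and>
    (AE \<omega> in M. continuous_on {0..} (\<lambda>t. Y t \<omega>)) \<and>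
    (\<exists>G. (\<forall>k::nat. is_simple_proc M F (G k)) \<and>
      (\<forall>t\<ge>0. \<forall>\<epsilon>>0.
        (\<lambda>k. measure M {\<omega>\<in>space M. ennreal \<epsilon> <
           (\<integral>\<^sup>+s\<in>{0..t}. ennreal ((trace_norm (simple_proc_val (G k) s \<omega> - H s \<omega>))\<^sup>2) \<partial>lborel)})
          \<longlonglongrightarrow> 0 \<and>
        (\<lambda>k. measure M {\<omega>\<in>space M. \<epsilon> < norm (simple_integral W (G k) t \<omega> - Y t \<omega>)})
          \<longlonglongrightarrow> 0))"

text \<open>\<open>dX\<^sub>s = \<beta>\<^sub>s ds + H\<^sub>s dW\<^sub>s\<close>, \<open>s \<ge> 0\<close>, \<open>X\<^sub>0 = x\<close>. The coefficient processes \<open>\<beta>\<close> and \<open>H\<close> may be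
  expressions in \<open>X\<close> itself, in which case this says that \<open>X\<close> is a (strong) solution of the
  corresponding equation.\<close>

definition solves_sde ::
    "'w measure \<Rightarrow> (real \<Rightarrow> 'w measure) \<Rightarrow> (real \<Rightarrow> 'w \<Rightarrow> real ^ 'm) \<Rightarrow> real ^ 'n \<Rightarrow>
     (real \<Rightarrow> 'w \<Rightarrow> real ^ 'n) \<Rightarrow> (real \<Rightarrow> 'w \<Rightarrow> real ^ 'm ^ 'n) \<Rightarrow> (real \<Rightarrow> 'w \<Rightarrow> real ^ 'n) \<Rightarrow> bool"
  where "solves_sde M F W x \<beta> H X \<longleftrightarrow>
    progressively_measurable F X \<and>
    (AE \<omega> in M. continuous_on {0..} (\<lambda>t. X t \<omega>)) \<and>
    (AE \<omega> in M. \<forall>t\<ge>0. set_integrable lborel {0..t} (\<lambda>s. \<beta> s \<omega>)) \<and>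
    (\<exists>Y. ito_integral M F W H Y \<and>
      (AE \<omega> in M. \<forall>t\<ge>0. X t \<omega> = x + (LINT s:{0..t}|lborel. \<beta> s \<omega>) + Y t \<omega>))"


section \<open>The non-degenerate diffusion coefficient\<close>

definition sigma_r ::
    "real \<Rightarrow> (real ^ 'n \<Rightarrow> 'u \<Rightarrow> 'v \<Rightarrow> real ^ 'd ^ 'n) \<Rightarrow> real ^ 'n \<Rightarrow> 'u \<Rightarrow> 'v \<Rightarrow> real ^ ('d + 'n) ^ 'n"
  where "sigma_r r \<sigma> x u v =
    (\<chi> i j. case j of Inl k \<Rightarrow> \<sigma> x u v $ i $ k | Inr k \<Rightarrow> (r *\<^sub>R (mat 1 :: real ^ 'n ^ 'n)) $ i $ k)"

end

theory Submission
  imports Defs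
begin

text \<open>
  Subtracting the two equations removes both the drift \<open>b\<close> and the possibly degenerate diffusion
  \<open>\<sigma>\<close>: the difference \<open>Z = X\<^sup>r - X\<close> solves the linear equation
  \<open>dZ\<^sub>t = - (K / 2) Z\<^sub>t dt + r dB\<^sup>1\<^sub>t\<close>, \<open>Z\<^sub>0 = 0\<close>. Hence \<open>Z\<^sub>s\<close> is the Wiener integral of
  \<open>r exp (- (K / 2) (s - t))\<close> against \<open>B\<^sup>1\<close>, a centred Gaussian vector with covariance
  \<open>r\<^sup>2 (1 - exp (- K s)) / K\<close> times the identity. Moreover \<open>X\<^sub>s\<close> is a functional of \<open>B\<close>, which is independent of
  \<open>B\<^sup>1\<close>. So the law of \<open>X\<^sup>r\<^sub>s = X\<^sub>s + Z\<^sub>s\<close> is the convolution of some law with that Gaussian one, and its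
  density is at most the maximum of the Gaussian density, which is smaller than the claimed
  constant by the factor \<open>\<pi>\<close> to the power \<open>- n / 2\<close>.

  The stochastic part of this argument is the identity
  \<open>\<integral>\<sigma>\<^sup>r dW - \<integral>\<sigma> dB = r B\<^sup>1\<close> (lemma \<open>ito_integral_block_row_minus_ito_integral\<close>). The two integrals are limits
  of elementary integrals with respect to different filtrations and different partitions. After
  passing to a common refinement, the difference is an elementary integral for \<open>W\<close> whose integrand
  tends to zero in mean square over time, in probability. Such integrals tend to zero in
  probability by the classical truncation argument (\<open>elementary_integral_tail_bound\<close>). Only a mean
  square estimate up to a dimensional constant enters there, so it suffices that each single coordinate of an
  increment of \<open>W\<close> is centred, has variance the elapsed time and is independent of the past of \<open>W\<close>;
  the locale \<open>centered_increments\<close> records this.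

  The Gaussian part avoids stochastic calculus. Along a uniform partition, the sums of
  \<open>r exp (- (K / 2) (s - t\<^sub>i\<^sub>+\<^sub>1))\<close> times the increments of \<open>B\<^sup>1\<close> converge pathwise to \<open>Z\<^sub>s\<close>, by
  summation by parts and the continuity of \<open>Z\<close> (\<open>exp_weighted_sum_tendsto\<close>). They are Gaussian and
  independent of \<open>X\<^sub>s\<close>, and, since the weights are taken at right endpoints, their
  variance is never below that of \<open>Z\<^sub>s\<close> (\<open>exp_weighted_variance_ge\<close>). So the density bound holds for
  every approximation with the same constant. It passes to the limit for open sets by Fatou's
  lemma, and to Borel sets by outer regularity of Lebesgue measure (\<open>emeasure_limit_le_lborel\<close>).
\<close>

section \<open>Matrices and their Frobenius norm\<close>

lemma norm_matrix_vector_mult_le: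
  fixes A :: "real ^ 'm ^ 'n" and y :: "real ^ 'm"
  shows "norm (A *v y) \<le> norm A * norm y"
proof -
  have "norm (A *v y) = L2_set (\<lambda>i. \<bar>A $ i \<bullet> y\<bar>) UNIV"
    by (simp add: norm_vec_def[of "A *v y"] matrix_vector_mul_component)
  also have "\<dots> \<le> L2_set (\<lambda>i. norm (A $ i) * norm y) UNIV"
    by (intro L2_set_mono) (auto simp: Cauchy_Schwarz_ineq2)
  also have "\<dots> = norm A * norm y"
    by (simp add: norm_vec_def[of A] L2_set_left_distrib)
  finally show ?thesis .
qed

lemma norm_matrix_power2:
  fixes A :: "real ^ 'm ^ 'n"
  shows "(norm A)\<^sup>2 = (\<Sum>i\<in>UNIV. \<Sum>j\<in>UNIV. (A $ i $ j)\<^sup>2)"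
  by (simp add: norm_vec_def L2_set_def sum_nonneg)

lemma trace_norm_eq_norm: "trace_norm (A :: real ^ 'm ^ 'n) = norm A"
proof -
  have "trace (A ** transpose A) = (norm A)\<^sup>2"
    unfolding norm_matrix_power2 by (simp add: trace_def matrix_matrix_mult_def transpose_def power2_eq_square)
  then show ?thesis by (simp add: trace_norm_def)
qed

lemma bounded_bilinear_matrix_vector_mult:
  "bounded_bilinear ((*v) :: real ^ 'm ^ 'n \<Rightarrow> real ^ 'm \<Rightarrow> real ^ 'n)"
proof
  show "\<exists>K. \<forall>A y. norm ((A :: real ^ 'm ^ 'n) *v y) \<le> norm A * norm y * K"
    by (intro exI[of _ 1]) (simp add: norm_matrix_vector_mult_le)
qed (simp_all add: matrix_vector_mult_add_rdistrib matrix_vector_right_distrib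
      scaleR_matrix_vector_assoc[symmetric] matrix_vector_mult_scaleR)

lemma borel_measurable_matrix_vector_mult [measurable (raw)]:
  fixes f :: "'a \<Rightarrow> real ^ 'm ^ 'n"
  assumes "f \<in> borel_measurable N" "g \<in> borel_measurable N"
  shows "(\<lambda>\<omega>. f \<omega> *v g \<omega>) \<in> borel_measurable N"
  using assms
  by (rule borel_measurable_continuous_Pair)
     (intro bounded_bilinear.continuous_on[OF bounded_bilinear_matrix_vector_mult] continuous_intros)

lemma borel_measurable_vec_nth_comp [measurable (raw)]:
  fixes f :: "'a \<Rightarrow> real ^ 'm"
  assumes "f \<in> borel_measurable N"
  shows "(\<lambda>\<omega>. f \<omega> $ i) \<in> borel_measurable N"
  using assms by (rule measurable_compose) (intro borel_measurable_continuous_onI continuous_intros)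

text \<open>Reduces a product with a vector increment to products with its coordinates, for which
  independence of the past is assumed.\<close>

lemma inner_matrix_vector_mult:
  fixes A :: "real ^ 'm ^ 'n"
  shows "x \<bullet> (A *v y) = (\<Sum>a\<in>UNIV. (x \<bullet> (A *v axis a 1)) * y $ a)"
proof -
  have "x \<bullet> (A *v y) = (x v* A) \<bullet> y" by (simp add: dot_lmul_matrix)
  also have "\<dots> = (\<Sum>a\<in>UNIV. ((x v* A) \<bullet> axis a 1) * y $ a)"
    by (simp add: inner_vec_def[of "x v* A" y] inner_axis)
  finally show ?thesis by (simp add: dot_lmul_matrix)
qed

section \<open>Independence of completed sigma-algebras and of Brownian increments\<close>

lemma finite_set_enumeration:
  fixes S :: "real set"
  assumes "finite S" "S \<noteq> {}"
  obtains N :: nat and \<rho> :: "nat \<Rightarrow> real" where "\<And>i j. i < j \<Longrightarrow> j \<le> N \<Longrightarrow> \<rho> i < \<rho> j" "\<rho> ` {..N} = S"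
proof -
  define L where "L = sorted_list_of_set S"
  have L: "sorted_wrt (<) L" "set L = S" "length L > 0"
    using assms by (auto simp: L_def card_gt_0_iff)
  show thesis
  proof (rule that[of "length L - 1" "\<lambda>i. L ! i"])
    show "L ! i < L ! j" if "i < j" "j \<le> length L - 1" for i j
      using that L(1,3) sorted_wrt_nth_less[of "(<)" L i j] by auto
    have "{..length L - 1} = {..<length L}" using L(3) by (cases L) (auto simp: less_Suc_eq_le)
    then show "(\<lambda>i. L ! i) ` {..length L - 1} = S"
      using L(2) by (auto simp: set_conv_nth)
  qed
qed

text \<open>Changing events by null sets does not change probabilities, so the family of all events that agree
  almost surely with a member of a \<open>\<pi>\<close>-system is again a \<open>\<pi>\<close>-system independent of the other
  one. This is how independence is transferred to completed filtrations.\<close>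

lemma (in prob_space) indep_set_modulo_null:
  assumes ind: "indep_set P Q" and "Int_stable P" "Int_stable Q"
    and R: "\<And>A. A \<in> R \<Longrightarrow> A \<in> events \<and> (\<exists>A'\<in>P. AE \<omega> in M. \<omega> \<in> A \<longleftrightarrow> \<omega> \<in> A')"
  shows "indep_set (sigma_sets (space M) R) (sigma_sets (space M) Q)"
proof -
  define P' where "P' = {A \<in> events. \<exists>A'\<in>P. AE \<omega> in M. \<omega> \<in> A \<longleftrightarrow> \<omega> \<in> A'}"
  have Pe: "P \<subseteq> events" and Qe: "Q \<subseteq> events"
    using indep_setD_ev1[OF ind] indep_setD_ev2[OF ind] .
  have "Int_stable P'"
  proof (rule Int_stableI)
    fix A C assume "A \<in> P'" "C \<in> P'"
    then obtain A' C' where *: "A \<in> events" "C \<in> events" "A' \<in> P" "C' \<in> P"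
      "AE \<omega> in M. \<omega> \<in> A \<longleftrightarrow> \<omega> \<in> A'" "AE \<omega> in M. \<omega> \<in> C \<longleftrightarrow> \<omega> \<in> C'"
      by (auto simp: P'_def)
    have "A' \<inter> C' \<in> P" using * \<open>Int_stable P\<close> by (auto simp: Int_stable_def)
    moreover have "AE \<omega> in M. \<omega> \<in> A \<inter> C \<longleftrightarrow> \<omega> \<in> A' \<inter> C'"
      using *(5,6) by eventually_elim auto
    ultimately show "A \<inter> C \<in> P'" using *(1,2) unfolding P'_def by blast
  qed
  moreover have "indep_set P' Q"
  proof (rule indep_setI)
    show "P' \<subseteq> events" by (auto simp: P'_def)
    show "Q \<subseteq> events" by fact
    fix A C assume "A \<in> P'" and C: "C \<in> Q"
    then obtain A' where A: "A \<in> events" "A' \<in> P" "AE \<omega> in M. \<omega> \<in> A \<longleftrightarrow> \<omega> \<in> A'"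
      by (auto simp: P'_def)
    have "prob A = prob A'"
      using A Pe by (intro measure_eq_AE) auto
    moreover have "prob (A \<inter> C) = prob (A' \<inter> C)"
    proof (rule measure_eq_AE)
      show "AE \<omega> in M. \<omega> \<in> A \<inter> C \<longleftrightarrow> \<omega> \<in> A' \<inter> C"
        using A(3) by eventually_elim auto
    qed (use A Pe Qe C in auto)
    ultimately show "prob (A \<inter> C) = prob A * prob C"
      using indep_setD[OF ind A(2) C] by simp
  qed
  ultimately have "indep_set (sigma_sets (space M) P') (sigma_sets (space M) Q)"
    using \<open>Int_stable Q\<close> by (intro indep_set_sigma_sets)
  moreover have "sigma_sets (space M) R \<subseteq> sigma_sets (space M) P'"
    using R by (intro sigma_sets_mono') (auto simp: P'_def)
  ultimately show ?thesis
    unfolding indep_sets2_eq by blast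
qed

lemma (in prob_space) indep_set_commute: "indep_set P Q \<Longrightarrow> indep_set Q P"
  unfolding indep_sets2_eq by (metis Int_commute mult.commute)

lemma (in prob_space) indep_set_mono:
  "indep_set P Q \<Longrightarrow> P' \<subseteq> P \<Longrightarrow> Q' \<subseteq> Q \<Longrightarrow> indep_set P' Q'"
  unfolding indep_sets2_eq by blast

lemma space_completed_filtration [simp]: "space (completed_natural_filtration M Z t) = space M"
  by (simp add: completed_natural_filtration_def space_measure_of_conv)

lemma sets_completed_filtration:
  "sets (completed_natural_filtration M Z t) = sigma_sets (space M) (process_events M {0..t} Z \<union> null_sets M)"
  unfolding completed_natural_filtration_def
  by (intro sets_measure_of) (auto simp: process_events_def dest: sets.sets_into_space)

lemma sets_completed_filtration_mono:
  "s \<le> t \<Longrightarrow> sets (completed_natural_filtration M Z s) \<subseteq> sets (completed_natural_filtration M Z t)"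
  unfolding sets_completed_filtration by (intro sigma_sets_mono') (fastforce simp: process_events_def)

lemma sets_completed_filtration_subset:
  assumes "\<And>t. 0 \<le> t \<Longrightarrow> Z t \<in> borel_measurable M"
  shows "sets (completed_natural_filtration M Z t) \<subseteq> sets M"
  unfolding sets_completed_filtration using assms
  by (intro sets.sigma_sets_subset) (auto simp: process_events_def intro!: measurable_sets)

lemma measurable_completed_filtration:
  assumes "0 \<le> s" "s \<le> t"
  shows "Z s \<in> borel_measurable (completed_natural_filtration M Z t)"
proof (rule measurableI)
  fix A :: "'b set" assume "A \<in> sets borel"
  then have "Z s -` A \<inter> space M \<in> process_events M {0..t} Z"
    using assms by (auto simp: process_events_def)
  then show "Z s -` A \<inter> space (completed_natural_filtration M Z t) \<in> sets (completed_natural_filtration M Z t)"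
    by (auto simp: sets_completed_filtration)
qed simp

lemma brownian_motion_measurable: "brownian_motion M W \<Longrightarrow> 0 \<le> t \<Longrightarrow> W t \<in> borel_measurable M"
  by (simp add: brownian_motion_def)

lemma Int_stable_vimage_sets: "Int_stable {Y -` C \<inter> space M | C. C \<in> sets N}"
proof (rule Int_stableI, clarify)
  fix C C' assume "C \<in> sets N" "C' \<in> sets N"
  then have "C \<inter> C' \<in> sets N" by auto
  then show "\<exists>D. (Y -` C \<inter> space M) \<inter> (Y -` C' \<inter> space M) = Y -` D \<inter> space M \<and> D \<in> sets N"
    by (intro exI[of _ "C \<inter> C'"]) auto
qed

lemma (in prob_space) indep_varI_indep_set:
  assumes ind: "indep_set P Q"
    and X: "X \<in> measurable M S" "\<And>A. A \<in> sets S \<Longrightarrow> X -` A \<inter> space M \<in> P"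
    and Y: "Y \<in> measurable M T" "\<And>A. A \<in> sets T \<Longrightarrow> Y -` A \<inter> space M \<in> Q"
  shows "indep_var S X T Y"
  unfolding indep_var_eq
proof (intro conjI X(1) Y(1) indep_set_sigma_sets Int_stable_vimage_sets)
  show "indep_set {X -` A \<inter> space M |A. A \<in> sets S} {Y -` A \<inter> space M |A. A \<in> sets T}"
    by (rule indep_set_mono[OF ind]) (use X(2) Y(2) in auto)
qed

text \<open>The past is generated, up to null sets, by the cylinder events in finitely many values of
  \<open>W q - W 0\<close>. Each value is a sum of increments over consecutive intervals that end before \<open>s\<close>, so a cylinder is
  independent of \<open>W t - W s\<close>. Subtracting \<open>W 0\<close> changes the cylinders
  by null sets only, because \<open>W 0\<close> vanishes almost surely.\<close>

lemma (in prob_space) brownian_increment_indep_past: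
  fixes W :: "real \<Rightarrow> 'a \<Rightarrow> real ^ 'm"
  assumes W: "brownian_motion M W" and st: "0 \<le> s" "s < t"
  shows "indep_set (sets (completed_natural_filtration M W s))
    {(\<lambda>\<omega>. W t \<omega> - W s \<omega>) -` C \<inter> space M | C. C \<in> sets borel}"
    (is "indep_set _ ?Q")
proof -
  have Wm: "W q \<in> borel_measurable M" if "0 \<le> q" for q
    using brownian_motion_measurable[OF W that] .
  define P where "P = {{\<omega>\<in>space M. \<forall>q\<in>J. W q \<omega> - W 0 \<omega> \<in> A q} | J A.
     finite J \<and> J \<subseteq> {0..s} \<and> (\<forall>q\<in>J. A q \<in> sets borel)}"
  have PI: "{\<omega>\<in>space M. \<forall>q\<in>J. W q \<omega> - W 0 \<omega> \<in> A q} \<in> P"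
    if "finite J" "J \<subseteq> {0..s}" "\<forall>q\<in>J. A q \<in> sets borel" for J A
    using that unfolding P_def by blast
  have cyl: "prob (a \<inter> c) = prob a * prob c" "a \<in> events" "c \<in> events" if "a \<in> P" "c \<in> ?Q" for a c
  proof -
    from \<open>a \<in> P\<close> obtain J A where JA: "finite J" "J \<subseteq> {0..s}" "\<forall>q\<in>J. A q \<in> sets borel"
      and a: "a = {\<omega>\<in>space M. \<forall>q\<in>J. W q \<omega> - W 0 \<omega> \<in> A q}"
      by (auto simp: P_def)
    from \<open>c \<in> ?Q\<close> obtain C where C: "C \<in> sets borel" and c: "c = (\<lambda>\<omega>. W t \<omega> - W s \<omega>) -` C \<inter> space M"
      by auto
    show "c \<in> events" unfolding c using Wm[of s] Wm[of t] C st by (auto intro!: measurable_sets)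
    have fin: "finite (J \<union> {0, s})" "J \<union> {0, s} \<noteq> {}"
      using JA(1) by auto
    obtain N :: nat and \<rho> :: "nat \<Rightarrow> real" where \<rho>: "\<And>i j. i < j \<Longrightarrow> j \<le> N \<Longrightarrow> \<rho> i < (\<rho> j :: real)" "\<rho> ` {..N} = J \<union> {0, s}"
      by (rule finite_set_enumeration[OF fin]) blast
    have ran: "\<rho> i \<in> {0..s}" if "i \<le> N" for i
    proof -
      have "\<rho> i \<in> \<rho> ` {..N}" using that by auto
      then show ?thesis using \<rho>(2) JA st by auto
    qed
    have mono: "\<rho> i \<le> \<rho> j" if "i \<le> j" "j \<le> N" for i j
      using \<rho>(1)[of i j] that by (cases "i = j") (auto intro: less_imp_le)
    have "0 \<in> \<rho> ` {..N}" using \<rho>(2) by auto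
    then obtain i0 where "i0 \<le> N" "\<rho> i0 = 0" by auto
    then have \<rho>0: "\<rho> 0 = 0" using ran[of 0] mono[of 0 i0] by auto
    have "s \<in> \<rho> ` {..N}" using \<rho>(2) by auto
    then obtain iN where "iN \<le> N" "\<rho> iN = s" by auto
    then have \<rho>N: "\<rho> N = s" using ran[of N] mono[of iN N] by auto
    define \<tau> where "\<tau> i = (if i \<le> N then \<rho> i else t)" for i
    have "incseq \<tau>"
      using mono ran st by (auto simp: incseq_def \<tau>_def) (meson less_imp_le order_trans)
    moreover have "0 \<le> \<tau> 0" by (simp add: \<tau>_def \<rho>0)
    ultimately have iv: "indep_vars (\<lambda>_. borel) (\<lambda>i \<omega>. W (\<tau> (Suc i)) \<omega> - W (\<tau> i) \<omega>) {..<Suc N}"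
      using W unfolding brownian_motion_def by blast
    define D where "D i \<omega> = W (\<tau> (Suc i)) \<omega> - W (\<tau> i) \<omega>" for i \<omega>
    have iv2: "indep_var (PiM {..<N} (\<lambda>_. borel)) (\<lambda>\<omega>. restrict (\<lambda>i. D i \<omega>) {..<N})
                     (PiM {N} (\<lambda>_. borel)) (\<lambda>\<omega>. restrict (\<lambda>i. D i \<omega>) {N})"
      by (rule indep_var_restrict[OF iv[folded D_def]]) auto
    have "\<forall>q\<in>J. \<exists>p\<le>N. \<rho> p = q" using \<rho>(2) by (metis UnI1 atMost_iff imageE)
    then obtain p where p: "\<And>q. q \<in> J \<Longrightarrow> p q \<le> N \<and> \<rho> (p q) = q" by metis
    have tele: "W q \<omega> - W 0 \<omega> = (\<Sum>i<p q. D i \<omega>)" if "q \<in> J" for q \<omega>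
    proof -
      have "(\<Sum>i<p q. D i \<omega>) = (\<Sum>i<p q. W (\<rho> (Suc i)) \<omega> - W (\<rho> i) \<omega>)"
        using p[OF that] by (intro sum.cong) (auto simp: D_def \<tau>_def)
      also have "\<dots> = W (\<rho> (p q)) \<omega> - W (\<rho> 0) \<omega>"
        using sum_lessThan_telescope[of "\<lambda>i. W (\<rho> i) \<omega>" "p q"] by simp
      finally show ?thesis using p[OF that] \<rho>0 by simp
    qed
    define E where "E = {d\<in>space (PiM {..<N} (\<lambda>_. borel :: (real ^ 'm) measure)). \<forall>q\<in>J. (\<Sum>i<p q. d i) \<in> A q}"
    have "(\<lambda>d. \<Sum>i<p q. d i) \<in> borel_measurable (PiM {..<N} (\<lambda>_. borel :: (real ^ 'm) measure))" if "q \<in> J" for q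
      using p[OF that] by (intro borel_measurable_sum measurable_component_singleton) auto
    then have E: "E \<in> sets (PiM {..<N} (\<lambda>_. borel))"
      unfolding E_def using JA by (intro sets.sets_Collect_finite_All) (auto intro: measurable_sets_Collect[where P="\<lambda>x. x \<in> A _"])
    define C' where "C' = {d\<in>space (PiM {N} (\<lambda>_. borel :: (real ^ 'm) measure)). d N \<in> C}"
    have "(\<lambda>d. d N) \<in> borel_measurable (PiM {N} (\<lambda>_. borel :: (real ^ 'm) measure))"
      by (rule measurable_component_singleton) auto
    then have C': "C' \<in> sets (PiM {N} (\<lambda>_. borel))"
      unfolding C'_def using C by (auto intro: measurable_sets_Collect[where P="\<lambda>x. x \<in> C"])
    have aE: "a = (\<lambda>\<omega>. restrict (\<lambda>i. D i \<omega>) {..<N}) -` E \<inter> space M"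
    proof -
      have "(\<Sum>i<p q. restrict (\<lambda>i. D i \<omega>) {..<N} i) = (\<Sum>i<p q. D i \<omega>)" if "q \<in> J" for q \<omega>
        using p[OF that] by (intro sum.cong) auto
      then show ?thesis
        unfolding a E_def using tele by (auto simp: space_PiM PiE_def)
    qed
    \<comment> \<open>The last increment \<open>D N\<close> is \<open>W t - W s\<close>, since \<open>\<tau> N = s\<close> and \<open>\<tau> (Suc N) = t\<close>.\<close>
    have cE: "c = (\<lambda>\<omega>. restrict (\<lambda>i. D i \<omega>) {N}) -` C' \<inter> space M"
      unfolding c C'_def using \<rho>N by (auto simp: space_PiM PiE_def D_def \<tau>_def)
    show "a \<in> events"
      unfolding aE using indep_var_rv1[OF iv2] E by (rule measurable_sets)
    have "a \<inter> c = (\<lambda>\<omega>. (restrict (\<lambda>i. D i \<omega>) {..<N}, restrict (\<lambda>i. D i \<omega>) {N})) -` (E \<times> C') \<inter> space M"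
      unfolding aE cE by auto
    then show "prob (a \<inter> c) = prob a * prob c"
      using indep_varD[OF iv2 E C'] aE cE by simp
  qed
  have emptyP: "{} \<in> P"
    using PI[of "{0}" "\<lambda>_. {}"] st by auto
  have emptyQ: "{} \<in> ?Q" by (rule CollectI, rule exI[of _ "{}"]) auto
  have "indep_set P ?Q"
    by (rule indep_setI) (use cyl emptyP emptyQ in blast)+
  moreover have "Int_stable P"
  proof (rule Int_stableI)
    fix a a' assume "a \<in> P" "a' \<in> P"
    then obtain J A J' A' where JA: "finite J" "J \<subseteq> {0..s}" "\<forall>q\<in>J. A q \<in> sets borel"
       "finite J'" "J' \<subseteq> {0..s}" "\<forall>q\<in>J'. A' q \<in> sets borel"
      and a: "a = {\<omega>\<in>space M. \<forall>q\<in>J. W q \<omega> - W 0 \<omega> \<in> A q}"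
         "a' = {\<omega>\<in>space M. \<forall>q\<in>J'. W q \<omega> - W 0 \<omega> \<in> A' q}"
      by (auto simp: P_def)
    define A'' where "A'' q = (if q \<in> J then A q else UNIV) \<inter> (if q \<in> J' then A' q else UNIV)" for q
    have "a \<inter> a' = {\<omega>\<in>space M. \<forall>q\<in>J \<union> J'. W q \<omega> - W 0 \<omega> \<in> A'' q}"
      unfolding a A''_def by auto
    also have "\<dots> \<in> P" by (rule PI) (use JA in \<open>auto simp: A''_def\<close>)
    finally show "a \<inter> a' \<in> P" .
  qed
  moreover have "A \<in> events \<and> (\<exists>A'\<in>P. AE \<omega> in M. \<omega> \<in> A \<longleftrightarrow> \<omega> \<in> A')"
    if A: "A \<in> process_events M {0..s} W \<union> null_sets M" for A
  proof (cases "A \<in> null_sets M")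
    case True
    then have "AE \<omega> in M. \<omega> \<in> A \<longleftrightarrow> \<omega> \<in> {}"
      by (auto dest: AE_not_in)
    with True emptyP show ?thesis by blast
  next
    case False
    with A obtain q C where q: "q \<in> {0..s}" "C \<in> sets borel" "A = W q -` C \<inter> space M"
      by (auto simp: process_events_def)
    have 0: "AE \<omega> in M. W 0 \<omega> = 0" using W by (simp add: brownian_motion_def)
    have "AE \<omega> in M. \<omega> \<in> A \<longleftrightarrow> \<omega> \<in> {\<omega>\<in>space M. \<forall>q\<in>{q}. W q \<omega> - W 0 \<omega> \<in> C}"
      using 0 by eventually_elim (auto simp: q)
    moreover have "{\<omega>\<in>space M. \<forall>q\<in>{q}. W q \<omega> - W 0 \<omega> \<in> C} \<in> P"
      by (rule PI) (use q in auto)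
    moreover have "A \<in> events" using Wm[of q] q by (auto intro!: measurable_sets)
    ultimately show ?thesis by blast
  qed
  ultimately have "indep_set (sigma_sets (space M) (process_events M {0..s} W \<union> null_sets M)) (sigma_sets (space M) ?Q)"
    by (intro indep_set_modulo_null[of P ?Q] Int_stable_vimage_sets)
  then show ?thesis
    unfolding sets_completed_filtration by (rule indep_set_mono) (auto intro: sigma_sets.Basic)
qed

text \<open>The null sets are adjoined to one of the two sigma-algebras at a time.\<close>

lemma (in prob_space) independent_processes_completed:
  assumes ind: "independent_processes M Y Z"
    and Y: "\<And>t. 0 \<le> t \<Longrightarrow> Y t \<in> borel_measurable M" and Z: "\<And>t. 0 \<le> t \<Longrightarrow> Z t \<in> borel_measurable M"
  shows "indep_set (sigma_sets (space M) (process_events M {0..} Y \<union> null_sets M))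
                   (sigma_sets (space M) (process_events M {0..} Z \<union> null_sets M))"
proof -
  have Y: "\<forall>t\<ge>0. Y t \<in> borel_measurable M" and Z: "\<forall>t\<ge>0. Z t \<in> borel_measurable M"
    using Y Z by auto
  have Int: "Int_stable (sigma_sets (space M) A)" if "A \<subseteq> events" for A
    using sets.Int_stable[of "sigma (space M) A"] that sets.sets_into_space
    by (subst (asm) sets_measure_of) auto
  have pe: "process_events M {0..} Y' \<union> null_sets M \<subseteq> events" if "\<forall>t\<ge>0. Y' t \<in> borel_measurable M"
    for Y' :: "real \<Rightarrow> 'a \<Rightarrow> 'z::topological_space"
    using that by (auto simp: process_events_def intro!: measurable_sets)
  have sub: "process_events M {0..} Y' \<subseteq> Pow (space M)" and sub': "process_events M {0..} Y' \<union> null_sets M \<subseteq> Pow (space M)"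
    if "\<forall>t\<ge>0. Y' t \<in> borel_measurable M"
    for Y' :: "real \<Rightarrow> 'a \<Rightarrow> 'z::topological_space"
    using order.trans[OF pe[of Y', OF that] sets.space_closed] by blast+
  have modn: "A \<in> events \<and> (\<exists>A'\<in>sigma_sets (space M) (process_events M {0..} Y'). AE \<omega> in M. \<omega> \<in> A \<longleftrightarrow> \<omega> \<in> A')"
    if A: "A \<in> process_events M {0..} Y' \<union> null_sets M" and Y': "\<forall>t\<ge>0. Y' t \<in> borel_measurable M"
    for A and Y' :: "real \<Rightarrow> 'a \<Rightarrow> 'z::topological_space"
  proof (cases "A \<in> null_sets M")
    case True
    then have "AE \<omega> in M. \<omega> \<in> A \<longleftrightarrow> \<omega> \<in> {}"
      by (auto dest: AE_not_in)
    with True show ?thesis using sigma_sets.Empty by blast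
  next
    case False
    then have "A \<in> sigma_sets (space M) (process_events M {0..} Y')" using A by (auto intro: sigma_sets.Basic)
    moreover have "A \<in> events" using A pe[of Y', OF Y'] by blast
    ultimately show ?thesis by blast
  qed
  have 1: "indep_set (sigma_sets (space M) (process_events M {0..} Y)) (sigma_sets (space M) (process_events M {0..} Z))"
    using ind by (simp add: independent_processes_def)
  let ?Y = "process_events M {0..} Y" and ?Z = "process_events M {0..} Z"
  have IntZ: "Int_stable (sigma_sets (space M) ?Z)" and IntY: "Int_stable (sigma_sets (space M) ?Y)"
    and IntYn: "Int_stable (sigma_sets (space M) (?Y \<union> null_sets M))"
    using pe[of Y, OF Y] pe[of Z, OF Z] by (intro Int; blast)+
  have "indep_set (sigma_sets (space M) (?Y \<union> null_sets M)) (sigma_sets (space M) (sigma_sets (space M) ?Z))"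
    using 1 IntY IntZ modn[of _ Y, OF _ Y] by (rule indep_set_modulo_null)
  then have 2: "indep_set (sigma_sets (space M) (?Y \<union> null_sets M)) (sigma_sets (space M) ?Z)"
    unfolding sigma_sets_sigma_sets_eq[OF sub[of Z, OF Z]] .
  have "indep_set (sigma_sets (space M) (?Z \<union> null_sets M)) (sigma_sets (space M) (sigma_sets (space M) (?Y \<union> null_sets M)))"
    using indep_set_commute[OF 2] IntZ IntYn modn[of _ Z, OF _ Z] by (rule indep_set_modulo_null)
  then show ?thesis
    unfolding sigma_sets_sigma_sets_eq[OF sub'[of Y, OF Y]] by (rule indep_set_commute)
qed

lemma sets_completed_filtration_subset_process_sigma:
  "sets (completed_natural_filtration M Y t) \<subseteq> sigma_sets (space M) (process_events M {0..} Y \<union> null_sets M)"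
  unfolding sets_completed_filtration by (intro sigma_sets_mono') (fastforce simp: process_events_def)

text \<open>The past of the pair is generated by intersections of a past event of \<open>Y\<close> and a past event of
  \<open>Z\<close>. The second factor is independent of everything that \<open>Y\<close> generates, in particular of
  the first factor together with the increment.\<close>

lemma (in prob_space) brownian_increment_indep_joint_past:
  fixes Y :: "real \<Rightarrow> 'a \<Rightarrow> real ^ 'm" and Z :: "real \<Rightarrow> 'a \<Rightarrow> real ^ 'k"
  assumes W: "brownian_motion M Y" and Z: "\<And>t. 0 \<le> t \<Longrightarrow> Z t \<in> borel_measurable M"
    and ind: "independent_processes M Y Z" and st: "0 \<le> s" "s < t"
  shows "indep_set (sigma_sets (space M) (process_events M {0..s} Y \<union> process_events M {0..s} Z \<union> null_sets M))
    {(\<lambda>\<omega>. Y t \<omega> - Y s \<omega>) -` C \<inter> space M | C. C \<in> sets borel}" (is "indep_set _ ?Q")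
proof -
  have Ym: "Y q \<in> borel_measurable M" if "0 \<le> q" for q using brownian_motion_measurable[OF W that] .
  let ?FY = "completed_natural_filtration M Y" and ?FZ = "completed_natural_filtration M Z"
  define P where "P = {A \<inter> A1 | A A1. A \<in> sets (?FY s) \<and> A1 \<in> sets (?FZ s)}"
  note past = brownian_increment_indep_past[OF W st]
  note ind' = independent_processes_completed[OF ind Ym Z]
  have FYe: "sets (?FY s) \<subseteq> events" and FZe: "sets (?FZ s) \<subseteq> events"
    using sets_completed_filtration_subset[of Y M s] sets_completed_filtration_subset[of Z M s] Ym Z by auto
  have "Int_stable P"
  proof (rule Int_stableI)
    fix a b assume "a \<in> P" "b \<in> P"
    then obtain A A1 C C1 where *: "a = A \<inter> A1" "b = C \<inter> C1" "A \<in> sets (?FY s)" "A1 \<in> sets (?FZ s)"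
      "C \<in> sets (?FY s)" "C1 \<in> sets (?FZ s)" by (auto simp: P_def)
    have "a \<inter> b = (A \<inter> C) \<inter> (A1 \<inter> C1)" using * by auto
    then show "a \<inter> b \<in> P" using * unfolding P_def by blast
  qed
  moreover have "indep_set P ?Q"
  proof (rule indep_setI)
    show "P \<subseteq> events" using FYe FZe by (auto simp: P_def)
    show "?Q \<subseteq> events" using indep_setD_ev2[OF past] .
    fix a c assume "a \<in> P" and c: "c \<in> ?Q"
    then obtain A A1 where a: "a = A \<inter> A1" "A \<in> sets (?FY s)" "A1 \<in> sets (?FZ s)" by (auto simp: P_def)
    obtain C where C: "c = (\<lambda>\<omega>. Y t \<omega> - Y s \<omega>) -` C \<inter> space M" "C \<in> sets borel" using c by auto
    have "(\<lambda>\<omega>. Y t \<omega> - Y s \<omega>) \<in> borel_measurable (?FY t)"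
      using st by (intro borel_measurable_diff measurable_completed_filtration) auto
    from measurable_sets[OF this C(2)] have "c \<in> sets (?FY t)" using C by simp
    moreover have "A \<in> sets (?FY t)" using a sets_completed_filtration_mono[of s t M Y] st by auto
    ultimately have "A \<inter> c \<in> sets (?FY t)" by auto
    then have Ac: "A \<inter> c \<in> sigma_sets (space M) (process_events M {0..} Y \<union> null_sets M)"
      using sets_completed_filtration_subset_process_sigma by blast
    have A: "A \<in> sigma_sets (space M) (process_events M {0..} Y \<union> null_sets M)"
      using a sets_completed_filtration_subset_process_sigma by blast
    have A1: "A1 \<in> sigma_sets (space M) (process_events M {0..} Z \<union> null_sets M)"
      using a sets_completed_filtration_subset_process_sigma by blast
    have "prob (a \<inter> c) = prob ((A \<inter> c) \<inter> A1)" using a by (simp add: Int_ac)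
    also have "\<dots> = prob (A \<inter> c) * prob A1" using indep_setD[OF ind' Ac A1] .
    also have "\<dots> = prob A * prob c * prob A1" using indep_setD[OF past a(2) c] by simp
    also have "\<dots> = prob a * prob c" using indep_setD[OF ind' A A1] a by simp
    finally show "prob (a \<inter> c) = prob a * prob c" .
  qed
  ultimately have "indep_set (sigma_sets (space M) P) (sigma_sets (space M) ?Q)"
    by (intro indep_set_sigma_sets Int_stable_vimage_sets)
  moreover have "sigma_sets (space M) (process_events M {0..s} Y \<union> process_events M {0..s} Z \<union> null_sets M) \<subseteq> sigma_sets (space M) P"
  proof (intro sigma_sets_mono' subsetI)
    fix A assume A: "A \<in> process_events M {0..s} Y \<union> process_events M {0..s} Z \<union> null_sets M"
    then have "A \<subseteq> space M" by (auto simp: process_events_def dest: sets.sets_into_space)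
    moreover have "space M \<in> sets (?FY s)" "space M \<in> sets (?FZ s)"
      using sets.top[of "?FY s"] sets.top[of "?FZ s"] by auto
    moreover have "A \<in> sets (?FY s) \<or> A \<in> sets (?FZ s)"
      using A by (auto simp: sets_completed_filtration)
    ultimately show "A \<in> P"
      unfolding P_def by (metis (mono_tags, lifting) Int_absorb1 Int_absorb2 mem_Collect_eq)
  qed
  moreover have "?Q \<subseteq> sigma_sets (space M) ?Q" by (rule sigma_sets_superset_generator)
  ultimately show ?thesis
    by (rule indep_set_mono)
qed

section \<open>Gaussian vectors\<close>

lemma nn_integral_lborel_vec_prod:
  fixes g :: "'n::finite \<Rightarrow> real \<Rightarrow> ennreal"
  assumes [measurable]: "\<And>i. g i \<in> borel_measurable borel"
  shows "(\<integral>\<^sup>+y. (\<Prod>i\<in>UNIV. g i (y $ i)) \<partial>(lborel :: (real ^ 'n) measure)) = (\<Prod>i\<in>UNIV. \<integral>\<^sup>+z. g i z \<partial>lborel)"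
proof -
  define ix :: "real ^ 'n \<Rightarrow> 'n" where "ix e = (SOME i. e = axis i 1)" for e
  have Basis: "(Basis :: (real ^ 'n) set) = (\<lambda>i. axis i 1) ` UNIV"
    by (auto simp: Basis_vec_def)
  have inj: "inj (\<lambda>i. axis i 1 :: real ^ 'n)"
    by (auto simp: inj_on_def axis_eq_axis)
  have ix: "ix (axis i 1) = i" for i
    by (simp add: ix_def axis_eq_axis)
  have "(\<integral>\<^sup>+y. (\<Prod>e\<in>Basis. g (ix e) (y \<bullet> e)) \<partial>(lborel :: (real ^ 'n) measure)) = (\<Prod>e\<in>(Basis :: (real ^ 'n) set). \<integral>\<^sup>+z. g (ix e) z \<partial>lborel)"
    by (intro nn_integral_lborel_prod) auto
  then show ?thesis
    unfolding Basis prod.reindex[OF inj] by (simp add: ix inner_axis)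
qed

lemma nn_integral_normal_density_eq_1: "0 < \<sigma> \<Longrightarrow> (\<integral>\<^sup>+z. ennreal (normal_density \<mu> \<sigma> z) \<partial>lborel) = 1"
  using prob_space.emeasure_space_1[OF prob_space_normal_density[of \<sigma> \<mu>]] by (simp add: emeasure_density)

text \<open>The density is a product, and the other factors integrate to 1.\<close>

lemma (in prob_space) gaussian_vector_component:
  fixes Y :: "'a \<Rightarrow> real ^ 'm"
  assumes Y: "distributed M lborel Y (\<lambda>y. ennreal (\<Prod>i\<in>UNIV. normal_density 0 \<sigma> (y $ i)))" and \<sigma>: "0 < \<sigma>"
  shows "distributed M lborel (\<lambda>\<omega>. Y \<omega> $ a) (normal_density 0 \<sigma>)"
  unfolding distributed_def
proof (intro conjI)
  have [measurable]: "Y \<in> borel_measurable M" using distributed_measurable[OF Y] unfolding measurable_lborel1 .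
  show "(\<lambda>\<omega>. Y \<omega> $ a) \<in> measurable M lborel" by simp
  show "distr M lborel (\<lambda>\<omega>. Y \<omega> $ a) = density lborel (normal_density 0 \<sigma>)"
  proof (rule measure_eqI)
    fix A assume "A \<in> sets (distr M lborel (\<lambda>\<omega>. Y \<omega> $ a))"
    then have A[measurable]: "A \<in> sets borel" by simp
    have "emeasure (distr M lborel (\<lambda>\<omega>. Y \<omega> $ a)) A = (\<integral>\<^sup>+\<omega>. indicator A (Y \<omega> $ a) \<partial>M)"
      by (simp add: nn_integral_indicator[symmetric] nn_integral_distr del: nn_integral_indicator)
    also have "\<dots> = (\<integral>\<^sup>+y. ennreal (\<Prod>i\<in>UNIV. normal_density 0 \<sigma> (y $ i)) * indicator A (y $ a) \<partial>lborel)"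
      using distributed_nn_integral[OF Y, of "\<lambda>y. indicator A (y $ a)"] by simp
    also have "\<dots> = (\<integral>\<^sup>+y. (\<Prod>i\<in>UNIV. ennreal (normal_density 0 \<sigma> (y $ i)) * (if i = a then indicator A (y $ i) else 1)) \<partial>lborel)"
      by (simp add: prod.distrib prod_ennreal)
    also have "\<dots> = (\<Prod>i\<in>UNIV. \<integral>\<^sup>+z. ennreal (normal_density 0 \<sigma> z) * (if i = a then indicator A z else 1) \<partial>lborel)"
      by (rule nn_integral_lborel_vec_prod) measurable
    also have "\<dots> = (\<Prod>i\<in>UNIV. if i = a then (\<integral>\<^sup>+z. ennreal (normal_density 0 \<sigma> z) * indicator A z \<partial>lborel) else 1)"
      using \<sigma> by (intro prod.cong) (auto simp: nn_integral_normal_density_eq_1)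
    also have "\<dots> = emeasure (density lborel (normal_density 0 \<sigma>)) A"
      by (simp add: emeasure_density)
    finally show "emeasure (distr M lborel (\<lambda>\<omega>. Y \<omega> $ a)) A = emeasure (density lborel (normal_density 0 \<sigma>)) A" .
  qed simp
qed simp

definition gaussian_vec_density :: "real \<Rightarrow> real ^ 'n \<Rightarrow> real" where
  "gaussian_vec_density \<sigma> y = (\<Prod>i\<in>UNIV. normal_density 0 \<sigma> (y $ i))"

lemma gaussian_vec_density_measurable [measurable]: "gaussian_vec_density \<sigma> \<in> borel_measurable borel"
  unfolding gaussian_vec_density_def[abs_def] by measurable

lemma gaussian_vec_density_nonneg: "0 \<le> gaussian_vec_density \<sigma> y"
  by (simp add: gaussian_vec_density_def prod_nonneg)

lemma (in prob_space) nn_integral_indep_var: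
  assumes ind: "indep_var S X T Y" and h: "h \<in> borel_measurable (S \<Otimes>\<^sub>M T)"
  shows "(\<integral>\<^sup>+\<omega>. h (X \<omega>, Y \<omega>) \<partial>M) = (\<integral>\<^sup>+x. (\<integral>\<^sup>+y. h (x, y) \<partial>distr M T Y) \<partial>distr M S X)"
proof -
  have X: "X \<in> measurable M S" and Y: "Y \<in> measurable M T"
    using indep_var_rv1[OF ind] indep_var_rv2[OF ind] .
  interpret Y: prob_space "distr M T Y" using Y by (rule prob_space_distr)
  have "(\<integral>\<^sup>+\<omega>. h (X \<omega>, Y \<omega>) \<partial>M) = (\<integral>\<^sup>+p. h p \<partial>distr M (S \<Otimes>\<^sub>M T) (\<lambda>\<omega>. (X \<omega>, Y \<omega>)))"
    using X Y h by (subst nn_integral_distr) auto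
  also have "\<dots> = (\<integral>\<^sup>+p. h p \<partial>(distr M S X \<Otimes>\<^sub>M distr M T Y))"
    using ind by (simp add: indep_var_distribution_eq)
  also have "\<dots> = (\<integral>\<^sup>+x. (\<integral>\<^sup>+y. h (x, y) \<partial>distr M T Y) \<partial>distr M S X)"
    using h by (subst Y.nn_integral_fst[symmetric]) (auto cong: measurable_cong_sets)
  finally show ?thesis .
qed

lemma emeasure_vimage_eq_nn_integral:
  assumes "Y \<in> measurable M N" "A \<in> sets N"
  shows "emeasure M (Y -` A \<inter> space M) = (\<integral>\<^sup>+\<omega>. indicator A (Y \<omega>) \<partial>M)"
proof -
  have "(\<integral>\<^sup>+\<omega>. indicator A (Y \<omega>) \<partial>M) = (\<integral>\<^sup>+\<omega>. indicator (Y -` A \<inter> space M) \<omega> \<partial>M)"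
    by (intro nn_integral_cong) (auto split: split_indicator)
  then show ?thesis using measurable_sets[OF assms] by simp
qed

lemma distributed_lborelI:
  assumes Y: "Y \<in> borel_measurable M" and f: "f \<in> borel_measurable borel"
    and eq: "\<And>A. A \<in> sets borel \<Longrightarrow> emeasure M (Y -` A \<inter> space M) = (\<integral>\<^sup>+y. f y * indicator A y \<partial>lborel)"
  shows "distributed M lborel Y f"
  unfolding distributed_def
  using Y f eq by (auto intro!: measure_eqI simp: emeasure_distr emeasure_density)

lemma (in prob_space) gaussian_vector_scale:
  fixes Y :: "'a \<Rightarrow> real ^ 'n"
  assumes Y: "distributed M lborel Y (\<lambda>y. ennreal (gaussian_vec_density \<sigma> y))" and \<sigma>: "0 < \<sigma>" and c: "0 < c"
  shows "distributed M lborel (\<lambda>\<omega>. c *\<^sub>R Y \<omega>) (\<lambda>y. ennreal (gaussian_vec_density (c * \<sigma>) y))"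
proof (rule distributed_lborelI)
  have [measurable]: "Y \<in> borel_measurable M" using distributed_measurable[OF Y] by simp
  show "(\<lambda>\<omega>. c *\<^sub>R Y \<omega>) \<in> borel_measurable M" by measurable
  show "(\<lambda>y. ennreal (gaussian_vec_density (c * \<sigma>) y)) \<in> borel_measurable borel" by measurable
  fix A :: "(real ^ 'n) set" assume A[measurable]: "A \<in> sets borel"
  have nd: "normal_density 0 (c * \<sigma>) (c * q) * c = normal_density 0 \<sigma> q" for q
    using c \<sigma> by (simp add: normal_density_def power_mult_distrib real_sqrt_mult)
  have gd: "gaussian_vec_density (c * \<sigma>) (c *\<^sub>R y) * c ^ CARD('n) = gaussian_vec_density \<sigma> y" for y :: "real ^ 'n"
    unfolding gaussian_vec_density_def by (simp add: nd[symmetric] prod.distrib)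
  have "emeasure M ((\<lambda>\<omega>. c *\<^sub>R Y \<omega>) -` A \<inter> space M) = (\<integral>\<^sup>+\<omega>. indicator A (c *\<^sub>R Y \<omega>) \<partial>M)"
    by (simp add: emeasure_vimage_eq_nn_integral[where N = borel])
  also have "\<dots> = (\<integral>\<^sup>+y. ennreal (gaussian_vec_density \<sigma> y) * indicator A (c *\<^sub>R y) \<partial>lborel)"
    using distributed_nn_integral[OF Y, of "\<lambda>y. indicator A (c *\<^sub>R y)"] by simp
  also have "\<dots> = (\<integral>\<^sup>+y. ennreal (c ^ CARD('n)) * (ennreal (gaussian_vec_density (c * \<sigma>) (c *\<^sub>R y)) * indicator A (c *\<^sub>R y)) \<partial>lborel)"
    using c by (intro nn_integral_cong) (simp add: gd[symmetric] ennreal_mult gaussian_vec_density_nonneg mult_ac)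
  also have "\<dots> = (\<integral>\<^sup>+y. ennreal (gaussian_vec_density (c * \<sigma>) y) * indicator A y \<partial>lborel)"
    using c by (subst (2) lborel_affine[of c "0 :: real ^ 'n"]) (simp_all add: nn_integral_density nn_integral_distr)
  finally show "emeasure M ((\<lambda>\<omega>. c *\<^sub>R Y \<omega>) -` A \<inter> space M) = \<dots>" .
qed

lemma gaussian_vec_density_convolution:
  fixes z :: "real ^ 'n"
  assumes "0 < \<sigma>" "0 < \<tau>"
  shows "(\<integral>\<^sup>+x. ennreal (gaussian_vec_density \<sigma> x) * ennreal (gaussian_vec_density \<tau> (z - x)) \<partial>lborel) =
     ennreal (gaussian_vec_density (sqrt (\<sigma>\<^sup>2 + \<tau>\<^sup>2)) z)"
proof -
  have conv: "(\<integral>\<^sup>+q. ennreal (normal_density 0 \<sigma> q * normal_density 0 \<tau> (p - q)) \<partial>lborel) = ennreal (normal_density 0 (sqrt (\<sigma>\<^sup>2 + \<tau>\<^sup>2)) p)" for p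
    using fun_cong[OF conv_normal_density_zero_mean[OF assms(2,1)], of p] by (simp add: mult.commute add.commute)
  have "(\<integral>\<^sup>+x. ennreal (gaussian_vec_density \<sigma> x) * ennreal (gaussian_vec_density \<tau> (z - x)) \<partial>lborel) =
     (\<integral>\<^sup>+x. (\<Prod>i\<in>UNIV. ennreal (normal_density 0 \<sigma> (x $ i) * normal_density 0 \<tau> (z $ i - x $ i))) \<partial>lborel)"
    by (simp add: gaussian_vec_density_def ennreal_mult[symmetric] prod_nonneg prod_ennreal prod.distrib)
  also have "\<dots> = (\<Prod>i\<in>UNIV. \<integral>\<^sup>+q. ennreal (normal_density 0 \<sigma> q * normal_density 0 \<tau> (z $ i - q)) \<partial>lborel)"
    by (rule nn_integral_lborel_vec_prod) measurable
  also have "\<dots> = ennreal (gaussian_vec_density (sqrt (\<sigma>\<^sup>2 + \<tau>\<^sup>2)) z)"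
    unfolding conv by (simp add: gaussian_vec_density_def prod_ennreal)
  finally show ?thesis .
qed

lemma nn_integral_lborel_translate:
  fixes x :: "'c::euclidean_space"
  assumes [measurable]: "f \<in> borel_measurable borel"
  shows "(\<integral>\<^sup>+y. f (x + y) \<partial>lborel) = (\<integral>\<^sup>+y. f y \<partial>lborel)"
proof -
  have "(\<integral>\<^sup>+y. f y \<partial>lborel) = (\<integral>\<^sup>+y. f y \<partial>distr lborel borel ((+) x))"
    by (simp add: lborel_distr_plus)
  also have "\<dots> = (\<integral>\<^sup>+y. f (x + y) \<partial>lborel)" by (simp add: nn_integral_distr)
  finally show ?thesis by simp
qed

text \<open>Independence turns the law of the sum into a convolution, and the convolution of product densities
  factors over the coordinates into one-dimensional Gaussian convolutions.\<close>

lemma (in prob_space) gaussian_vector_add: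
  fixes X Y :: "'a \<Rightarrow> real ^ 'n"
  assumes ind: "indep_var borel X borel Y" and \<sigma>: "0 < \<sigma>" and \<tau>: "0 < \<tau>"
    and X: "distributed M lborel X (\<lambda>y. ennreal (gaussian_vec_density \<sigma> y))"
    and Y: "distributed M lborel Y (\<lambda>y. ennreal (gaussian_vec_density \<tau> y))"
  shows "distributed M lborel (\<lambda>\<omega>. X \<omega> + Y \<omega>) (\<lambda>y. ennreal (gaussian_vec_density (sqrt (\<sigma>\<^sup>2 + \<tau>\<^sup>2)) y))"
proof (rule distributed_lborelI)
  have [measurable]: "X \<in> borel_measurable M" "Y \<in> borel_measurable M"
    using distributed_measurable[OF X] distributed_measurable[OF Y] by auto
  show "(\<lambda>\<omega>. X \<omega> + Y \<omega>) \<in> borel_measurable M" by measurable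
  show "(\<lambda>y. ennreal (gaussian_vec_density (sqrt (\<sigma>\<^sup>2 + \<tau>\<^sup>2)) y :: real)) \<in> borel_measurable borel" by measurable
  fix A :: "(real ^ 'n) set" assume A[measurable]: "A \<in> sets borel"
  have dX: "distr M borel X = density lborel (gaussian_vec_density \<sigma>)" and dY: "distr M borel Y = density lborel (gaussian_vec_density \<tau>)"
    using distributed_distr_eq_density[OF X] distributed_distr_eq_density[OF Y] by (simp_all cong: distr_cong)
  have "emeasure M ((\<lambda>\<omega>. X \<omega> + Y \<omega>) -` A \<inter> space M) = (\<integral>\<^sup>+\<omega>. indicator A (X \<omega> + Y \<omega>) \<partial>M)"
    by (simp add: emeasure_vimage_eq_nn_integral[where N = borel])
  also have "\<dots> = (\<integral>\<^sup>+x. (\<integral>\<^sup>+y. indicator A (x + y) \<partial>distr M borel Y) \<partial>distr M borel X)"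
    using nn_integral_indep_var[OF ind, of "\<lambda>p. indicator A (fst p + snd p)"] by simp
  also have "\<dots> = (\<integral>\<^sup>+x. ennreal (gaussian_vec_density \<sigma> x) * (\<integral>\<^sup>+y. ennreal (gaussian_vec_density \<tau> y) * indicator A (x + y) \<partial>lborel) \<partial>lborel)"
    unfolding dX dY by (subst (1 2) nn_integral_density) (auto intro!: lborel.borel_measurable_nn_integral)
  also have "\<dots> = (\<integral>\<^sup>+x. ennreal (gaussian_vec_density \<sigma> x) * (\<integral>\<^sup>+y. ennreal (gaussian_vec_density \<tau> (y - x)) * indicator A y \<partial>lborel) \<partial>lborel)"
  proof -
    have "(\<integral>\<^sup>+y. ennreal (gaussian_vec_density \<tau> y) * indicator A (x + y) \<partial>lborel) =
        (\<integral>\<^sup>+y. ennreal (gaussian_vec_density \<tau> (y - x)) * indicator A y \<partial>lborel)" for x :: "real ^ 'n"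
      using nn_integral_lborel_translate[of "\<lambda>y. ennreal (gaussian_vec_density \<tau> (y - x)) * indicator A y" x] by simp
    then show ?thesis by simp
  qed
  also have "\<dots> = (\<integral>\<^sup>+x. (\<integral>\<^sup>+y. ennreal (gaussian_vec_density \<sigma> x) * ennreal (gaussian_vec_density \<tau> (y - x)) * indicator A y \<partial>lborel) \<partial>lborel)"
    by (simp add: nn_integral_cmult[symmetric] mult.assoc)
  also have "\<dots> = (\<integral>\<^sup>+y. (\<integral>\<^sup>+x. ennreal (gaussian_vec_density \<sigma> x) * ennreal (gaussian_vec_density \<tau> (y - x)) * indicator A y \<partial>lborel) \<partial>lborel)"
    by (rule lborel_pair.Fubini'[symmetric]) measurable
  also have "\<dots> = (\<integral>\<^sup>+y. ennreal (gaussian_vec_density (sqrt (\<sigma>\<^sup>2 + \<tau>\<^sup>2)) y) * indicator A y \<partial>lborel)"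
    by (simp add: nn_integral_multc gaussian_vec_density_convolution[OF \<sigma> \<tau>])
  finally show "emeasure M ((\<lambda>\<omega>. X \<omega> + Y \<omega>) -` A \<inter> space M) = \<dots>" .
qed

text \<open>Conditionally on \<open>X\<close>, the probability that \<open>X + Y\<close> lies in \<open>A\<close> is the integral of the density of
  \<open>Y\<close> over a translate of \<open>A\<close>, and translation preserves Lebesgue measure.\<close>

lemma (in prob_space) emeasure_indep_sum_le_density_bound:
  fixes X Y :: "'a \<Rightarrow> real ^ 'n"
  assumes ind: "indep_var borel X borel Y" and Y: "distributed M lborel Y f"
    and f: "\<And>y. f y \<le> c" and A[measurable]: "A \<in> sets borel"
  shows "emeasure M {\<omega>\<in>space M. X \<omega> + Y \<omega> \<in> A} \<le> c * emeasure lborel A"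
proof -
  have [measurable]: "X \<in> borel_measurable M" "Y \<in> borel_measurable M" "f \<in> borel_measurable borel"
    using indep_var_rv1[OF ind] distributed_measurable[OF Y] distributed_borel_measurable[OF Y] by auto
  have dY: "distr M borel Y = density lborel f"
    using distributed_distr_eq_density[OF Y] by (simp cong: distr_cong)
  interpret X: prob_space "distr M borel X" by (rule prob_space_distr) simp
  have "{\<omega>\<in>space M. X \<omega> + Y \<omega> \<in> A} = (\<lambda>\<omega>. X \<omega> + Y \<omega>) -` A \<inter> space M" by auto
  then have "emeasure M {\<omega>\<in>space M. X \<omega> + Y \<omega> \<in> A} = (\<integral>\<^sup>+\<omega>. indicator A (X \<omega> + Y \<omega>) \<partial>M)"
    by (simp add: emeasure_vimage_eq_nn_integral[where N = borel])
  also have "\<dots> = (\<integral>\<^sup>+x. (\<integral>\<^sup>+y. indicator A (x + y) \<partial>distr M borel Y) \<partial>distr M borel X)"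
    using nn_integral_indep_var[OF ind, of "\<lambda>p. indicator A (fst p + snd p)"] by simp
  also have "\<dots> \<le> (\<integral>\<^sup>+x. c * emeasure lborel A \<partial>distr M borel X)"
  proof (rule nn_integral_mono)
    fix x
    have "(\<integral>\<^sup>+y. indicator A (x + y) \<partial>distr M borel Y) = (\<integral>\<^sup>+y. f y * indicator A (x + y) \<partial>lborel)"
      unfolding dY by (subst nn_integral_density) auto
    also have "\<dots> \<le> (\<integral>\<^sup>+y. c * indicator A (x + y) \<partial>lborel)"
      using f by (intro nn_integral_mono mult_right_mono) auto
    also have "\<dots> = c * (\<integral>\<^sup>+y. indicator A y \<partial>lborel)"
      using nn_integral_lborel_translate[of "indicator A" x] by (simp add: nn_integral_cmult)
    finally show "(\<integral>\<^sup>+y. indicator A (x + y) \<partial>distr M borel Y) \<le> c * emeasure lborel A" by simp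
  qed
  also have "\<dots> = c * emeasure lborel A" using X.emeasure_space_1 by simp
  finally show ?thesis .
qed

text \<open>The maximum of the density is \<open>(2 \<pi> w)\<close> to the power \<open>- n / 2\<close>. The constant on the right is
  \<open>(2 r\<^sup>2 \<theta> / K)\<close> to the power \<open>- n / 2\<close>, so there is room for the factor \<open>\<pi>\<close>.\<close>

lemma gaussian_vec_density_le:
  fixes y :: "real ^ 'n"
  assumes "0 < K" "0 < r" "0 < \<theta>" "r\<^sup>2 * \<theta> / K \<le> w"
  shows "gaussian_vec_density (sqrt w) y \<le> (K / 2) powr (real CARD('n) / 2) * r powr (- real CARD('n)) * \<theta> powr (- real CARD('n) / 2)"
proof -
  have w0: "0 < r\<^sup>2 * \<theta> / K" using assms by simp
  then have w: "0 < w" using assms by linarith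
  define a where "a = (K / 2) powr (1 / 2) * r powr (- 1) * \<theta> powr (- 1 / 2)"
  have "(K / 2) powr (1 / 2) = sqrt (K / 2)" using assms by (intro powr_half_sqrt) simp
  moreover have "r powr (- 1) = 1 / r" using powr_minus_divide[of r 1] assms by simp
  moreover have "\<theta> powr (- 1 / 2) = 1 / sqrt \<theta>"
    using powr_minus_divide[of \<theta> "1 / 2"] powr_half_sqrt[of \<theta>] assms by simp
  ultimately have "a = sqrt (K / 2) * (1 / r) * (1 / sqrt \<theta>)" by (simp add: a_def)
  also have "\<dots> = 1 / (sqrt (2 * \<theta> / K) * r)"
    using assms by (simp add: real_sqrt_divide real_sqrt_mult)
  also have "sqrt (2 * \<theta> / K) * r = sqrt (2 * (r\<^sup>2 * \<theta> / K))"
    using assms by (simp add: real_sqrt_divide real_sqrt_mult)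
  finally have a: "a = 1 / sqrt (2 * (r\<^sup>2 * \<theta> / K))" .
  have le: "normal_density 0 (sqrt w) q \<le> a" for q
  proof -
    have "normal_density 0 (sqrt w) q \<le> 1 / sqrt (2 * pi * w)"
    proof -
      have "exp (- (q - 0)\<^sup>2 / (2 * (sqrt w)\<^sup>2)) \<le> 1" using w by (simp only: exp_le_one_iff) simp
      from mult_left_mono[OF this, of "1 / sqrt (2 * pi * w)"] show ?thesis
        using w by (simp add: normal_density_def)
    qed
    also have "\<dots> \<le> 1 / sqrt (2 * (r\<^sup>2 * \<theta> / K))"
    proof (intro divide_left_mono real_sqrt_le_mono)
      have "2 * (r\<^sup>2 * \<theta> / K) \<le> 2 * 1 * w" using assms by simp
      also have "\<dots> \<le> 2 * pi * w" using w pi_ge_two by (intro mult_right_mono) auto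
      finally show "2 * (r\<^sup>2 * \<theta> / K) \<le> 2 * pi * w" .
    qed (use w w0 in auto)
    finally show ?thesis by (simp add: a)
  qed
  have "gaussian_vec_density (sqrt w) y \<le> (\<Prod>i\<in>(UNIV :: 'n set). a)"
    unfolding gaussian_vec_density_def by (intro prod_mono) (use le in auto)
  also have "\<dots> = a ^ CARD('n)" by simp
  also have "\<dots> = (K / 2) powr (real CARD('n) / 2) * r powr (- real CARD('n)) * \<theta> powr (- real CARD('n) / 2)"
  proof -
    have "(1 / r) ^ CARD('n) = r powr (- real CARD('n))"
      using assms by (simp add: powr_minus powr_realpow power_one_over inverse_eq_divide)
    then show ?thesis
      unfolding a_def power_mult_distrib using assms by (simp add: powr_power)
  qed
  finally show ?thesis .
qed

section \<open>Elementary stochastic integrals\<close>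

text \<open>What the mean square estimate for elementary integrals requires of the integrator. Independence is
  stated for one coordinate of an increment at a time: no joint law of different coordinates enters, so
  the two components of a joint Brownian motion can be treated separately.\<close>

locale centered_increments = prob_space M for M :: "'w measure" +
  fixes F :: "real \<Rightarrow> 'w measure" and W :: "real \<Rightarrow> 'w \<Rightarrow> real ^ 'm"
  assumes space_F: "space (F t) = space M"
    and sets_F: "0 \<le> t \<Longrightarrow> sets (F t) \<subseteq> sets M"
    and sets_F_mono: "s \<le> t \<Longrightarrow> sets (F s) \<subseteq> sets (F t)"
    and adapted: "0 \<le> t \<Longrightarrow> W t \<in> borel_measurable (F t)"
    and increment_indep: "0 \<le> s \<Longrightarrow> s < t \<Longrightarrow> Y \<in> borel_measurable (F s) \<Longrightarrow>
          indep_var borel (Y :: 'w \<Rightarrow> real) borel (\<lambda>\<omega>. (W t \<omega> - W s \<omega>) $ a)"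
    and increment_integrable: "0 \<le> s \<Longrightarrow> s < t \<Longrightarrow> integrable M (\<lambda>\<omega>. (W t \<omega> - W s \<omega>) $ a)"
    and increment_mean: "0 \<le> s \<Longrightarrow> s < t \<Longrightarrow> expectation (\<lambda>\<omega>. (W t \<omega> - W s \<omega>) $ a) = 0"
    and increment_sq_integrable: "0 \<le> s \<Longrightarrow> s < t \<Longrightarrow> integrable M (\<lambda>\<omega>. ((W t \<omega> - W s \<omega>) $ a)\<^sup>2)"
    and increment_variance: "0 \<le> s \<Longrightarrow> s < t \<Longrightarrow> expectation (\<lambda>\<omega>. ((W t \<omega> - W s \<omega>) $ a)\<^sup>2) = t - s"
begin

lemma measurable_F_mono:
  assumes "s \<le> t" "f \<in> measurable (F s) N" shows "f \<in> measurable (F t) N"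
  using assms(2) measurable_mono[of N N "F s" "F t"] sets_F_mono[OF assms(1)] space_F by auto

lemma measurable_F:
  assumes "0 \<le> t" "f \<in> measurable (F t) N" shows "f \<in> measurable M N"
  using assms(2) measurable_mono[of N N "F t" M] sets_F[OF assms(1)] space_F by auto

text \<open>Each new summand is orthogonal to the previous ones: its inner product with the earlier sum is a
  sum of terms, each a variable known at time \<open>\<rho> n\<close> times a coordinate of the next increment, which is centred and
  independent of that variable. The square of the new summand is at most \<open>\<parallel>\<Xi>\<parallel>\<^sup>2 \<parallel>\<Delta>W\<parallel>\<^sup>2\<close>, whence
  the dimensional factor.\<close>

lemma elementary_integral_L2:
  fixes \<rho> :: "nat \<Rightarrow> real" and \<Xi> :: "nat \<Rightarrow> 'w \<Rightarrow> real ^ 'm ^ 'n"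
  assumes \<rho>0: "0 \<le> \<rho> 0" and \<rho>: "\<And>j. j < N \<Longrightarrow> \<rho> j < \<rho> (Suc j)"
    and \<Xi>m: "\<And>j. j < N \<Longrightarrow> \<Xi> j \<in> borel_measurable (F (\<rho> j))"
    and \<Xi>b: "\<And>j. j < N \<Longrightarrow> \<exists>c. \<forall>\<omega>\<in>space M. norm (\<Xi> j \<omega>) \<le> c"
  defines "S \<equiv> \<lambda>n \<omega>. \<Sum>j<n. \<Xi> j \<omega> *v (W (\<rho> (Suc j)) \<omega> - W (\<rho> j) \<omega>)"
  assumes "n \<le> N"
  shows "S n \<in> borel_measurable (F (\<rho> n))"
    and "integrable M (\<lambda>\<omega>. (norm (S n \<omega>))\<^sup>2)"
    and "expectation (\<lambda>\<omega>. (norm (S n \<omega>))\<^sup>2) \<le>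
           real CARD('m) * (\<Sum>j<n. (\<rho> (Suc j) - \<rho> j) * expectation (\<lambda>\<omega>. (norm (\<Xi> j \<omega>))\<^sup>2))"
proof -
  have "S n \<in> borel_measurable (F (\<rho> n)) \<and> integrable M (\<lambda>\<omega>. (norm (S n \<omega>))\<^sup>2) \<and> 0 \<le> \<rho> n \<and>
     expectation (\<lambda>\<omega>. (norm (S n \<omega>))\<^sup>2) \<le>
           real CARD('m) * (\<Sum>j<n. (\<rho> (Suc j) - \<rho> j) * expectation (\<lambda>\<omega>. (norm (\<Xi> j \<omega>))\<^sup>2))"
    using \<open>n \<le> N\<close>
  proof (induction n)
    case 0
    then show ?case using \<rho>0 by (simp add: S_def)
  next
    case (Suc n)
    then have IH: "S n \<in> borel_measurable (F (\<rho> n))" "integrable M (\<lambda>\<omega>. (norm (S n \<omega>))\<^sup>2)" "0 \<le> \<rho> n"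
      "expectation (\<lambda>\<omega>. (norm (S n \<omega>))\<^sup>2) \<le>
           real CARD('m) * (\<Sum>j<n. (\<rho> (Suc j) - \<rho> j) * expectation (\<lambda>\<omega>. (norm (\<Xi> j \<omega>))\<^sup>2))"
      and n: "n < N" by auto
    have \<rho>n: "\<rho> n < \<rho> (Suc n)" using \<rho>[OF n] .
    have \<rho>n': "0 \<le> \<rho> (Suc n)" using IH(3) \<rho>n by simp
    define \<Delta> where "\<Delta> \<omega> = W (\<rho> (Suc n)) \<omega> - W (\<rho> n) \<omega>" for \<omega>
    have \<Xi>n: "\<Xi> n \<in> borel_measurable (F (\<rho> n))" using \<Xi>m[OF n] .
    obtain c where c: "\<And>\<omega>. \<omega> \<in> space M \<Longrightarrow> norm (\<Xi> n \<omega>) \<le> c" using \<Xi>b[OF n] by auto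
    have \<Delta>F: "\<Delta> \<in> borel_measurable (F (\<rho> (Suc n)))"
      unfolding \<Delta>_def using \<rho>n adapted[OF \<rho>n'] measurable_F_mono[OF _ adapted[OF IH(3)], of "\<rho> (Suc n)"]
      by (intro borel_measurable_diff) auto
    have up: "f \<in> borel_measurable (F (\<rho> n)) \<Longrightarrow> f \<in> borel_measurable (F (\<rho> (Suc n)))" for f :: "'w \<Rightarrow> 'c::topological_space"
      by (rule measurable_F_mono[OF less_imp_le[OF \<rho>n]])
    have SS: "S (Suc n) = (\<lambda>\<omega>. S n \<omega> + \<Xi> n \<omega> *v \<Delta> \<omega>)"
      by (simp add: S_def \<Delta>_def fun_eq_iff)
    have meas: "S (Suc n) \<in> borel_measurable (F (\<rho> (Suc n)))"
      unfolding SS using up[OF IH(1)] up[OF \<Xi>n] \<Delta>F by measurable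
    note [measurable] = measurable_F[OF IH(3) IH(1)] measurable_F[OF IH(3) \<Xi>n] measurable_F[OF \<rho>n' \<Delta>F]

    define Y where "Y a \<omega> = S n \<omega> \<bullet> (\<Xi> n \<omega> *v axis a 1)" for a \<omega>
    have YF: "Y a \<in> borel_measurable (F (\<rho> n))" for a
      unfolding Y_def using IH(1) \<Xi>n by measurable
    have Yi: "integrable M (Y a)" for a
    proof (rule Bochner_Integration.integrable_bound)
      show "integrable M (\<lambda>\<omega>. (1 + (norm (S n \<omega>))\<^sup>2) * c)"
        using IH(2) by auto
      show "Y a \<in> borel_measurable M" using YF measurable_F[OF IH(3)] by blast
      show "AE \<omega> in M. norm (Y a \<omega>) \<le> norm ((1 + (norm (S n \<omega>))\<^sup>2) * c)"
      proof (rule AE_I2)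
        fix \<omega> assume \<omega>: "\<omega> \<in> space M"
        have "c \<ge> 0" using c[OF \<omega>] norm_ge_zero order_trans by blast
        have "norm (\<Xi> n \<omega> *v axis a 1) \<le> c"
          using norm_matrix_vector_mult_le[of "\<Xi> n \<omega>" "axis a 1"] c[OF \<omega>] by (simp add: norm_axis_1)
        then have "norm (S n \<omega>) * norm (\<Xi> n \<omega> *v axis a 1) \<le> norm (S n \<omega>) * c"
          by (intro mult_left_mono) auto
        also have "\<dots> \<le> (1 + (norm (S n \<omega>))\<^sup>2) * c"
        proof (rule mult_right_mono[OF _ \<open>c \<ge> 0\<close>])
          have "0 \<le> (norm (S n \<omega>) - 1/2)\<^sup>2" by simp
          then show "norm (S n \<omega>) \<le> 1 + (norm (S n \<omega>))\<^sup>2" by (simp add: power2_eq_square algebra_simps)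
        qed
        finally show "norm (Y a \<omega>) \<le> norm ((1 + (norm (S n \<omega>))\<^sup>2) * c)"
          unfolding Y_def using Cauchy_Schwarz_ineq2[of "S n \<omega>" "\<Xi> n \<omega> *v axis a 1"] by simp
      qed
    qed
    have \<Delta>i: "integrable M (\<lambda>\<omega>. \<Delta> \<omega> $ a)" "expectation (\<lambda>\<omega>. \<Delta> \<omega> $ a) = 0"
      "integrable M (\<lambda>\<omega>. (\<Delta> \<omega> $ a)\<^sup>2)" "expectation (\<lambda>\<omega>. (\<Delta> \<omega> $ a)\<^sup>2) = \<rho> (Suc n) - \<rho> n" for a
      unfolding \<Delta>_def using increment_integrable[OF IH(3) \<rho>n] increment_mean[OF IH(3) \<rho>n]
        increment_sq_integrable[OF IH(3) \<rho>n] increment_variance[OF IH(3) \<rho>n] by auto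
    have iv: "indep_var borel G borel (\<lambda>\<omega>. \<Delta> \<omega> $ a)" if "G \<in> borel_measurable (F (\<rho> n))" for G :: "'w \<Rightarrow> real" and a
      unfolding \<Delta>_def using increment_indep[OF IH(3) \<rho>n that] .
    have cross: "integrable M (\<lambda>\<omega>. Y a \<omega> * \<Delta> \<omega> $ a)" "expectation (\<lambda>\<omega>. Y a \<omega> * \<Delta> \<omega> $ a) = 0" for a
      using indep_var_integrable[OF iv[OF YF] Yi \<Delta>i(1)] indep_var_lebesgue_integral[OF iv[OF YF] Yi \<Delta>i(1)]
      by (auto simp: \<Delta>i)
    have crossS: "S n \<omega> \<bullet> (\<Xi> n \<omega> *v \<Delta> \<omega>) = (\<Sum>a\<in>UNIV. Y a \<omega> * \<Delta> \<omega> $ a)" for \<omega>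
      unfolding Y_def by (rule inner_matrix_vector_mult)
    have \<Xi>2F: "(\<lambda>\<omega>. (norm (\<Xi> n \<omega>))\<^sup>2) \<in> borel_measurable (F (\<rho> n))"
      using \<Xi>n by measurable
    have \<Xi>2i: "integrable M (\<lambda>\<omega>. (norm (\<Xi> n \<omega>))\<^sup>2)"
    proof (rule integrable_const_bound[of _ "c\<^sup>2"])
      show "AE \<omega> in M. norm ((norm (\<Xi> n \<omega>))\<^sup>2) \<le> c\<^sup>2"
        by (rule AE_I2) (simp add: c power_mono)
    qed measurable
    have iv2: "indep_var borel (\<lambda>\<omega>. (norm (\<Xi> n \<omega>))\<^sup>2) borel (\<lambda>\<omega>. (\<Delta> \<omega> $ a)\<^sup>2)" for a
      using indep_var_compose[OF iv[OF \<Xi>2F, of a], of id borel "\<lambda>z. z\<^sup>2" borel] by (simp add: comp_def)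
    have sq: "integrable M (\<lambda>\<omega>. (norm (\<Xi> n \<omega>))\<^sup>2 * (\<Delta> \<omega> $ a)\<^sup>2)"
       "expectation (\<lambda>\<omega>. (norm (\<Xi> n \<omega>))\<^sup>2 * (\<Delta> \<omega> $ a)\<^sup>2) = expectation (\<lambda>\<omega>. (norm (\<Xi> n \<omega>))\<^sup>2) * (\<rho> (Suc n) - \<rho> n)" for a
      using indep_var_integrable[OF iv2 \<Xi>2i \<Delta>i(3)] indep_var_lebesgue_integral[OF iv2 \<Xi>2i \<Delta>i(3)] by (auto simp: \<Delta>i)
    define R where "R \<omega> = (norm (S n \<omega>))\<^sup>2 + 2 * (\<Sum>a\<in>UNIV. Y a \<omega> * \<Delta> \<omega> $ a) +
          (\<Sum>a\<in>UNIV. (norm (\<Xi> n \<omega>))\<^sup>2 * (\<Delta> \<omega> $ a)\<^sup>2)" for \<omega>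
    have le: "(norm (S (Suc n) \<omega>))\<^sup>2 \<le> R \<omega>" for \<omega>
    proof -
      have "(norm (\<Xi> n \<omega> *v \<Delta> \<omega>))\<^sup>2 \<le> (norm (\<Xi> n \<omega>) * norm (\<Delta> \<omega>))\<^sup>2"
        by (intro power_mono norm_matrix_vector_mult_le) auto
      also have "\<dots> = (\<Sum>a\<in>UNIV. (norm (\<Xi> n \<omega>))\<^sup>2 * (\<Delta> \<omega> $ a)\<^sup>2)"
        by (simp add: power_mult_distrib sum_distrib_left[symmetric] norm_vec_def[of "\<Delta> \<omega>"] L2_set_def sum_nonneg)
      finally show ?thesis
        by (simp add: SS R_def power2_norm_eq_inner[of "_ + _"] inner_add_left inner_add_right inner_commute
             crossS[symmetric]) (simp add: power2_norm_eq_inner inner_commute)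
    qed
    have Ri: "integrable M R"
      unfolding R_def using IH(2) cross(1) sq(1) by auto
    have "expectation R = expectation (\<lambda>\<omega>. (norm (S n \<omega>))\<^sup>2) + real CARD('m) * (expectation (\<lambda>\<omega>. (norm (\<Xi> n \<omega>))\<^sup>2) * (\<rho> (Suc n) - \<rho> n))"
      unfolding R_def using IH(2) cross sq by (simp add: integral_sum)
    moreover have int: "integrable M (\<lambda>\<omega>. (norm (S (Suc n) \<omega>))\<^sup>2)"
    proof (rule Bochner_Integration.integrable_bound[OF Ri])
      show "(\<lambda>\<omega>. (norm (S (Suc n) \<omega>))\<^sup>2) \<in> borel_measurable M"
        using measurable_F[OF \<rho>n' meas] by measurable
      show "AE \<omega> in M. norm ((norm (S (Suc n) \<omega>))\<^sup>2) \<le> norm (R \<omega>)"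
        using le by (auto intro!: AE_I2 order_trans[OF le])
    qed
    moreover have "expectation (\<lambda>\<omega>. (norm (S (Suc n) \<omega>))\<^sup>2) \<le> expectation R"
      using int Ri le by (intro integral_mono)
    ultimately show ?case
      using IH(4) meas \<rho>n' by (auto simp: algebra_simps)
  qed
  then show "S n \<in> borel_measurable (F (\<rho> n))"
    and "integrable M (\<lambda>\<omega>. (norm (S n \<omega>))\<^sup>2)"
    and "expectation (\<lambda>\<omega>. (norm (S n \<omega>))\<^sup>2) \<le>
           real CARD('m) * (\<Sum>j<n. (\<rho> (Suc j) - \<rho> j) * expectation (\<lambda>\<omega>. (norm (\<Xi> j \<omega>))\<^sup>2))"
    by auto
qed

text \<open>The integrand is set to zero from the first index on at which its accumulated energy exceeds
  \<open>\<delta>\<close>. This depends only on the past, so the integrand stays adapted, its energy is at most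
  \<open>\<delta>\<close>, and Markov's inequality applies to the truncated sum. On the event that the total energy is
  at most \<open>\<delta>\<close> nothing was truncated.\<close>

lemma elementary_integral_tail_bound:
  fixes \<rho> :: "nat \<Rightarrow> real" and \<Xi> :: "nat \<Rightarrow> 'w \<Rightarrow> real ^ 'm ^ 'n"
  assumes \<rho>0: "0 \<le> \<rho> 0" and \<rho>: "\<And>j. j < N \<Longrightarrow> \<rho> j < \<rho> (Suc j)"
    and \<Xi>m: "\<And>j. j < N \<Longrightarrow> \<Xi> j \<in> borel_measurable (F (\<rho> j))"
    and \<Xi>b: "\<And>j. j < N \<Longrightarrow> \<exists>c. \<forall>\<omega>\<in>space M. norm (\<Xi> j \<omega>) \<le> c"
    and pos: "0 < \<epsilon>" "0 < \<delta>"
  shows "prob {\<omega>\<in>space M. \<epsilon> < norm (\<Sum>j<N. \<Xi> j \<omega> *v (W (\<rho> (Suc j)) \<omega> - W (\<rho> j) \<omega>))}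
     \<le> prob {\<omega>\<in>space M. \<delta> < (\<Sum>j<N. (\<rho> (Suc j) - \<rho> j) * (norm (\<Xi> j \<omega>))\<^sup>2)} + real CARD('m) * \<delta> / \<epsilon>\<^sup>2"
proof -
  define q where "q n \<omega> = (\<Sum>j<n. (\<rho> (Suc j) - \<rho> j) * (norm (\<Xi> j \<omega>))\<^sup>2)" for n \<omega>
  \<comment> \<open>The energy is accumulated up to and including index \<open>j\<close>; it is nevertheless known at time \<open>\<rho> j\<close>.\<close>
  define \<Xi>' where "\<Xi>' j \<omega> = (if q (Suc j) \<omega> \<le> \<delta> then \<Xi> j \<omega> else 0)" for j \<omega>
  have \<rho>mono: "\<rho> i \<le> \<rho> j" if "i \<le> j" "j \<le> N" for i j
    using that
  proof (induction j)
    case (Suc j)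
    then show ?case using \<rho>[of j] by (cases "i = Suc j") auto
  qed simp
  have \<rho>nn: "0 \<le> \<rho> j" if "j \<le> N" for j using \<rho>mono[of 0 j] \<rho>0 that by auto
  have qF: "q (Suc j) \<in> borel_measurable (F (\<rho> j))" if "j < N" for j
    unfolding q_def
  proof (intro borel_measurable_sum)
    fix i assume "i \<in> {..<Suc j}"
    then have "\<Xi> i \<in> borel_measurable (F (\<rho> j))"
      using that \<Xi>m[of i] \<rho>mono[of i j] measurable_F_mono by auto
    then show "(\<lambda>\<omega>. (\<rho> (Suc i) - \<rho> i) * (norm (\<Xi> i \<omega>))\<^sup>2) \<in> borel_measurable (F (\<rho> j))"
      by measurable
  qed
  have \<Xi>'m: "\<Xi>' j \<in> borel_measurable (F (\<rho> j))" if "j < N" for j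
    unfolding \<Xi>'_def using \<Xi>m[OF that] qF[OF that] by measurable
  have \<Xi>'b: "\<exists>c. \<forall>\<omega>\<in>space M. norm (\<Xi>' j \<omega>) \<le> c" if j: "j < N" for j
  proof -
    obtain c where "\<forall>\<omega>\<in>space M. norm (\<Xi> j \<omega>) \<le> c" using \<Xi>b[OF j] by auto
    then show ?thesis by (intro exI[of _ "max 0 c"]) (auto simp: \<Xi>'_def le_max_iff_disj)
  qed
  define S where "S \<omega> = (\<Sum>j<N. \<Xi> j \<omega> *v (W (\<rho> (Suc j)) \<omega> - W (\<rho> j) \<omega>))" for \<omega>
  define S' where "S' \<omega> = (\<Sum>j<N. \<Xi>' j \<omega> *v (W (\<rho> (Suc j)) \<omega> - W (\<rho> j) \<omega>))" for \<omega>
  note L2 = elementary_integral_L2[of \<rho> N \<Xi>', OF \<rho>0 \<rho> \<Xi>'m \<Xi>'b, of N, folded S'_def]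
  have S'm: "S' \<in> borel_measurable M" using measurable_F[OF \<rho>nn[of N] L2(1)] by simp
  have S'i: "integrable M (\<lambda>\<omega>. (norm (S' \<omega>))\<^sup>2)" using L2(2) by simp
  have "(\<Sum>j<n. (\<rho> (Suc j) - \<rho> j) * (norm (\<Xi>' j \<omega>))\<^sup>2) \<le> min (q n \<omega>) \<delta>" if "n \<le> N" for n \<omega>
    using that
  proof (induction n)
    case 0
    then show ?case using pos by (simp add: q_def)
  next
    case (Suc n)
    have "0 \<le> (\<rho> (Suc n) - \<rho> n) * (norm (\<Xi> n \<omega>))\<^sup>2" using \<rho>[of n] Suc.prems by auto
    then show ?case using Suc by (auto simp: \<Xi>'_def q_def)
  qed
  from this[of N] have q': "(\<Sum>j<N. (\<rho> (Suc j) - \<rho> j) * (norm (\<Xi>' j \<omega>))\<^sup>2) \<le> \<delta>" for \<omega> by simp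
  have \<Xi>'i: "integrable M (\<lambda>\<omega>. (norm (\<Xi>' j \<omega>))\<^sup>2)" if j: "j < N" for j
  proof -
    obtain c where c: "\<forall>\<omega>\<in>space M. norm (\<Xi>' j \<omega>) \<le> c" using \<Xi>'b[OF j] by auto
    have [measurable]: "\<Xi>' j \<in> borel_measurable M" using measurable_F[OF \<rho>nn \<Xi>'m[OF j]] j by simp
    show ?thesis
      by (rule integrable_const_bound[of _ "c\<^sup>2"]) (use c in \<open>auto simp: power_mono\<close>)
  qed
  have "(\<Sum>j<N. (\<rho> (Suc j) - \<rho> j) * expectation (\<lambda>\<omega>. (norm (\<Xi>' j \<omega>))\<^sup>2)) =
     expectation (\<lambda>\<omega>. \<Sum>j<N. (\<rho> (Suc j) - \<rho> j) * (norm (\<Xi>' j \<omega>))\<^sup>2)"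
    using \<Xi>'i by (subst Bochner_Integration.integral_sum) auto
  also have "\<dots> \<le> expectation (\<lambda>\<omega>. \<delta>)"
    using \<Xi>'i q' by (intro integral_mono) auto
  finally have E: "expectation (\<lambda>\<omega>. (norm (S' \<omega>))\<^sup>2) \<le> real CARD('m) * \<delta>"
    using L2(3) by (simp add: prob_space) (meson order_trans mult_left_mono of_nat_0_le_iff)
  have "prob {\<omega>\<in>space M. \<epsilon>\<^sup>2 \<le> (norm (S' \<omega>))\<^sup>2} \<le> expectation (\<lambda>\<omega>. (norm (S' \<omega>))\<^sup>2) / \<epsilon>\<^sup>2"
    using pos by (intro integral_Markov_inequality_measure[OF S'i, of "{}"]) auto
  also have "\<dots> \<le> real CARD('m) * \<delta> / \<epsilon>\<^sup>2"
    using E by (intro divide_right_mono) auto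
  finally have M: "prob {\<omega>\<in>space M. \<epsilon>\<^sup>2 \<le> (norm (S' \<omega>))\<^sup>2} \<le> real CARD('m) * \<delta> / \<epsilon>\<^sup>2" .
  have qM: "q N \<in> borel_measurable M"
    unfolding q_def using measurable_F[OF \<rho>nn \<Xi>m] by (intro borel_measurable_sum) (auto intro!: borel_measurable_times borel_measurable_power borel_measurable_norm)
  have eq: "S \<omega> = S' \<omega>" if "q N \<omega> \<le> \<delta>" for \<omega>
    unfolding S_def S'_def
  proof (rule sum.cong)
    fix j assume "j \<in> {..<N}"
    then have "q (Suc j) \<omega> \<le> q N \<omega>"
      unfolding q_def using \<rho> by (intro sum_mono2) (auto simp: less_imp_le)
    then show "\<Xi> j \<omega> *v (W (\<rho> (Suc j)) \<omega> - W (\<rho> j) \<omega>) = \<Xi>' j \<omega> *v (W (\<rho> (Suc j)) \<omega> - W (\<rho> j) \<omega>)"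
      using that by (simp add: \<Xi>'_def)
  qed simp
  have "{\<omega>\<in>space M. \<epsilon> < norm (S \<omega>)} \<subseteq> {\<omega>\<in>space M. \<delta> < q N \<omega>} \<union> {\<omega>\<in>space M. \<epsilon>\<^sup>2 \<le> (norm (S' \<omega>))\<^sup>2}"
  proof safe
    fix \<omega> assume *: "\<omega> \<in> space M" "\<epsilon> < norm (S \<omega>)" "\<not> \<epsilon>\<^sup>2 \<le> (norm (S' \<omega>))\<^sup>2"
    show "\<delta> < q N \<omega>"
    proof (rule ccontr)
      assume "\<not> \<delta> < q N \<omega>"
      then have "\<epsilon> < norm (S' \<omega>)" using eq[of \<omega>] * by simp
      then show False using *(3) pos power_mono[of \<epsilon> "norm (S' \<omega>)" 2] by simp
    qed
  qed
  moreover have ev: "{\<omega>\<in>space M. \<delta> < q N \<omega>} \<in> events" "{\<omega>\<in>space M. \<epsilon>\<^sup>2 \<le> (norm (S' \<omega>))\<^sup>2} \<in> events"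
    using qM by measurable (use S'm in measurable)
  ultimately have "prob {\<omega>\<in>space M. \<epsilon> < norm (S \<omega>)} \<le> prob ({\<omega>\<in>space M. \<delta> < q N \<omega>} \<union> {\<omega>\<in>space M. \<epsilon>\<^sup>2 \<le> (norm (S' \<omega>))\<^sup>2})"
    by (intro finite_measure_mono) auto
  also have "\<dots> \<le> prob {\<omega>\<in>space M. \<delta> < q N \<omega>} + prob {\<omega>\<in>space M. \<epsilon>\<^sup>2 \<le> (norm (S' \<omega>))\<^sup>2}"
    using ev by (intro measure_Un_le)
  finally show ?thesis using M by (simp add: S_def q_def)
qed

text \<open>The tail bound for a finite family of possibly overlapping intervals, as they arise when simple
  processes with different partitions are subtracted. Everything is rewritten over the partition
  formed by all endpoints; since the value on a cell only collects intervals that begin no later than it,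
  adaptedness is preserved.\<close>

lemma interval_family_tail_bound:
  fixes \<alpha> \<beta> :: "'i \<Rightarrow> real" and \<xi> :: "'i \<Rightarrow> 'w \<Rightarrow> real ^ 'm ^ 'n"
  assumes I: "finite I" and \<alpha>\<beta>: "\<And>i. i \<in> I \<Longrightarrow> 0 \<le> \<alpha> i \<and> \<alpha> i \<le> \<beta> i"
    and \<xi>m: "\<And>i. i \<in> I \<Longrightarrow> \<alpha> i < \<beta> i \<Longrightarrow> \<xi> i \<in> borel_measurable (F (\<alpha> i))"
    and \<xi>b: "\<And>i. i \<in> I \<Longrightarrow> \<exists>c. \<forall>\<omega>\<in>space M. norm (\<xi> i \<omega>) \<le> c"
    and pos: "0 < \<epsilon>" "0 < \<delta>"
  shows "prob {\<omega>\<in>space M. \<epsilon> < norm (\<Sum>i\<in>I. \<xi> i \<omega> *v (W (\<beta> i) \<omega> - W (\<alpha> i) \<omega>))}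
     \<le> prob {\<omega>\<in>space M. ennreal \<delta> < (\<integral>\<^sup>+s. ennreal ((norm (\<Sum>i\<in>I. indicator {\<alpha> i<..\<beta> i} s *\<^sub>R \<xi> i \<omega>))\<^sup>2) \<partial>lborel)}
       + real CARD('m) * \<delta> / \<epsilon>\<^sup>2"
proof -
  have fin: "finite (\<alpha> ` I \<union> \<beta> ` I \<union> {0})" "\<alpha> ` I \<union> \<beta> ` I \<union> {0} \<noteq> {}" using I by auto
  obtain N :: nat and \<rho> :: "nat \<Rightarrow> real" where \<rho>: "\<And>i j. i < j \<Longrightarrow> j \<le> N \<Longrightarrow> \<rho> i < \<rho> j" and ran: "\<rho> ` {..N} = \<alpha> ` I \<union> \<beta> ` I \<union> {0}"
    by (rule finite_set_enumeration[OF fin]) blast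
  have \<rho>_le_iff: "\<rho> i \<le> \<rho> j \<longleftrightarrow> i \<le> j" if "i \<le> N" "j \<le> N" for i j
    using \<rho>[of i j] \<rho>[of j i] that by (cases i j rule: linorder_cases) auto
  have \<rho>nn: "0 \<le> \<rho> i" if "i \<le> N" for i
  proof -
    have "\<rho> i \<in> \<alpha> ` I \<union> \<beta> ` I \<union> {0}" using that ran by blast
    moreover have "0 \<le> \<alpha> i \<and> 0 \<le> \<beta> i" if "i \<in> I" for i
      using \<alpha>\<beta>[OF that] by linarith
    ultimately show ?thesis by auto
  qed
  define on where "on i j \<longleftrightarrow> \<alpha> i \<le> \<rho> j \<and> \<rho> j < \<beta> i" for i j
  \<comment> \<open>The same telescoping identity serves for the paths of \<open>W\<close> and for indicator functions of intervals.\<close>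
  have tele: "(\<Sum>j<N. if on i j then g (\<rho> (Suc j)) - g (\<rho> j) else 0) = g (\<beta> i) - g (\<alpha> i)"
    if i: "i \<in> I" for i and g :: "real \<Rightarrow> 'z::real_vector"
  proof -
    have "\<alpha> i \<in> \<rho> ` {..N}" "\<beta> i \<in> \<rho> ` {..N}" unfolding ran using i by auto
    then obtain p q where pq: "p \<le> N" "q \<le> N" "\<alpha> i = \<rho> p" "\<beta> i = \<rho> q" by auto
    then have "p \<le> q" using \<alpha>\<beta>[OF i] \<rho>_le_iff[of p q] by simp
    have on: "on i j \<longleftrightarrow> j \<in> {p..<q}" if "j < N" for j
      unfolding on_def using \<rho>_le_iff[of p j] \<rho>_le_iff[of q j] that pq by (auto simp: not_le[symmetric])
    have "(\<Sum>j<N. if on i j then g (\<rho> (Suc j)) - g (\<rho> j) else 0) = (\<Sum>j\<in>{..<N} \<inter> {p..<q}. g (\<rho> (Suc j)) - g (\<rho> j))"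
      unfolding sum.inter_restrict[OF finite_lessThan] using on by (intro sum.cong) auto
    also have "{..<N} \<inter> {p..<q} = {p..<q}" using pq by auto
    also have "(\<Sum>j=p..<q. g (\<rho> (Suc j)) - g (\<rho> j)) = g (\<rho> q) - g (\<rho> p)"
      using sum_Suc_diff'[OF \<open>p \<le> q\<close>, of "\<lambda>j. g (\<rho> j)"] by simp
    finally show ?thesis using pq by simp
  qed
  define \<Xi> where "\<Xi> j \<omega> = (\<Sum>i\<in>I. if on i j then \<xi> i \<omega> else 0)" for j \<omega>
  have sumW: "(\<Sum>i\<in>I. \<xi> i \<omega> *v (W (\<beta> i) \<omega> - W (\<alpha> i) \<omega>)) = (\<Sum>j<N. \<Xi> j \<omega> *v (W (\<rho> (Suc j)) \<omega> - W (\<rho> j) \<omega>))" for \<omega>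
  proof -
    have "(\<Sum>i\<in>I. \<xi> i \<omega> *v (W (\<beta> i) \<omega> - W (\<alpha> i) \<omega>)) =
       (\<Sum>i\<in>I. \<Sum>j<N. (if on i j then \<xi> i \<omega> else 0) *v (W (\<rho> (Suc j)) \<omega> - W (\<rho> j) \<omega>))"
    proof (rule sum.cong)
      fix i assume "i \<in> I"
      then have "\<xi> i \<omega> *v (W (\<beta> i) \<omega> - W (\<alpha> i) \<omega>) =
           \<xi> i \<omega> *v (\<Sum>j<N. if on i j then W (\<rho> (Suc j)) \<omega> - W (\<rho> j) \<omega> else 0)"
        using tele[of i "\<lambda>q. W q \<omega>"] by simp
      also have "\<dots> = (\<Sum>j<N. \<xi> i \<omega> *v (if on i j then W (\<rho> (Suc j)) \<omega> - W (\<rho> j) \<omega> else 0))"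
        by (rule bounded_bilinear.sum_right[OF bounded_bilinear_matrix_vector_mult])
      also have "\<dots> = (\<Sum>j<N. (if on i j then \<xi> i \<omega> else 0) *v (W (\<rho> (Suc j)) \<omega> - W (\<rho> j) \<omega>))"
        by (intro sum.cong) (auto simp: matrix_vector_mult_0)
      finally show "\<xi> i \<omega> *v (W (\<beta> i) \<omega> - W (\<alpha> i) \<omega>) = \<dots>" .
    qed simp
    also have "\<dots> = (\<Sum>j<N. \<Xi> j \<omega> *v (W (\<rho> (Suc j)) \<omega> - W (\<rho> j) \<omega>))"
      unfolding \<Xi>_def bounded_bilinear.sum_left[OF bounded_bilinear_matrix_vector_mult] by (rule sum.swap)
    finally show ?thesis .
  qed
  have sumI: "(\<Sum>i\<in>I. indicator {\<alpha> i<..\<beta> i} s *\<^sub>R \<xi> i \<omega>) = (\<Sum>j<N. indicator {\<rho> j<..\<rho> (Suc j)} s *\<^sub>R \<Xi> j \<omega>)" for s \<omega>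
  proof -
    \<comment> \<open>The increments of the step function at \<open>s\<close> are the indicators of the intervals that contain \<open>s\<close>.\<close>
    define g :: "real \<Rightarrow> real" where "g c = (if s \<le> c then 1 else 0)" for c
    have g: "g b - g a = indicator {a<..b} s" if "a \<le> b" for a b
      using that by (auto simp: g_def)
    have g\<rho>: "g (\<rho> (Suc j)) - g (\<rho> j) = indicator {\<rho> j<..\<rho> (Suc j)} s" if "j < N" for j
      using that \<rho>[of j "Suc j"] by (intro g) simp
    have "(\<Sum>i\<in>I. indicator {\<alpha> i<..\<beta> i} s *\<^sub>R \<xi> i \<omega>) =
       (\<Sum>i\<in>I. \<Sum>j<N. indicator {\<rho> j<..\<rho> (Suc j)} s *\<^sub>R (if on i j then \<xi> i \<omega> else 0))"
    proof (rule sum.cong)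
      fix i assume i: "i \<in> I"
      then have "indicator {\<alpha> i<..\<beta> i} s *\<^sub>R \<xi> i \<omega> = (\<Sum>j<N. if on i j then g (\<rho> (Suc j)) - g (\<rho> j) else 0) *\<^sub>R \<xi> i \<omega>"
        using tele[of i g] g[of "\<alpha> i" "\<beta> i"] \<alpha>\<beta>[OF i] by simp
      also have "\<dots> = (\<Sum>j<N. indicator {\<rho> j<..\<rho> (Suc j)} s *\<^sub>R (if on i j then \<xi> i \<omega> else 0))"
        unfolding scaleR_sum_left by (intro sum.cong) (auto simp: g\<rho>)
      finally show "indicator {\<alpha> i<..\<beta> i} s *\<^sub>R \<xi> i \<omega> = \<dots>" .
    qed simp
    also have "\<dots> = (\<Sum>j<N. indicator {\<rho> j<..\<rho> (Suc j)} s *\<^sub>R \<Xi> j \<omega>)"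
      unfolding \<Xi>_def scaleR_sum_right by (rule sum.swap)
    finally show ?thesis .
  qed
  have disj: "(norm (\<Sum>j<N. indicator {\<rho> j<..\<rho> (Suc j)} s *\<^sub>R \<Xi> j \<omega>))\<^sup>2 = (\<Sum>j<N. indicator {\<rho> j<..\<rho> (Suc j)} s * (norm (\<Xi> j \<omega>))\<^sup>2)" for s \<omega>
  proof (cases "\<exists>j0<N. s \<in> {\<rho> j0<..\<rho> (Suc j0)}")
    case True
    then obtain j0 where j0: "j0 < N" "s \<in> {\<rho> j0<..\<rho> (Suc j0)}" by auto
    have other: "s \<notin> {\<rho> j<..\<rho> (Suc j)}" if "j < N" "j \<noteq> j0" for j
      using j0 that \<rho>_le_iff[of "Suc j" j0] \<rho>_le_iff[of "Suc j0" j] by auto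
    have single: "(\<Sum>j<N. h j) = h j0" if "\<And>j. j < N \<Longrightarrow> j \<noteq> j0 \<Longrightarrow> h j = 0" for h :: "nat \<Rightarrow> 'z::comm_monoid_add"
      using j0 that by (subst sum.remove[of _ j0]) auto
    have "(\<Sum>j<N. indicator {\<rho> j<..\<rho> (Suc j)} s *\<^sub>R \<Xi> j \<omega>) = \<Xi> j0 \<omega>"
      using other j0 by (subst single) auto
    moreover have "(\<Sum>j<N. indicator {\<rho> j<..\<rho> (Suc j)} s * (norm (\<Xi> j \<omega>))\<^sup>2) = (norm (\<Xi> j0 \<omega>))\<^sup>2"
      using other j0 by (subst single) auto
    ultimately show ?thesis by simp
  next
    case False
    then have "indicator {\<rho> j<..\<rho> (Suc j)} s = (0::real)" if "j < N" for j using that by auto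
    then show ?thesis by simp
  qed
  have int: "(\<integral>\<^sup>+s. ennreal ((norm (\<Sum>i\<in>I. indicator {\<alpha> i<..\<beta> i} s *\<^sub>R \<xi> i \<omega>))\<^sup>2) \<partial>lborel) =
      ennreal (\<Sum>j<N. (\<rho> (Suc j) - \<rho> j) * (norm (\<Xi> j \<omega>))\<^sup>2)" for \<omega>
  proof -
    have "(\<integral>\<^sup>+s. ennreal ((norm (\<Sum>i\<in>I. indicator {\<alpha> i<..\<beta> i} s *\<^sub>R \<xi> i \<omega>))\<^sup>2) \<partial>lborel) =
       (\<integral>\<^sup>+s. (\<Sum>j<N. ennreal ((norm (\<Xi> j \<omega>))\<^sup>2) * indicator {\<rho> j<..\<rho> (Suc j)} s) \<partial>lborel)"
      unfolding sumI disj by (intro nn_integral_cong) (subst sum_ennreal[symmetric], auto intro!: sum.cong split: split_indicator)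
    also have "\<dots> = (\<Sum>j<N. ennreal ((norm (\<Xi> j \<omega>))\<^sup>2) * ennreal (\<rho> (Suc j) - \<rho> j))"
      using \<rho> by (subst nn_integral_sum) (auto intro!: sum.cong simp: nn_integral_cmult_indicator less_imp_le)
    also have "\<dots> = (\<Sum>j<N. ennreal ((\<rho> (Suc j) - \<rho> j) * (norm (\<Xi> j \<omega>))\<^sup>2))"
      using \<rho> by (intro sum.cong) (auto simp: ennreal_mult mult.commute less_imp_le)
    also have "\<dots> = ennreal (\<Sum>j<N. (\<rho> (Suc j) - \<rho> j) * (norm (\<Xi> j \<omega>))\<^sup>2)"
      using \<rho> by (intro sum_ennreal) (auto simp: less_imp_le)
    finally show ?thesis .
  qed
  have \<Xi>m: "\<Xi> j \<in> borel_measurable (F (\<rho> j))" if "j < N" for j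
    unfolding \<Xi>_def
  proof (intro borel_measurable_sum)
    fix i assume i: "i \<in> I"
    show "(\<lambda>\<omega>. if on i j then \<xi> i \<omega> else 0) \<in> borel_measurable (F (\<rho> j))"
    proof (cases "on i j")
      case True
      then have "\<xi> i \<in> borel_measurable (F (\<rho> j))"
        using \<xi>m[OF i] measurable_F_mono[of "\<alpha> i" "\<rho> j"] by (auto simp: on_def)
      then show ?thesis using True by simp
    qed simp
  qed
  have \<Xi>b: "\<exists>c. \<forall>\<omega>\<in>space M. norm (\<Xi> j \<omega>) \<le> c" for j
  proof -
    obtain c where c: "\<And>i \<omega>. i \<in> I \<Longrightarrow> \<omega> \<in> space M \<Longrightarrow> norm (\<xi> i \<omega>) \<le> c i" using \<xi>b by metis
    have "norm (\<Xi> j \<omega>) \<le> (\<Sum>i\<in>I. max 0 (c i))" if "\<omega> \<in> space M" for \<omega>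
      unfolding \<Xi>_def using c[OF _ that] by (intro sum_norm_le) (auto simp: le_max_iff_disj)
    then show ?thesis by blast
  qed
  have "prob {\<omega>\<in>space M. \<epsilon> < norm (\<Sum>j<N. \<Xi> j \<omega> *v (W (\<rho> (Suc j)) \<omega> - W (\<rho> j) \<omega>))}
     \<le> prob {\<omega>\<in>space M. \<delta> < (\<Sum>j<N. (\<rho> (Suc j) - \<rho> j) * (norm (\<Xi> j \<omega>))\<^sup>2)} + real CARD('m) * \<delta> / \<epsilon>\<^sup>2"
    using \<rho>nn[of 0] \<rho> \<Xi>m \<Xi>b pos by (intro elementary_integral_tail_bound) auto
  then show ?thesis
    unfolding sumW int using pos by (simp add: ennreal_less_iff)
qed

end

section \<open>The joint Brownian motion\<close>

lemma (in prob_space) brownian_increment_moments: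
  fixes W :: "real \<Rightarrow> 'a \<Rightarrow> real ^ 'm"
  assumes W: "brownian_motion M W" and st: "0 \<le> s" "s < t"
  shows "integrable M (\<lambda>\<omega>. (W t \<omega> - W s \<omega>) $ a)" "expectation (\<lambda>\<omega>. (W t \<omega> - W s \<omega>) $ a) = 0"
    and "integrable M (\<lambda>\<omega>. ((W t \<omega> - W s \<omega>) $ a)\<^sup>2)" "expectation (\<lambda>\<omega>. ((W t \<omega> - W s \<omega>) $ a)\<^sup>2) = t - s"
proof -
  have D: "distributed M lborel (\<lambda>\<omega>. (W t \<omega> - W s \<omega>) $ a) (normal_density 0 (sqrt (t - s)))"
    by (rule gaussian_vector_component) (use W st in \<open>auto simp: brownian_motion_def\<close>)
  have pos: "0 < sqrt (t - s)" using st by simp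
  show "integrable M (\<lambda>\<omega>. (W t \<omega> - W s \<omega>) $ a)"
    using integrable_normal_moment[OF pos, of 0 1] distributed_integrable[OF D, of "\<lambda>z. z"] by simp
  show "integrable M (\<lambda>\<omega>. ((W t \<omega> - W s \<omega>) $ a)\<^sup>2)"
    using integrable_normal_moment[OF pos, of 0 2] distributed_integrable[OF D, of "\<lambda>z. z\<^sup>2"] by simp
  show E: "expectation (\<lambda>\<omega>. (W t \<omega> - W s \<omega>) $ a) = 0"
    using normal_distributed_expectation[OF pos D] .
  show "expectation (\<lambda>\<omega>. ((W t \<omega> - W s \<omega>) $ a)\<^sup>2) = t - s"
    using normal_distributed_variance[OF pos D] E st by simp
qed

lemma measurable_joint_process:
  fixes Y :: "real \<Rightarrow> 'a \<Rightarrow> real ^ 'd" and Z :: "real \<Rightarrow> 'a \<Rightarrow> real ^ 'n"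
  assumes "Y t \<in> borel_measurable N" "Z t \<in> borel_measurable N"
  shows "joint_process Y Z t \<in> borel_measurable N"
proof -
  have "(\<lambda>\<omega>. joint_process Y Z t \<omega> $ j) \<in> borel_measurable N" for j
    using assms by (cases j) (auto simp: joint_process_def)
  then have "(\<lambda>\<omega>. joint_process Y Z t \<omega> \<bullet> e) \<in> borel_measurable N" if "e \<in> Basis" for e
    using that by (auto simp: Basis_vec_def inner_axis)
  then show ?thesis by (subst borel_measurable_euclidean_space) auto
qed

lemma measurable_joint_process_components:
  fixes Y :: "real \<Rightarrow> 'a \<Rightarrow> real ^ 'd" and Z :: "real \<Rightarrow> 'a \<Rightarrow> real ^ 'n"
  assumes "joint_process Y Z t \<in> borel_measurable N"
  shows "Y t \<in> borel_measurable N" "Z t \<in> borel_measurable N"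
proof -
  have "(\<lambda>\<omega>. Y t \<omega> $ i) \<in> borel_measurable N" for i
    using borel_measurable_vec_nth_comp[OF assms, of "Inl i"] by (simp add: joint_process_def)
  then have "(\<lambda>\<omega>. Y t \<omega> \<bullet> e) \<in> borel_measurable N" if "e \<in> Basis" for e
    using that by (auto simp: Basis_vec_def inner_axis)
  then show "Y t \<in> borel_measurable N" by (subst borel_measurable_euclidean_space) auto
  have "(\<lambda>\<omega>. Z t \<omega> $ i) \<in> borel_measurable N" for i
    using borel_measurable_vec_nth_comp[OF assms, of "Inr i"] by (simp add: joint_process_def)
  then have "(\<lambda>\<omega>. Z t \<omega> \<bullet> e) \<in> borel_measurable N" if "e \<in> Basis" for e
    using that by (auto simp: Basis_vec_def inner_axis)
  then show "Z t \<in> borel_measurable N" by (subst borel_measurable_euclidean_space) auto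
qed

text \<open>Each coordinate of the joint process belongs to \<open>B\<close> or to \<open>B1\<close>, and the roles of the two
  independent processes may be exchanged.\<close>

lemma (in prob_space) centered_increments_joint_brownian_motion:
  fixes B :: "real \<Rightarrow> 'a \<Rightarrow> real ^ 'd" and B1 :: "real \<Rightarrow> 'a \<Rightarrow> real ^ 'n"
  assumes B: "brownian_motion M B" and B1: "brownian_motion M B1" and ind: "independent_processes M B B1"
  shows "centered_increments M (completed_natural_filtration M (joint_process B B1)) (joint_process B B1)"
proof -
  let ?W = "joint_process B B1"
  let ?F = "completed_natural_filtration M ?W"
  have Bm: "B t \<in> borel_measurable M" "B1 t \<in> borel_measurable M" if "0 \<le> t" for t
    using brownian_motion_measurable B B1 that by auto
  have Wm: "?W t \<in> borel_measurable M" if "0 \<le> t" for t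
    using Bm[OF that] by (rule measurable_joint_process)
  have ind': "independent_processes M B1 B"
    using ind unfolding independent_processes_def by (rule indep_set_commute)
  have FW: "sets (?F s) \<subseteq> sigma_sets (space M) (process_events M {0..s} B \<union> process_events M {0..s} B1 \<union> null_sets M)"
    (is "_ \<subseteq> sigma_sets _ ?E") for s
    unfolding sets_completed_filtration
  proof (rule sigma_sets_mono, safe)
    have E: "?E \<subseteq> Pow (space M)" by (auto simp: process_events_def dest: sets.sets_into_space)
    fix A assume "A \<in> process_events M {0..s} ?W"
    then obtain q C where q: "q \<in> {0..s}" "C \<in> sets borel" and A: "A = ?W q -` C \<inter> space M"
      by (auto simp: process_events_def)
    have gen: "Y \<in> borel_measurable (sigma (space M) ?E)"
      if "\<And>C. C \<in> sets borel \<Longrightarrow> Y -` C \<inter> space M \<in> ?E" for Y :: "'a \<Rightarrow> real ^ 'k"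
      using that E by (intro measurableI) (auto simp: sets_measure_of space_measure_of intro: sigma_sets.Basic)
    have "B q -` C \<inter> space M \<in> ?E" "B1 q -` C' \<inter> space M \<in> ?E" if "C \<in> sets borel" "C' \<in> sets borel" for C C'
      using that q(1) unfolding process_events_def by blast+
    then have "B q \<in> borel_measurable (sigma (space M) ?E)" "B1 q \<in> borel_measurable (sigma (space M) ?E)"
      using gen[of "B q"] gen[of "B1 q"] sets.empty_sets by blast+
    then have "?W q \<in> borel_measurable (sigma (space M) ?E)" by (rule measurable_joint_process)
    from measurable_sets[OF this q(2)]
    show "A \<in> sigma_sets (space M) ?E"
      using E A by (simp add: sets_measure_of space_measure_of)
  qed (auto intro: sigma_sets.Basic)
  show ?thesis
  proof
    fix s t :: real and a :: "'d + 'n"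
    show "space (?F t) = space M" by simp
    show "0 \<le> t \<Longrightarrow> sets (?F t) \<subseteq> events" using sets_completed_filtration_subset[of ?W M t] Wm by blast
    show "s \<le> t \<Longrightarrow> sets (?F s) \<subseteq> sets (?F t)" by (rule sets_completed_filtration_mono)
    show "0 \<le> t \<Longrightarrow> ?W t \<in> borel_measurable (?F t)" by (rule measurable_completed_filtration) auto
    assume st: "0 \<le> s" "s < t"
    show "integrable M (\<lambda>\<omega>. (?W t \<omega> - ?W s \<omega>) $ a)" "expectation (\<lambda>\<omega>. (?W t \<omega> - ?W s \<omega>) $ a) = 0"
      "integrable M (\<lambda>\<omega>. ((?W t \<omega> - ?W s \<omega>) $ a)\<^sup>2)" "expectation (\<lambda>\<omega>. ((?W t \<omega> - ?W s \<omega>) $ a)\<^sup>2) = t - s"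
      using brownian_increment_moments[OF B st] brownian_increment_moments[OF B1 st]
      by (cases a; simp add: joint_process_def)+
    fix Y :: "'a \<Rightarrow> real" assume Y: "Y \<in> borel_measurable (?F s)"
    have YM: "Y \<in> borel_measurable M"
      using Y measurable_mono[of borel borel "?F s" M] sets_completed_filtration_subset[of ?W M s] Wm by auto
    have key: "indep_var borel Y borel (\<lambda>\<omega>. (V t \<omega> - V s \<omega>) $ k)"
      if V: "brownian_motion M V" and iV: "indep_set (sigma_sets (space M) (process_events M {0..s} B \<union> process_events M {0..s} B1 \<union> null_sets M))
           {(\<lambda>\<omega>. V t \<omega> - V s \<omega>) -` C \<inter> space M | C. C \<in> sets borel}"
      for V :: "real \<Rightarrow> 'a \<Rightarrow> real ^ 'k" and k
    proof (rule indep_varI_indep_set[OF iV])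
      have Vm: "V t \<in> borel_measurable M" "V s \<in> borel_measurable M"
        using brownian_motion_measurable[OF V] st by auto
      show "(\<lambda>\<omega>. (V t \<omega> - V s \<omega>) $ k) \<in> borel_measurable M"
        using Vm by measurable
      show "Y \<in> borel_measurable M" by fact
      fix A :: "real set" assume A: "A \<in> sets borel"
      show "Y -` A \<inter> space M \<in> sigma_sets (space M) (process_events M {0..s} B \<union> process_events M {0..s} B1 \<union> null_sets M)"
        using measurable_sets[OF Y A] FW by auto
      have "(\<lambda>y :: real ^ 'k. y $ k) \<in> borel_measurable borel" by measurable
      from measurable_sets[OF this A]
      show "(\<lambda>\<omega>. (V t \<omega> - V s \<omega>) $ k) -` A \<inter> space M \<in> {(\<lambda>\<omega>. V t \<omega> - V s \<omega>) -` C \<inter> space M | C. C \<in> sets borel}"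
        by (intro CollectI exI[of _ "(\<lambda>y. y $ k) -` A"]) auto
    qed
    show "indep_var borel Y borel (\<lambda>\<omega>. (?W t \<omega> - ?W s \<omega>) $ a)"
    proof (cases a)
      case (Inl k)
      then show ?thesis
        using key[OF B brownian_increment_indep_joint_past[OF B Bm(2) ind st], of k] by (simp add: joint_process_def)
    next
      case (Inr k)
      then show ?thesis
        using key[OF B1, of k] brownian_increment_indep_joint_past[OF B1 Bm(1) ind' st] by (simp add: joint_process_def Un_commute Un_left_commute)
    qed
  qed
qed

section \<open>Comparing Ito integrals driven by the joint process\<close>

definition block_row :: "real ^ 'd ^ 'n \<Rightarrow> real ^ 'k ^ 'n \<Rightarrow> real ^ ('d + 'k) ^ 'n" where
  "block_row A C = (\<chi> i j. case j of Inl k \<Rightarrow> A $ i $ k | Inr k \<Rightarrow> C $ i $ k)"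

lemma sigma_r_eq_block_row: "sigma_r r \<sigma> x u v = block_row (\<sigma> x u v) (r *\<^sub>R mat 1)"
  by (simp add: sigma_r_def block_row_def)

lemma sum_UNIV_sum_type:
  "(\<Sum>j\<in>(UNIV :: ('d::finite + 'k::finite) set). g j) = (\<Sum>k\<in>UNIV. g (Inl k)) + (\<Sum>k\<in>UNIV. g (Inr k))"
  unfolding UNIV_Plus_UNIV[symmetric] by (subst sum.Plus) auto

lemma block_row_diff: "block_row A C - block_row A' C' = block_row (A - A') (C - C')"
  by (auto simp: block_row_def vec_eq_iff split: sum.split)

lemma norm_block_row_0: "norm (block_row A (0 :: real ^ 'k ^ 'n)) = norm (A :: real ^ 'd ^ 'n)"
proof -
  have "(norm (block_row A (0 :: real ^ 'k ^ 'n)))\<^sup>2 = (norm A)\<^sup>2"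
    unfolding norm_matrix_power2 by (simp add: block_row_def sum_UNIV_sum_type)
  then show ?thesis by (simp add: power2_eq_iff_nonneg)
qed

lemma block_row_mult_joint_process:
  "block_row A C *v (joint_process Y Z t \<omega> - joint_process Y Z s \<omega>) = A *v (Y t \<omega> - Y s \<omega>) + C *v (Z t \<omega> - Z s \<omega>)"
  by (simp add: vec_eq_iff block_row_def joint_process_def matrix_vector_mult_def sum_UNIV_sum_type)

text \<open>The limits in the definition of the Ito integral concern probabilities of events; without
  measurability the value 0 of \<^term>\<open>measure M\<close> on other sets would make them meaningless. Clamping the time to
  \<open>{0..t}\<close> turns progressive measurability into joint measurability on the full product.\<close>

lemma progressively_measurable_error:
  fixes H :: "real \<Rightarrow> 'w \<Rightarrow> real ^ 'm ^ 'n"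
  assumes H: "progressively_measurable F H" and F: "\<And>t. space (F t) = space M" "\<And>t. 0 \<le> t \<Longrightarrow> sets (F t) \<subseteq> sets M"
    and G: "is_simple_proc M F G" and t: "0 \<le> t"
  defines "E \<equiv> \<lambda>s \<omega>. ennreal ((norm (simple_proc_val G s \<omega> - H s \<omega>))\<^sup>2) * indicator {0..t} s"
  shows "\<omega> \<in> space M \<Longrightarrow> (\<lambda>s. E s \<omega>) \<in> borel_measurable lborel"
    and "(\<lambda>\<omega>. \<integral>\<^sup>+s. E s \<omega> \<partial>lborel) \<in> borel_measurable M"
proof -
  obtain k \<tau> \<xi> where Gk: "G = (k, \<tau>, \<xi>)" by (cases G) auto
  have \<xi>: "\<xi> i \<in> borel_measurable M" if "i < k" for i
  proof -
    have "0 \<le> \<tau> i" using G incseqD[of \<tau> 0 i] by (auto simp: Gk)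
    moreover have "\<xi> i \<in> borel_measurable (F (\<tau> i))" using G that by (auto simp: Gk)
    ultimately show ?thesis using F measurable_mono[of borel borel "F (\<tau> i)" M] by auto
  qed
  have "(\<lambda>(\<omega>, s). (max 0 (min t s), \<omega>)) \<in> M \<Otimes>\<^sub>M lborel \<rightarrow>\<^sub>M restrict_space borel {0..t} \<Otimes>\<^sub>M F t"
    unfolding case_prod_beta
  proof (rule measurable_Pair)
    show "(\<lambda>p. max 0 (min t (snd p))) \<in> M \<Otimes>\<^sub>M lborel \<rightarrow>\<^sub>M restrict_space borel {0..t}"
      using t by (intro measurable_restrict_space2) auto
    show "fst \<in> M \<Otimes>\<^sub>M lborel \<rightarrow>\<^sub>M F t"
      by (rule measurable_compose[OF measurable_fst])
         (use F(1)[of t] F(2)[OF t] in \<open>auto simp: measurable_def\<close>)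
  qed
  moreover have "(\<lambda>(s, \<omega>). H s \<omega>) \<in> borel_measurable (restrict_space borel {0..t} \<Otimes>\<^sub>M F t)"
    using H t by (simp add: progressively_measurable_def)
  ultimately have "(\<lambda>p. case (case p of (\<omega>, s) \<Rightarrow> (max 0 (min t s), \<omega>)) of (s, \<omega>) \<Rightarrow> H s \<omega>) \<in> borel_measurable (M \<Otimes>\<^sub>M lborel)"
    by (rule measurable_compose)
  then have Hc: "(\<lambda>(\<omega>, s). H (max 0 (min t s)) \<omega>) \<in> borel_measurable (M \<Otimes>\<^sub>M lborel)"
    by (simp add: split_beta')
  have Gm: "(\<lambda>(\<omega>, s). simple_proc_val G s \<omega>) \<in> borel_measurable (M \<Otimes>\<^sub>M lborel)"
    unfolding Gk simple_proc_val.simps case_prod_beta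
    using \<xi> by (intro borel_measurable_sum borel_measurable_scaleR) (auto intro: measurable_compose[OF measurable_snd] measurable_compose[OF measurable_fst])
  have "(\<lambda>(\<omega>, s). ennreal ((norm (simple_proc_val G s \<omega> - H (max 0 (min t s)) \<omega>))\<^sup>2) * indicator {0..t} s) \<in> borel_measurable (M \<Otimes>\<^sub>M lborel)"
    using Hc Gm unfolding case_prod_beta by measurable
  also have "(\<lambda>(\<omega>, s). ennreal ((norm (simple_proc_val G s \<omega> - H (max 0 (min t s)) \<omega>))\<^sup>2) * indicator {0..t} s) = (\<lambda>(\<omega>, s). E s \<omega>)"
    by (auto simp: E_def fun_eq_iff indicator_def)
  finally have E: "(\<lambda>(\<omega>, s). E s \<omega>) \<in> borel_measurable (M \<Otimes>\<^sub>M lborel)" .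
  show "(\<lambda>\<omega>. \<integral>\<^sup>+s. E s \<omega> \<partial>lborel) \<in> borel_measurable M"
    using E by (rule lborel.borel_measurable_nn_integral)
  show "(\<lambda>s. E s \<omega>) \<in> borel_measurable lborel" if "\<omega> \<in> space M"
    using measurable_compose[OF measurable_Pair1'[OF that] E] by simp
qed

lemma AE_zero_if_prob_gt_zero:
  fixes V :: "'w \<Rightarrow> 'b::{real_normed_vector, second_countable_topology}"
  assumes "prob_space M" and [measurable]: "V \<in> borel_measurable M"
    and V: "\<And>\<epsilon>. 0 < \<epsilon> \<Longrightarrow> measure M {\<omega>\<in>space M. \<epsilon> < norm (V \<omega>)} = 0"
  shows "AE \<omega> in M. V \<omega> = 0"
proof -
  interpret prob_space M by fact
  have "AE \<omega> in M. norm (V \<omega>) \<le> 1 / real (Suc n)" for n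
  proof -
    have "{\<omega>\<in>space M. 1 / real (Suc n) < norm (V \<omega>)} \<in> null_sets M"
      using V[of "1 / real (Suc n)"] by (auto simp: null_sets_def emeasure_eq_measure)
    then show ?thesis by (rule AE_I') auto
  qed
  then have "AE \<omega> in M. \<forall>n. norm (V \<omega>) \<le> 1 / real (Suc n)"
    by (simp add: AE_all_countable)
  then show ?thesis
  proof eventually_elim
    case (elim \<omega>)
    have "norm (V \<omega>) \<le> 0"
      by (rule LIMSEQ_le_const[OF lim_inverse_n'[THEN LIMSEQ_Suc]]) (use elim in auto)
    then show ?case by simp
  qed
qed

lemma measurable_simple_integral:
  assumes G: "is_simple_proc M F G" and F: "\<And>t. space (F t) = space M" "\<And>t. 0 \<le> t \<Longrightarrow> sets (F t) \<subseteq> sets M"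
    and W: "\<And>t. 0 \<le> t \<Longrightarrow> W t \<in> borel_measurable M" and t: "0 \<le> t"
  shows "simple_integral W G t \<in> borel_measurable M"
proof -
  obtain k \<tau> \<xi> where Gk: "G = (k, \<tau>, \<xi>)" by (cases G) auto
  have \<tau>: "0 \<le> \<tau> i" for i
    using G incseqD[of \<tau> 0 i] by (auto simp: Gk)
  have \<xi>: "\<xi> i \<in> borel_measurable M" if "i < k" for i
  proof -
    have "\<xi> i \<in> borel_measurable (F (\<tau> i))" using G that by (auto simp: Gk)
    then show ?thesis using F \<tau>[of i] measurable_mono[of borel borel "F (\<tau> i)" M] by auto
  qed
  have "simple_integral W G t = (\<lambda>\<omega>. \<Sum>i<k. \<xi> i \<omega> *v (W (min t (\<tau> (Suc i))) \<omega> - W (min t (\<tau> i)) \<omega>))"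
    by (simp add: Gk fun_eq_iff)
  then show ?thesis
    using \<xi> W t \<tau> by (auto intro!: borel_measurable_sum borel_measurable_matrix_vector_mult borel_measurable_diff)
qed

text \<open>Let \<open>G\<close> and \<open>G'\<close> be simple processes that approximate \<open>block_row H C\<close> and \<open>H\<close>. The process
  \<open>G - block_row G' C\<close> has an elementary integral that converges to the left-hand side, while its
  energy tends to zero in probability, since \<open>block_row H C - block_row H C\<close> vanishes.\<close>

lemma (in prob_space) ito_integral_block_row_minus_ito_integral:
  fixes B :: "real \<Rightarrow> 'a \<Rightarrow> real ^ 'd" and B1 :: "real \<Rightarrow> 'a \<Rightarrow> real ^ 'k" and H :: "real \<Rightarrow> 'a \<Rightarrow> real ^ 'd ^ 'n"
    and C :: "real ^ 'k ^ 'n"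
  assumes B: "brownian_motion M B" and B1: "brownian_motion M B1" and ind: "independent_processes M B B1"
    and Y: "ito_integral M (completed_natural_filtration M B) B H Y"
    and Z: "ito_integral M (completed_natural_filtration M (joint_process B B1)) (joint_process B B1)
              (\<lambda>t \<omega>. block_row (H t \<omega>) C) Z"
    and t: "0 \<le> t"
  shows "AE \<omega> in M. Z t \<omega> - Y t \<omega> - C *v (B1 t \<omega> - B1 0 \<omega>) = 0"
proof (rule AE_zero_if_prob_gt_zero)
  let ?W = "joint_process B B1"
  let ?F = "completed_natural_filtration M ?W" and ?FB = "completed_natural_filtration M B"
  interpret CI: centered_increments M ?F ?W
    by (rule centered_increments_joint_brownian_motion[OF B B1 ind])
  have Bm: "B q \<in> borel_measurable M" "B1 q \<in> borel_measurable M" if "0 \<le> q" for q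
    using brownian_motion_measurable B B1 that by auto
  have Wm: "?W q \<in> borel_measurable M" if "0 \<le> q" for q
    using CI.measurable_F[OF that CI.adapted[OF that]] .
  have FB: "sets (?FB q) \<subseteq> sets (?F q)" for q
    unfolding sets_completed_filtration[of M B]
  proof (rule sets.sigma_sets_subset[of _ "?F q", simplified], safe)
    fix A assume "A \<in> process_events M {0..q} B"
    then obtain q' D where q': "q' \<in> {0..q}" "D \<in> sets borel" "A = B q' -` D \<inter> space M"
      by (auto simp: process_events_def)
    have "?W q' \<in> borel_measurable (?F q)" using q' by (intro measurable_completed_filtration) auto
    from measurable_sets[OF measurable_joint_process_components(1)[OF this] q'(2)]
    show "A \<in> sets (?F q)" using q' by simp
  next
    fix A assume "A \<in> null_sets M" then show "A \<in> sets (?F q)" by (auto simp: sets_completed_filtration)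
  qed
  have FBM: "0 \<le> q \<Longrightarrow> sets (?FB q) \<subseteq> events" for q
    using FB[of q] CI.sets_F[of q] by blast
  show "prob_space M" by unfold_locales
  have Ym: "Y t \<in> borel_measurable M"
    using Y t FBM[OF t] measurable_mono[of borel borel "?FB t" M] by (auto simp: ito_integral_def)
  have Zm: "Z t \<in> borel_measurable M"
    using Z t CI.measurable_F[OF t] by (auto simp: ito_integral_def)
  define V where "V \<omega> = Z t \<omega> - Y t \<omega> - C *v (B1 t \<omega> - B1 0 \<omega>)" for \<omega>
  have CB1: "(\<lambda>\<omega>. C *v (B1 t \<omega> - B1 0 \<omega>)) \<in> borel_measurable M"
    using Bm t by (intro borel_measurable_matrix_vector_mult borel_measurable_diff) auto
  have Vm: "V \<in> borel_measurable M"
    unfolding V_def using Zm Ym CB1 by measurable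
  then show "(\<lambda>\<omega>. Z t \<omega> - Y t \<omega> - C *v (B1 t \<omega> - B1 0 \<omega>)) \<in> borel_measurable M"
    unfolding V_def[abs_def] .

  obtain G where G: "\<And>k. is_simple_proc M ?F (G k)"
    and G1: "\<And>\<epsilon>. 0 < \<epsilon> \<Longrightarrow> (\<lambda>k. prob {\<omega>\<in>space M. ennreal \<epsilon> <
           (\<integral>\<^sup>+s\<in>{0..t}. ennreal ((norm (simple_proc_val (G k) s \<omega> - block_row (H s \<omega>) C))\<^sup>2) \<partial>lborel)}) \<longlonglongrightarrow> 0"
    and G2: "\<And>\<epsilon>. 0 < \<epsilon> \<Longrightarrow> (\<lambda>k. prob {\<omega>\<in>space M. \<epsilon> < norm (simple_integral ?W (G k) t \<omega> - Z t \<omega>)}) \<longlonglongrightarrow> 0"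
    using Z t unfolding ito_integral_def trace_norm_eq_norm by blast
  obtain G' where G': "\<And>k. is_simple_proc M ?FB (G' k)"
    and G1': "\<And>\<epsilon>. 0 < \<epsilon> \<Longrightarrow> (\<lambda>k. prob {\<omega>\<in>space M. ennreal \<epsilon> <
           (\<integral>\<^sup>+s\<in>{0..t}. ennreal ((norm (simple_proc_val (G' k) s \<omega> - H s \<omega>))\<^sup>2) \<partial>lborel)}) \<longlonglongrightarrow> 0"
    and G2': "\<And>\<epsilon>. 0 < \<epsilon> \<Longrightarrow> (\<lambda>k. prob {\<omega>\<in>space M. \<epsilon> < norm (simple_integral B (G' k) t \<omega> - Y t \<omega>)}) \<longlonglongrightarrow> 0"
    using Y t unfolding ito_integral_def trace_norm_eq_norm by blast
  have pH: "progressively_measurable ?F (\<lambda>t \<omega>. block_row (H t \<omega>) C)" "progressively_measurable ?FB H"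
    using Y Z by (auto simp: ito_integral_def)
  define E1 where "E1 k \<omega> = (\<integral>\<^sup>+s\<in>{0..t}. ennreal ((norm (simple_proc_val (G k) s \<omega> - block_row (H s \<omega>) C))\<^sup>2) \<partial>lborel)" for k \<omega>
  define E2 where "E2 k \<omega> = (\<integral>\<^sup>+s\<in>{0..t}. ennreal ((norm (simple_proc_val (G' k) s \<omega> - H s \<omega>))\<^sup>2) \<partial>lborel)" for k \<omega>
  have E1s: "(\<lambda>s. ennreal ((norm (simple_proc_val (G k) s \<omega> - block_row (H s \<omega>) C))\<^sup>2) * indicator {0..t} s) \<in> borel_measurable lborel"
    and E2s: "(\<lambda>s. ennreal ((norm (simple_proc_val (G' k) s \<omega> - H s \<omega>))\<^sup>2) * indicator {0..t} s) \<in> borel_measurable lborel"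
    if "\<omega> \<in> space M" for k \<omega>
    using progressively_measurable_error(1)[OF pH(1) CI.space_F CI.sets_F G t that]
      progressively_measurable_error(1)[OF pH(2) space_completed_filtration FBM G' t that] by auto
  have E1m: "E1 k \<in> borel_measurable M" and E2m: "E2 k \<in> borel_measurable M" for k
    using progressively_measurable_error(2)[OF pH(1) CI.space_F CI.sets_F G t]
      progressively_measurable_error(2)[OF pH(2) space_completed_filtration FBM G' t]
    unfolding E1_def[abs_def] E2_def[abs_def] by auto
  define S where "S k \<omega> = simple_integral ?W (G k) t \<omega> - simple_integral B (G' k) t \<omega> - C *v (B1 t \<omega> - B1 0 \<omega>)" for k \<omega>
  have IGm: "simple_integral ?W (G k) t \<in> borel_measurable M" "simple_integral B (G' k) t \<in> borel_measurable M" for k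
    using measurable_simple_integral[OF G CI.space_F CI.sets_F Wm t]
      measurable_simple_integral[OF G' space_completed_filtration FBM Bm(1) t] by auto
  have Sm: "S k \<in> borel_measurable M" for k
    unfolding S_def using IGm[of k] CB1 by measurable

  have tail: "prob {\<omega>\<in>space M. \<epsilon> < norm (S k \<omega>)} \<le> prob {\<omega>\<in>space M. ennreal (\<delta> / 4) < E1 k \<omega>} +
      prob {\<omega>\<in>space M. ennreal (\<delta> / 4) < E2 k \<omega>} + real CARD('d + 'k) * \<delta> / \<epsilon>\<^sup>2"
    if pos: "0 < \<epsilon>" "0 < \<delta>" for \<epsilon> \<delta> k
  proof -
    obtain m \<tau> \<xi> where Gk: "G k = (m, \<tau>, \<xi>)" by (cases "G k") auto
    obtain m' \<tau>' \<xi>' where Gk': "G' k = (m', \<tau>', \<xi>')" by (cases "G' k") auto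
    have \<tau>: "0 \<le> \<tau> 0" "incseq \<tau>" and \<xi>: "\<And>i. i < m \<Longrightarrow> \<xi> i \<in> borel_measurable (?F (\<tau> i))"
      "\<And>i. i < m \<Longrightarrow> \<exists>c. \<forall>\<omega>\<in>space M. norm (\<xi> i \<omega>) \<le> c"
      using G[of k] by (auto simp: Gk trace_norm_eq_norm)
    have \<tau>': "0 \<le> \<tau>' 0" "incseq \<tau>'" and \<xi>': "\<And>i. i < m' \<Longrightarrow> \<xi>' i \<in> borel_measurable (?FB (\<tau>' i))"
      "\<And>i. i < m' \<Longrightarrow> \<exists>c. \<forall>\<omega>\<in>space M. norm (\<xi>' i \<omega>) \<le> c"
      using G'[of k] by (auto simp: Gk' trace_norm_eq_norm)
    have \<tau>nn: "0 \<le> \<tau> i" "0 \<le> \<tau>' i" for i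
      using incseqD[OF \<tau>(2), of 0 i] incseqD[OF \<tau>'(2), of 0 i] \<tau>(1) \<tau>'(1) by auto
    have \<tau>Suc: "\<tau> i \<le> \<tau> (Suc i)" "\<tau>' i \<le> \<tau>' (Suc i)" for i
      using incseqD[OF \<tau>(2), of i "Suc i"] incseqD[OF \<tau>'(2), of i "Suc i"] by auto
    \<comment> \<open>The intervals of \<open>G k\<close>, those of \<open>G' k\<close>, and one interval \<open>{0<..t}\<close> for the constant block \<open>C\<close>;
      all are cut off at \<open>t\<close>.\<close>
    let ?I = "{..<m} <+> ({..<m'} <+> (UNIV :: unit set))"
    define \<alpha> where "\<alpha> = case_sum (\<lambda>i. min t (\<tau> i)) (case_sum (\<lambda>i. min t (\<tau>' i)) (\<lambda>_::unit. 0))"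
    define \<beta> where "\<beta> = case_sum (\<lambda>i. min t (\<tau> (Suc i))) (case_sum (\<lambda>i. min t (\<tau>' (Suc i))) (\<lambda>_::unit. t))"
    define \<zeta> where "\<zeta> = case_sum \<xi> (case_sum (\<lambda>i \<omega>. - block_row (\<xi>' i \<omega>) 0) (\<lambda>_::unit. \<lambda>_. - block_row 0 C))"
    have sumI: "(\<Sum>i\<in>?I. h i) = (\<Sum>i<m. h (Inl i)) + (\<Sum>i<m'. h (Inr (Inl i))) + h (Inr (Inr ()))"
      for h :: "nat + nat + unit \<Rightarrow> 'z::comm_monoid_add"
      by (subst sum.Plus; simp)+ (simp add: sum.Plus UNIV_unit add.assoc)
    define Q where "Q s \<omega> = (\<Sum>i\<in>?I. indicator {\<alpha> i<..\<beta> i} s *\<^sub>R \<zeta> i \<omega>)" for s \<omega>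
    have W_eq: "(\<Sum>i\<in>?I. \<zeta> i \<omega> *v (?W (\<beta> i) \<omega> - ?W (\<alpha> i) \<omega>)) = S k \<omega>" for \<omega>
      unfolding sumI S_def Gk Gk' simple_integral.simps
      by (simp add: \<zeta>_def \<alpha>_def \<beta>_def block_row_mult_joint_process sum_negf
          bounded_bilinear.minus_left[OF bounded_bilinear_matrix_vector_mult])
    have Q_in: "Q s \<omega> = simple_proc_val (G k) s \<omega> - block_row (simple_proc_val (G' k) s \<omega>) C" if "s \<in> {0<..t}" for s \<omega>
    proof -
      have ind: "indicator {min t a<..min t b} s = (indicator {a<..b} s :: real)" for a b
        using that by (auto simp: indicator_def)
      have "block_row (simple_proc_val (G' k) s \<omega>) C = (\<Sum>i<m'. indicator {\<tau>' i<..\<tau>' (Suc i)} s *\<^sub>R block_row (\<xi>' i \<omega>) 0) + block_row 0 C"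
        unfolding Gk' simple_proc_val.simps
        by (auto simp: vec_eq_iff block_row_def sum_component split: sum.split)
      then show ?thesis
        unfolding Q_def sumI using that by (simp add: \<zeta>_def \<alpha>_def \<beta>_def ind Gk sum_negf)
    qed
    have Q_out: "Q s \<omega> = 0" if "s \<notin> {0<..t}" for s \<omega>
    proof -
      have "0 \<le> \<alpha> i \<and> \<beta> i \<le> t" for i
        using \<tau>nn t by (auto simp: \<alpha>_def \<beta>_def split: sum.split)
      then have "s \<notin> {\<alpha> i<..\<beta> i}" for i using that by (meson greaterThanAtMost_iff order_le_less_trans order_trans)
      then show ?thesis unfolding Q_def by simp
    qed
    \<comment> \<open>The blocks \<open>C\<close> cancel, and \<open>\<parallel>a - b\<parallel>\<^sup>2 \<le> 2 \<parallel>a\<parallel>\<^sup>2 + 2 \<parallel>b\<parallel>\<^sup>2\<close>; so an energy above \<open>\<delta>\<close> makes one of the two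
      approximation errors exceed \<open>\<delta> / 4\<close>.\<close>
    have Q_le: "(\<integral>\<^sup>+s. ennreal ((norm (Q s \<omega>))\<^sup>2) \<partial>lborel) \<le> 2 * E1 k \<omega> + 2 * E2 k \<omega>" if \<omega>: "\<omega> \<in> space M" for \<omega>
    proof -
      have "ennreal ((norm (Q s \<omega>))\<^sup>2) \<le> 2 * (ennreal ((norm (simple_proc_val (G k) s \<omega> - block_row (H s \<omega>) C))\<^sup>2) * indicator {0..t} s)
          + 2 * (ennreal ((norm (simple_proc_val (G' k) s \<omega> - H s \<omega>))\<^sup>2) * indicator {0..t} s)" for s
      proof (cases "s \<in> {0<..t}")
        case True
        let ?x = "simple_proc_val (G k) s \<omega> - block_row (H s \<omega>) C" and ?y = "simple_proc_val (G' k) s \<omega> - H s \<omega>"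
        have "Q s \<omega> = ?x - block_row ?y 0"
          unfolding Q_in[OF True] using block_row_diff[of "simple_proc_val (G' k) s \<omega>" C "H s \<omega>" C] by (simp add: algebra_simps)
        then have "norm (Q s \<omega>) \<le> norm ?x + norm ?y"
          using norm_triangle_ineq4[of ?x "block_row ?y 0"] by (simp add: norm_block_row_0)
        then have "(norm (Q s \<omega>))\<^sup>2 \<le> (norm ?x + norm ?y)\<^sup>2" by (intro power_mono) auto
        also have "\<dots> \<le> 2 * (norm ?x)\<^sup>2 + 2 * (norm ?y)\<^sup>2"
          using sum_squares_bound[of "norm ?x" "norm ?y"] by (simp add: power2_sum)
        finally have "ennreal ((norm (Q s \<omega>))\<^sup>2) \<le> ennreal (2 * (norm ?x)\<^sup>2 + 2 * (norm ?y)\<^sup>2)" by (rule ennreal_leI)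
        then show ?thesis using True by (simp add: ennreal_mult ennreal_plus)
      qed (simp add: Q_out)
      then have "(\<integral>\<^sup>+s. ennreal ((norm (Q s \<omega>))\<^sup>2) \<partial>lborel) \<le> (\<integral>\<^sup>+s. 2 * (ennreal ((norm (simple_proc_val (G k) s \<omega> - block_row (H s \<omega>) C))\<^sup>2) * indicator {0..t} s)
          + 2 * (ennreal ((norm (simple_proc_val (G' k) s \<omega> - H s \<omega>))\<^sup>2) * indicator {0..t} s) \<partial>lborel)"
        by (intro nn_integral_mono)
      also have "\<dots> = 2 * E1 k \<omega> + 2 * E2 k \<omega>"
        unfolding E1_def E2_def using E1s[OF \<omega>] E2s[OF \<omega>]
        by (subst nn_integral_add) (auto simp: nn_integral_cmult)
      finally show ?thesis .
    qed
    have tail1: "prob {\<omega>\<in>space M. \<epsilon> < norm (S k \<omega>)} \<le> prob {\<omega>\<in>space M. ennreal \<delta> < (\<integral>\<^sup>+s. ennreal ((norm (Q s \<omega>))\<^sup>2) \<partial>lborel)}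
        + real CARD('d + 'k) * \<delta> / \<epsilon>\<^sup>2"
      unfolding W_eq[symmetric] Q_def
    proof (rule CI.interval_family_tail_bound)
      fix i assume i: "i \<in> ?I"
      show "0 \<le> \<alpha> i \<and> \<alpha> i \<le> \<beta> i"
        using \<tau>nn \<tau>Suc t by (auto simp: \<alpha>_def \<beta>_def min_le_iff_disj split: sum.split)
      have bm: "(\<lambda>\<omega>. - block_row (g \<omega>) (0 :: real ^ 'k ^ 'n)) \<in> borel_measurable N" if "g \<in> borel_measurable N"
        for g :: "'a \<Rightarrow> real ^ 'd ^ 'n" and N
      proof -
        have "linear (\<lambda>A :: real ^ 'd ^ 'n. - block_row A (0 :: real ^ 'k ^ 'n))"
          by (rule linearI) (auto simp: block_row_def vec_eq_iff split: sum.split)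
        then have "continuous_on UNIV (\<lambda>A :: real ^ 'd ^ 'n. - block_row A (0 :: real ^ 'k ^ 'n))"
          by (rule linear_continuous_on[OF linear_conv_bounded_linear[THEN iffD1]])
        then show ?thesis using that by (intro measurable_compose[OF that] borel_measurable_continuous_onI)
      qed
      show "\<zeta> i \<in> borel_measurable (?F (\<alpha> i))" if "\<alpha> i < \<beta> i"
      proof (cases i)
        case (Inl j)
        then have "\<alpha> i = \<tau> j" "j < m" using that i by (auto simp: \<alpha>_def \<beta>_def)
        then show ?thesis using \<xi>(1) Inl by (simp add: \<zeta>_def)
      next
        case (Inr i')
        show ?thesis
        proof (cases i')
          case (Inl j)
          then have j: "\<alpha> i = \<tau>' j" "j < m'" using that i \<open>i = Inr i'\<close> by (auto simp: \<alpha>_def \<beta>_def)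
          have "\<xi>' j \<in> borel_measurable (?F (\<tau>' j))"
            using \<xi>'(1)[OF j(2)] FB[of "\<tau>' j"] measurable_mono[of borel borel "?FB (\<tau>' j)" "?F (\<tau>' j)"] by auto
          from bm[OF this] show ?thesis using j Inl Inr by (simp add: \<zeta>_def)
        next
          case (Inr u)
          then show ?thesis using \<open>i = Inr i'\<close> by (simp add: \<zeta>_def)
        qed
      qed
      show "\<exists>c. \<forall>\<omega>\<in>space M. norm (\<zeta> i \<omega>) \<le> c"
        using i \<xi>(2) \<xi>'(2) by (auto simp: \<zeta>_def norm_block_row_0)
    qed (use pos in auto)
    have tail2: "prob {\<omega>\<in>space M. ennreal \<delta> < (\<integral>\<^sup>+s. ennreal ((norm (Q s \<omega>))\<^sup>2) \<partial>lborel)} \<le>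
        prob ({\<omega>\<in>space M. ennreal (\<delta> / 4) < E1 k \<omega>} \<union> {\<omega>\<in>space M. ennreal (\<delta> / 4) < E2 k \<omega>})"
    proof (rule finite_measure_mono)
      show "{\<omega>\<in>space M. ennreal \<delta> < (\<integral>\<^sup>+s. ennreal ((norm (Q s \<omega>))\<^sup>2) \<partial>lborel)} \<subseteq>
        {\<omega>\<in>space M. ennreal (\<delta> / 4) < E1 k \<omega>} \<union> {\<omega>\<in>space M. ennreal (\<delta> / 4) < E2 k \<omega>}"
      proof safe
        fix \<omega> assume \<omega>: "\<omega> \<in> space M" and 1: "ennreal \<delta> < (\<integral>\<^sup>+s. ennreal ((norm (Q s \<omega>))\<^sup>2) \<partial>lborel)"
          and 2: "\<not> ennreal (\<delta> / 4) < E2 k \<omega>"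
        show "ennreal (\<delta> / 4) < E1 k \<omega>"
        proof (rule ccontr)
          assume "\<not> ennreal (\<delta> / 4) < E1 k \<omega>"
          then have "2 * E1 k \<omega> + 2 * E2 k \<omega> \<le> 2 * ennreal (\<delta> / 4) + 2 * ennreal (\<delta> / 4)"
            using 2 by (intro add_mono mult_left_mono) auto
          also have "\<dots> = ennreal \<delta>"
            using pos by (simp add: ennreal_plus[symmetric] ennreal_mult'[symmetric] ennreal_numeral[symmetric] del: ennreal_plus ennreal_numeral)
          finally show False using 1 Q_le[OF \<omega>] by (meson not_le order_trans)
        qed
      qed
      show "{\<omega>\<in>space M. ennreal (\<delta> / 4) < E1 k \<omega>} \<union> {\<omega>\<in>space M. ennreal (\<delta> / 4) < E2 k \<omega>} \<in> events"
        using E1m[of k] E2m[of k] by measurable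
    qed
    have tail3: "prob ({\<omega>\<in>space M. ennreal (\<delta> / 4) < E1 k \<omega>} \<union> {\<omega>\<in>space M. ennreal (\<delta> / 4) < E2 k \<omega>}) \<le>
       prob {\<omega>\<in>space M. ennreal (\<delta> / 4) < E1 k \<omega>} + prob {\<omega>\<in>space M. ennreal (\<delta> / 4) < E2 k \<omega>}"
      using E1m[of k] E2m[of k] by (intro measure_Un_le; measurable)
    show ?thesis using tail1 tail2 tail3 by linarith
  qed

  have main: "prob {\<omega>\<in>space M. 3 * \<epsilon> < norm (V \<omega>)} \<le> real CARD('d + 'k) * \<delta> / \<epsilon>\<^sup>2"
    if pos: "0 < \<epsilon>" "0 < \<delta>" for \<epsilon> \<delta>
  proof -
    have "prob {\<omega>\<in>space M. 3 * \<epsilon> < norm (V \<omega>)} \<le>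
         prob {\<omega>\<in>space M. \<epsilon> < norm (simple_integral ?W (G k) t \<omega> - Z t \<omega>)} +
         prob {\<omega>\<in>space M. \<epsilon> < norm (simple_integral B (G' k) t \<omega> - Y t \<omega>)} +
         (prob {\<omega>\<in>space M. ennreal (\<delta> / 4) < E1 k \<omega>} +
         prob {\<omega>\<in>space M. ennreal (\<delta> / 4) < E2 k \<omega>} + real CARD('d + 'k) * \<delta> / \<epsilon>\<^sup>2)" (is "_ \<le> ?P k") for k
    proof -
      let ?A = "{\<omega>\<in>space M. \<epsilon> < norm (simple_integral ?W (G k) t \<omega> - Z t \<omega>)}"
      let ?B = "{\<omega>\<in>space M. \<epsilon> < norm (simple_integral B (G' k) t \<omega> - Y t \<omega>)}"
      let ?C = "{\<omega>\<in>space M. \<epsilon> < norm (S k \<omega>)}"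
      have large: "{\<omega>\<in>space M. \<epsilon> < norm (h \<omega>)} \<in> events" if "h \<in> borel_measurable M" for h :: "'a \<Rightarrow> real ^ 'n"
        using that by measurable
      have ev: "?A \<in> events" "?B \<in> events" "?C \<in> events"
        by (intro large borel_measurable_diff IGm Ym Zm Sm)+
      have "{\<omega>\<in>space M. 3 * \<epsilon> < norm (V \<omega>)} \<subseteq> ?A \<union> ?B \<union> ?C"
      proof (rule subsetI, rule ccontr)
        fix \<omega> assume "\<omega> \<in> {\<omega>\<in>space M. 3 * \<epsilon> < norm (V \<omega>)}" "\<omega> \<notin> ?A \<union> ?B \<union> ?C"
        then have *: "3 * \<epsilon> < norm (V \<omega>)" "norm (simple_integral ?W (G k) t \<omega> - Z t \<omega>) \<le> \<epsilon>"
          "norm (simple_integral B (G' k) t \<omega> - Y t \<omega>) \<le> \<epsilon>" "norm (S k \<omega>) \<le> \<epsilon>"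
          by (simp_all add: not_less)
        have "V \<omega> = (simple_integral B (G' k) t \<omega> - Y t \<omega>) - (simple_integral ?W (G k) t \<omega> - Z t \<omega>) + S k \<omega>"
          by (simp add: V_def S_def)
        then have "norm (V \<omega>) \<le> norm (simple_integral B (G' k) t \<omega> - Y t \<omega>) + norm (simple_integral ?W (G k) t \<omega> - Z t \<omega>) + norm (S k \<omega>)"
          using norm_triangle_ineq[of "(simple_integral B (G' k) t \<omega> - Y t \<omega>) - (simple_integral ?W (G k) t \<omega> - Z t \<omega>)" "S k \<omega>"]
            norm_triangle_ineq4[of "simple_integral B (G' k) t \<omega> - Y t \<omega>" "simple_integral ?W (G k) t \<omega> - Z t \<omega>"] by simp
        then show False using * by simp
      qed
      then have "prob {\<omega>\<in>space M. 3 * \<epsilon> < norm (V \<omega>)} \<le> prob (?A \<union> ?B \<union> ?C)"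
        using ev by (intro finite_measure_mono) auto
      also have "\<dots> \<le> prob ?A + prob ?B + prob ?C"
        using measure_Un_le[OF sets.Un[OF ev(1,2)] ev(3)] measure_Un_le[OF ev(1,2)] by linarith
      finally show ?thesis using tail[OF pos, of k] by linarith
    qed
    moreover have "?P \<longlonglongrightarrow> 0 + 0 + (0 + 0 + real CARD('d + 'k) * \<delta> / \<epsilon>\<^sup>2)"
      using pos by (intro tendsto_add G2 G2' G1[folded E1_def] G1'[folded E2_def] tendsto_const) auto
    ultimately show ?thesis by (intro LIMSEQ_le_const[of ?P]) auto
  qed
  fix \<epsilon> :: real assume \<epsilon>: "0 < \<epsilon>"
  define n where "n = real CARD('d + 'k)"
  have n: "0 < n" unfolding n_def by (rule of_nat_0_less_iff[THEN iffD2, OF zero_less_card_finite])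
  have "prob {\<omega>\<in>space M. \<epsilon> < norm (V \<omega>)} \<le> 0 + e" if "0 < e" for e
    using main[of "\<epsilon> / 3" "e * (\<epsilon> / 3)\<^sup>2 / n", folded n_def] \<epsilon> that n by simp
  then have "prob {\<omega>\<in>space M. \<epsilon> < norm (V \<omega>)} \<le> 0" by (rule field_le_epsilon)
  then show "prob {\<omega>\<in>space M. \<epsilon> < norm (Z t \<omega> - Y t \<omega> - C *v (B1 t \<omega> - B1 0 \<omega>))} = 0"
    by (simp add: V_def measure_le_0_iff)
qed

section \<open>The linear equation driven by the auxiliary noise\<close>

text \<open>Here \<open>z\<close> solves \<open>dz = - \<kappa> z dt + dg\<close> along the partition points. On one interval the weighted increment of
  \<open>g\<close> differs from the increment of \<open>exp (- \<kappa> (s - t)) z t\<close> by an oscillation term of order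
  \<open>\<Delta>\<close> times the modulus of continuity of \<open>z\<close> and a term of order \<open>\<Delta>\<^sup>2\<close>. The latter increments telescope to \<open>z s\<close>.
  No differentiability of \<open>g\<close> is involved, which is what Brownian paths call for.\<close>

lemma exp_weighted_sum_tendsto:
  fixes z g :: "real \<Rightarrow> 'a::euclidean_space"
  assumes s: "0 < s" and \<kappa>: "0 \<le> \<kappa>" and z: "continuous_on {0..s} z" and g0: "g 0 = 0"
    and eq: "\<And>m i. 0 < m \<Longrightarrow> i \<le> m \<Longrightarrow>
       z (real i * s / real m) = - \<kappa> *\<^sub>R integral {0..real i * s / real m} z + g (real i * s / real m)"
  shows "(\<lambda>m. \<Sum>i<m. exp (- \<kappa> * (s - real (Suc i) * s / real m)) *\<^sub>R
            (g (real (Suc i) * s / real m) - g (real i * s / real m))) \<longlonglongrightarrow> z s"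
proof (rule LIMSEQ_I)
  fix e :: real assume e: "0 < e"
  obtain C where C: "0 < C" "\<And>t. t \<in> {0..s} \<Longrightarrow> norm (z t) \<le> C"
    using compact_imp_bounded[OF compact_continuous_image[OF z compact_Icc]] unfolding bounded_pos by auto
  define \<eta> where "\<eta> = e / (2 * (\<kappa> * s + 1))"
  have "0 < \<kappa> * s + 1" using \<kappa> s by (simp add: add_nonneg_pos)
  then have \<eta>: "0 < \<eta>" "\<kappa> * \<eta> * s < e / 2" using e by (auto simp: \<eta>_def field_simps)
  obtain d where d: "0 < d" "\<And>t t'. t \<in> {0..s} \<Longrightarrow> t' \<in> {0..s} \<Longrightarrow> dist t' t < d \<Longrightarrow> dist (z t') (z t) < \<eta>"
    using compact_uniformly_continuous[OF z compact_Icc] \<eta>(1) unfolding uniformly_continuous_on_def by metis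
  obtain m0 :: nat where m0: "s / d < real m0" using reals_Archimedean2 by blast
  obtain m1 :: nat where m1: "2 * \<kappa>\<^sup>2 * s\<^sup>2 * C / e < real m1" using reals_Archimedean2 by blast
  show "\<exists>no. \<forall>m\<ge>no. norm ((\<Sum>i<m. exp (- \<kappa> * (s - real (Suc i) * s / real m)) *\<^sub>R
            (g (real (Suc i) * s / real m) - g (real i * s / real m))) - z s) < e"
  proof (intro exI allI impI)
    fix m assume m: "max (Suc m0) m1 \<le> m"
    have mpos: "0 < m" using m by simp
    define \<Delta> where "\<Delta> = s / real m"
    define T where "T i = real i * s / real m" for i
    define w where "w i = exp (- \<kappa> * (s - T i))" for i
    have \<Delta>: "0 < \<Delta>" using s mpos by (simp add: \<Delta>_def)
    have "s / d < real m" using m0 m by (auto intro: less_trans)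
    then have \<Delta>d: "\<Delta> < d" using d(1) mpos by (simp add: \<Delta>_def field_simps)
    have TSuc: "T (Suc i) = T i + \<Delta>" for i by (simp add: T_def \<Delta>_def add_divide_distrib[symmetric] algebra_simps)
    have T: "T i \<in> {0..s}" if "i \<le> m" for i
      using that s mpos by (auto simp: T_def field_simps)
    have T0: "T 0 = 0" and Tm: "T m = s" using mpos by (auto simp: T_def)
    have zT: "z (T i) = - \<kappa> *\<^sub>R integral {0..T i} z + g (T i)" if "i \<le> m" for i
      using eq[OF mpos that] by (simp add: T_def)
    have "z 0 = 0" using zT[of 0] g0 by (simp add: T0)
    have step: "norm (w (Suc i) *\<^sub>R (g (T (Suc i)) - g (T i)) - (w (Suc i) *\<^sub>R z (T (Suc i)) - w i *\<^sub>R z (T i))) \<le>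
       \<kappa> * \<eta> * \<Delta> + (\<kappa> * \<Delta>)\<^sup>2 * C" if i: "i < m" for i
    proof -
      have sub: "{0..T (Suc i)} \<subseteq> {0..s}" "{T i..T (Suc i)} \<subseteq> {0..s}" using T[of "Suc i"] T[of i] i by auto
      have zi: "z integrable_on {0..T (Suc i)}"
        by (rule integrable_continuous_interval[OF continuous_on_subset[OF z sub(1)]])
      have zc: "continuous_on {T i..T (Suc i)} z" by (rule continuous_on_subset[OF z sub(2)])
      have "integral {0..T i} z + integral {T i..T (Suc i)} z = integral {0..T (Suc i)} z"
        using T[of i] i TSuc[of i] \<Delta> by (intro Henstock_Kurzweil_Integration.integral_combine[OF _ _ zi]) auto
      moreover have "g (T i) = z (T i) + \<kappa> *\<^sub>R integral {0..T i} z"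
        "g (T (Suc i)) = z (T (Suc i)) + \<kappa> *\<^sub>R integral {0..T (Suc i)} z"
        using zT[of i] zT[of "Suc i"] i by auto
      ultimately have g: "g (T (Suc i)) - g (T i) = z (T (Suc i)) - z (T i) + \<kappa> *\<^sub>R integral {T i..T (Suc i)} z"
        by (simp flip: \<open>integral {0..T i} z + integral {T i..T (Suc i)} z = integral {0..T (Suc i)} z\<close> add: scaleR_right_distrib)
      define J where "J = integral {T i..T (Suc i)} (\<lambda>q. z q - z (T i))"
      have J: "integral {T i..T (Suc i)} z = J + \<Delta> *\<^sub>R z (T i)"
        unfolding J_def using \<Delta> TSuc[of i]
        by (subst Henstock_Kurzweil_Integration.integral_diff) (auto intro!: integrable_continuous_interval zc[unfolded TSuc])
      have "norm J \<le> \<eta> * (T (Suc i) - T i)"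
        unfolding J_def
      proof (rule integral_bound)
        show "T i \<le> T (Suc i)" using TSuc[of i] \<Delta> by simp
        show "continuous_on {T i..T (Suc i)} (\<lambda>q. z q - z (T i))" by (intro continuous_intros zc)
        fix q assume "q \<in> {T i..T (Suc i)}"
        then have "q \<in> {0..s}" "dist q (T i) < d" using sub TSuc[of i] \<Delta>d by (auto simp: dist_real_def)
        then show "norm (z q - z (T i)) \<le> \<eta>" using d(2)[of "T i" q] T[of i] i by (auto simp: dist_norm)
      qed
      then have nJ: "norm J \<le> \<eta> * \<Delta>" by (simp add: TSuc)
      have w: "w i = w (Suc i) * exp (- \<kappa> * \<Delta>)"
        unfolding w_def TSuc exp_add[symmetric] by (simp add: algebra_simps)
      have w1: "0 \<le> w (Suc i)" "w (Suc i) \<le> 1" using T[of "Suc i"] i \<kappa> by (auto simp: w_def)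
      \<comment> \<open>The second order remainder of the exponential, which lies between 0 and \<open>(\<kappa> \<Delta>)\<^sup>2\<close>.\<close>
      define \<theta> where "\<theta> = \<kappa> * \<Delta> - 1 + exp (- \<kappa> * \<Delta>)"
      have x: "0 \<le> \<kappa> * \<Delta>" using \<kappa> \<Delta> by simp
      have "exp (- (\<kappa> * \<Delta>)) \<le> 1 / (1 + \<kappa> * \<Delta>)"
        unfolding exp_minus using exp_ge_add_one_self[of "\<kappa> * \<Delta>"] x
        by (simp add: inverse_eq_divide frac_le)
      also have "\<dots> \<le> 1 - \<kappa> * \<Delta> + (\<kappa> * \<Delta>)\<^sup>2"
      proof -
        have "0 \<le> (\<kappa> * \<Delta>) ^ 3" using x by simp
        then have "1 \<le> (1 - \<kappa> * \<Delta> + (\<kappa> * \<Delta>)\<^sup>2) * (1 + \<kappa> * \<Delta>)"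
          by (simp add: algebra_simps power2_eq_square power3_eq_cube)
        then show ?thesis using x by (simp add: divide_le_eq)
      qed
      finally have \<theta>: "0 \<le> \<theta>" "\<theta> \<le> (\<kappa> * \<Delta>)\<^sup>2"
        using exp_ge_add_one_self[of "- (\<kappa> * \<Delta>)"] by (auto simp: \<theta>_def)
      have "w (Suc i) *\<^sub>R (g (T (Suc i)) - g (T i)) - (w (Suc i) *\<^sub>R z (T (Suc i)) - w i *\<^sub>R z (T i))
         = w (Suc i) *\<^sub>R (\<kappa> *\<^sub>R J) + w (Suc i) *\<^sub>R (\<theta> *\<^sub>R z (T i))"
        unfolding g J w \<theta>_def by (simp add: algebra_simps)
      also have "norm \<dots> \<le> norm (w (Suc i) *\<^sub>R (\<kappa> *\<^sub>R J)) + norm (w (Suc i) *\<^sub>R (\<theta> *\<^sub>R z (T i)))"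
        by (rule norm_triangle_ineq)
      also have "\<dots> \<le> 1 * (\<kappa> * (\<eta> * \<Delta>)) + 1 * ((\<kappa> * \<Delta>)\<^sup>2 * C)"
        unfolding norm_scaleR using w1 nJ \<theta> \<kappa> C(2)[OF T[of i]] i x
        by (intro add_mono mult_mono) auto
      finally show ?thesis by (simp add: mult.assoc)
    qed
    have zs: "z s = (\<Sum>i<m. w (Suc i) *\<^sub>R z (T (Suc i)) - w i *\<^sub>R z (T i))"
      using sum_lessThan_telescope[of "\<lambda>i. w i *\<^sub>R z (T i)" m] by (simp add: Tm T0 \<open>z 0 = 0\<close> w_def)
    have "norm ((\<Sum>i<m. w (Suc i) *\<^sub>R (g (T (Suc i)) - g (T i))) - z s) \<le> (\<Sum>i<m. \<kappa> * \<eta> * \<Delta> + (\<kappa> * \<Delta>)\<^sup>2 * C)"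
      unfolding zs sum_subtractf[symmetric] by (rule sum_norm_le) (use step in auto)
    also have "\<dots> = \<kappa> * \<eta> * s + \<kappa>\<^sup>2 * s\<^sup>2 * C / real m"
      using mpos by (simp add: \<Delta>_def power2_eq_square field_simps)
    also have "\<dots> < e / 2 + e / 2"
    proof (rule add_strict_mono[OF \<eta>(2)])
      have "2 * \<kappa>\<^sup>2 * s\<^sup>2 * C / e < real m" using m1 m by (auto intro: less_le_trans)
      then show "\<kappa>\<^sup>2 * s\<^sup>2 * C / real m < e / 2" using e mpos by (simp add: field_simps)
    qed
    finally show "norm ((\<Sum>i<m. exp (- \<kappa> * (s - real (Suc i) * s / real m)) *\<^sub>R
            (g (real (Suc i) * s / real m) - g (real i * s / real m))) - z s) < e"
      by (simp add: w_def T_def)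
  qed
qed

text \<open>The sum is a right endpoint Riemann sum of the increasing function \<open>exp (- K (s - t))\<close>, so it
  exceeds the integral over \<open>{0..s}\<close>.\<close>

lemma exp_weighted_variance_ge:
  assumes K: "0 < K" and s: "0 < s" and m: "0 < (m :: nat)"
  shows "(1 - exp (- K * s)) / K \<le> (\<Sum>i<m. (exp (- (K / 2) * (s - real (Suc i) * s / real m)))\<^sup>2 * (real (Suc i) * s / real m - real i * s / real m))"
proof -
  define T where "T i = real i * s / real m" for i
  have T0: "T 0 = 0" and Tm: "T m = s" using m by (auto simp: T_def)
  have step: "(exp (- K * (s - T (Suc i))) - exp (- K * (s - T i))) / K \<le> (exp (- (K / 2) * (s - T (Suc i))))\<^sup>2 * (T (Suc i) - T i)" for i
  proof -
    have sq: "(exp (- (K / 2) * (s - T (Suc i))))\<^sup>2 = exp (- K * (s - T (Suc i)))"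
      by (simp add: power2_eq_square exp_add[symmetric] algebra_simps)
    have "exp (- K * (s - T i)) = exp (- K * (s - T (Suc i))) * exp (- (K * (T (Suc i) - T i)))"
      by (simp add: exp_add[symmetric] algebra_simps)
    moreover have "1 - K * (T (Suc i) - T i) \<le> exp (- (K * (T (Suc i) - T i)))"
      using exp_ge_add_one_self[of "- (K * (T (Suc i) - T i))"] by simp
    then have "exp (- K * (s - T (Suc i))) * (1 - K * (T (Suc i) - T i)) \<le> exp (- K * (s - T (Suc i))) * exp (- (K * (T (Suc i) - T i)))"
      by (intro mult_left_mono) auto
    ultimately have "exp (- K * (s - T (Suc i))) - exp (- K * (s - T i)) \<le> exp (- K * (s - T (Suc i))) * (T (Suc i) - T i) * K"
      by (simp add: algebra_simps)
    then show ?thesis unfolding sq using K by (simp only: pos_divide_le_eq)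
  qed
  have "(1 - exp (- K * s)) / K = (\<Sum>i<m. (exp (- K * (s - T (Suc i))) - exp (- K * (s - T i))) / K)"
    unfolding sum_divide_distrib[symmetric] using sum_lessThan_telescope[of "\<lambda>i. exp (- K * (s - T i))" m] by (simp add: T0 Tm)
  also have "\<dots> \<le> (\<Sum>i<m. (exp (- (K / 2) * (s - T (Suc i))))\<^sup>2 * (T (Suc i) - T i))"
    by (intro sum_mono step)
  finally show ?thesis by (simp add: T_def)
qed

text \<open>Induction on the number of terms: the partial sum is measurable with respect to the past, hence
  independent of the next increment.\<close>

lemma (in prob_space) brownian_weighted_sum_gaussian:
  fixes W :: "real \<Rightarrow> 'a \<Rightarrow> real ^ 'n"
  assumes W: "brownian_motion M W" and t: "0 \<le> t 0" "\<And>i. t i < t (Suc i)" and c: "\<And>i. 0 < c i"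
  shows "distributed M lborel (\<lambda>\<omega>. \<Sum>i<Suc m. c i *\<^sub>R (W (t (Suc i)) \<omega> - W (t i) \<omega>))
     (\<lambda>y. ennreal (gaussian_vec_density (sqrt (\<Sum>i<Suc m. (c i)\<^sup>2 * (t (Suc i) - t i))) y))"
proof -
  have tmono: "t i \<le> t j" if "i \<le> j" for i j using lift_Suc_mono_le[of t, OF less_imp_le[OF t(2)] that] .
  have tnn: "0 \<le> t i" for i using t(1) tmono[of 0 i] by simp
  have incr: "distributed M lborel (\<lambda>\<omega>. c i *\<^sub>R (W (t (Suc i)) \<omega> - W (t i) \<omega>)) (\<lambda>y. ennreal (gaussian_vec_density (c i * sqrt (t (Suc i) - t i)) y))" for i
    using W tnn t(2)[of i] c[of i]
    by (intro gaussian_vector_scale) (auto simp: brownian_motion_def gaussian_vec_density_def)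
  show ?thesis
  proof (induction m)
    case 0
    then show ?case using incr[of 0] c[of 0] by (simp add: real_sqrt_mult)
  next
    case (Suc m)
    let ?S = "\<lambda>\<omega>. \<Sum>i<Suc m. c i *\<^sub>R (W (t (Suc i)) \<omega> - W (t i) \<omega>)"
    let ?D = "\<lambda>\<omega>. c (Suc m) *\<^sub>R (W (t (Suc (Suc m))) \<omega> - W (t (Suc m)) \<omega>)"
    let ?F = "completed_natural_filtration M W (t (Suc m))"
    have S: "?S \<in> borel_measurable ?F"
      using tmono tnn by (intro borel_measurable_sum borel_measurable_scaleR borel_measurable_diff measurable_completed_filtration) auto
    have ind: "indep_var borel ?S borel ?D"
    proof (rule indep_varI_indep_set[OF brownian_increment_indep_past[OF W tnn t(2)]])
      show "?S \<in> borel_measurable M" using distributed_measurable[OF Suc] by simp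
      show "?D \<in> borel_measurable M" using distributed_measurable[OF incr[of "Suc m"]] by simp
      show "?S -` A \<inter> space M \<in> sets ?F" if "A \<in> sets borel" for A
        using measurable_sets[OF S that] by simp
      show "?D -` A \<inter> space M \<in> {(\<lambda>\<omega>. W (t (Suc (Suc m))) \<omega> - W (t (Suc m)) \<omega>) -` C \<inter> space M | C. C \<in> sets borel}"
        if A: "A \<in> sets borel" for A
      proof -
        have "(\<lambda>y. c (Suc m) *\<^sub>R y) \<in> borel_measurable (borel :: (real ^ 'n) measure)" by measurable
        from measurable_sets[OF this A] have "(\<lambda>y. c (Suc m) *\<^sub>R y) -` A \<in> sets borel" by simp
        then show ?thesis by (intro CollectI exI[of _ "(\<lambda>y. c (Suc m) *\<^sub>R y) -` A"]) auto
      qed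
    qed
    have pos: "0 < (\<Sum>i<Suc m. (c i)\<^sup>2 * (t (Suc i) - t i))"
      using c t(2) by (intro sum_pos) (auto simp: mult_pos_pos less_imp_neq[THEN not_sym] zero_less_mult_iff)
    have pos': "0 < c (Suc m) * sqrt (t (Suc (Suc m)) - t (Suc m))"
      using c[of "Suc m"] t(2)[of "Suc m"] by simp
    have "0 \<le> t (Suc (Suc m)) - t (Suc m)" using t(2)[of "Suc m"] by simp
    then have var: "(sqrt (\<Sum>i<Suc m. (c i)\<^sup>2 * (t (Suc i) - t i)))\<^sup>2 + (c (Suc m) * sqrt (t (Suc (Suc m)) - t (Suc m)))\<^sup>2 =
       (\<Sum>i<Suc (Suc m). (c i)\<^sup>2 * (t (Suc i) - t i))"
      using pos by (simp only: sum.lessThan_Suc[of _ "Suc m"] power_mult_distrib real_sqrt_pow2 less_imp_le)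
    have "0 < sqrt (\<Sum>i<Suc m. (c i)\<^sup>2 * (t (Suc i) - t i))" using pos by (simp only: real_sqrt_gt_zero)
    from gaussian_vector_add[OF ind this pos' Suc incr, unfolded var]
    show ?case by (simp only: sum.lessThan_Suc[of _ "Suc m"])
  qed
qed

section \<open>The density bound\<close>

text \<open>For an open set the indicator is lower semicontinuous, so the bound passes to the limit by Fatou's
  lemma; a Borel set is contained in open sets of nearly the same Lebesgue measure.\<close>

lemma (in prob_space) emeasure_limit_le_lborel:
  fixes Z :: "'a \<Rightarrow> 'c::euclidean_space"
  assumes Z[measurable]: "Z \<in> borel_measurable M" and Zm[measurable]: "\<And>m. Zm m \<in> borel_measurable M"
    and lim: "AE \<omega> in M. (\<lambda>m. Zm m \<omega>) \<longlonglongrightarrow> Z \<omega>"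
    and bnd: "\<And>m A. open A \<Longrightarrow> emeasure M {\<omega>\<in>space M. Zm m \<omega> \<in> A} \<le> ennreal c * emeasure lborel A"
    and c: "0 < c" and D: "D \<in> sets borel"
  shows "emeasure M {\<omega>\<in>space M. Z \<omega> \<in> D} \<le> ennreal c * emeasure lborel D"
proof -
  have op: "emeasure M {\<omega>\<in>space M. Z \<omega> \<in> A} \<le> ennreal c * emeasure lborel A" if A: "open A" for A
  proof -
    have [measurable]: "A \<in> sets borel" using A by simp
    have vim: "emeasure M {\<omega>\<in>space M. f \<omega> \<in> A} = (\<integral>\<^sup>+\<omega>. indicator A (f \<omega>) \<partial>M)" if "f \<in> borel_measurable M" for f :: "'a \<Rightarrow> 'c"
      using emeasure_vimage_eq_nn_integral[OF that, of A] by (simp add: vimage_def Int_def conj_commute)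
    have "emeasure M {\<omega>\<in>space M. Z \<omega> \<in> A} = (\<integral>\<^sup>+\<omega>. indicator A (Z \<omega>) \<partial>M)" by (rule vim) simp
    also have "\<dots> \<le> (\<integral>\<^sup>+\<omega>. liminf (\<lambda>m. indicator A (Zm m \<omega>)) \<partial>M)"
    proof (rule nn_integral_mono_AE)
      show "AE \<omega> in M. (indicator A (Z \<omega>) :: ennreal) \<le> liminf (\<lambda>m. indicator A (Zm m \<omega>))"
        using lim
      proof eventually_elim
        case (elim \<omega>)
        show ?case
        proof (cases "Z \<omega> \<in> A")
          case True
          then have "eventually (\<lambda>m. Zm m \<omega> \<in> A) sequentially" using elim A by (auto dest: topological_tendstoD)
          then have "eventually (\<lambda>m. (1 :: ennreal) \<le> indicator A (Zm m \<omega>)) sequentially"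
            by eventually_elim simp
          then have "1 \<le> liminf (\<lambda>m. indicator A (Zm m \<omega>) :: ennreal)" by (rule Liminf_bounded)
          then show ?thesis using True by simp
        qed simp
      qed
    qed
    also have "\<dots> \<le> liminf (\<lambda>m. \<integral>\<^sup>+\<omega>. indicator A (Zm m \<omega>) \<partial>M)" by (rule nn_integral_liminf) simp
    also have "\<dots> \<le> liminf (\<lambda>m::nat. ennreal c * emeasure lborel A)"
      using bnd[OF A] by (intro Liminf_mono always_eventually allI) (simp add: vim[symmetric])
    also have "\<dots> = ennreal c * emeasure lborel A" by (rule Liminf_const) simp
    finally show ?thesis .
  qed
  show ?thesis
  proof (rule ennreal_le_epsilon)
    fix e :: real assume e: "0 < e"
    obtain A where A: "open A" "D \<subseteq> A" "emeasure lborel (A - D) < ennreal (e / c)"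
      using outer_regular_lborel[OF D, of "e / c"] e c by auto
    have [measurable]: "A \<in> sets borel" "D \<in> sets borel" using A D by auto
    have "emeasure M {\<omega>\<in>space M. Z \<omega> \<in> D} \<le> emeasure M {\<omega>\<in>space M. Z \<omega> \<in> A}"
      using A by (intro emeasure_mono) auto
    also have "\<dots> \<le> ennreal c * emeasure lborel A" by (rule op[OF A(1)])
    also have "emeasure lborel A = emeasure lborel D + emeasure lborel (A - D)"
      using A by (subst plus_emeasure) (auto simp: Un_absorb1)
    also have "ennreal c * (emeasure lborel D + emeasure lborel (A - D)) \<le> ennreal c * (emeasure lborel D + ennreal (e / c))"
      using A by (intro mult_left_mono add_left_mono) auto
    also have "\<dots> = ennreal c * emeasure lborel D + ennreal e"
      using c e by (simp add: distrib_left ennreal_mult[symmetric])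
    finally show "emeasure M {\<omega>\<in>space M. Z \<omega> \<in> D} \<le> ennreal c * emeasure lborel D + ennreal e" .
  qed
qed

lemma progressively_measurable_at:
  assumes X: "progressively_measurable F X" and s: "0 \<le> s"
  shows "X s \<in> borel_measurable (F s)"
proof -
  have "(\<lambda>\<omega>. (s, \<omega>)) \<in> F s \<rightarrow>\<^sub>M restrict_space borel {0..s} \<Otimes>\<^sub>M F s"
    using s by (intro measurable_Pair) (auto simp: space_restrict_space)
  moreover have "(\<lambda>(q, \<omega>). X q \<omega>) \<in> borel_measurable (restrict_space borel {0..s} \<Otimes>\<^sub>M F s)"
    using X s by (simp add: progressively_measurable_def)
  ultimately have "(\<lambda>\<omega>. case (s, \<omega>) of (q, \<omega>) \<Rightarrow> X q \<omega>) \<in> borel_measurable (F s)"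
    by (rule measurable_compose)
  then show ?thesis by simp
qed

theorem proposition4p1:
  fixes M :: "'w measure"
    and B :: "real \<Rightarrow> 'w \<Rightarrow> real ^ 'd" and B1 :: "real \<Rightarrow> 'w \<Rightarrow> real ^ 'n"
    and U :: "'u::metric_space set" and V :: "'v::metric_space set"
    and b :: "real ^ 'n \<Rightarrow> 'u \<Rightarrow> 'v \<Rightarrow> real ^ 'n"
    and \<sigma> :: "real ^ 'n \<Rightarrow> 'u \<Rightarrow> 'v \<Rightarrow> real ^ 'd ^ 'n"
    and f :: "real ^ 'n \<Rightarrow> 'u \<Rightarrow> 'v \<Rightarrow> real"
    and C\<^sub>b C\<^sub>f C\<^sub>\<sigma> K :: real
    and r s :: real and x :: "real ^ 'n"
    and u :: "real \<Rightarrow> 'w \<Rightarrow> 'u" and v :: "real \<Rightarrow> 'w \<Rightarrow> 'v"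
    and X Xr :: "real \<Rightarrow> 'w \<Rightarrow> real ^ 'n"
    and D :: "(real ^ 'n) set"
  assumes "prob_space M" and "complete_measure M"
    and "brownian_motion M B" and "brownian_motion M B1" and "independent_processes M B B1"
    and "compact U" and "compact V"
    and "\<And>x. continuous_on (U \<times> V) (\<lambda>(u, v). b x u v)"
    and "\<And>x. continuous_on (U \<times> V) (\<lambda>(u, v). \<sigma> x u v)"
    and "\<And>x. continuous_on (U \<times> V) (\<lambda>(u, v). f x u v)"
    and "\<And>x y u v. u \<in> U \<Longrightarrow> v \<in> V \<Longrightarrow> norm (b x u v - b y u v) \<le> C\<^sub>b * norm (x - y)"
    and "\<And>x y u v. u \<in> U \<Longrightarrow> v \<in> V \<Longrightarrow> \<bar>f x u v - f y u v\<bar> \<le> C\<^sub>f * norm (x - y)"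
    and "\<And>x y u v. u \<in> U \<Longrightarrow> v \<in> V \<Longrightarrow> trace_norm (\<sigma> x u v - \<sigma> y u v) \<le> C\<^sub>\<sigma> * norm (x - y)"
    and "K > C\<^sub>\<sigma>\<^sup>2"
    and "\<And>x y u v. u \<in> U \<Longrightarrow> v \<in> V \<Longrightarrow>
           2 * ((x - y) \<bullet> (b x u v - b y u v)) \<le> - K * (norm (x - y))\<^sup>2"
    and "0 < r" and "r \<le> 1"
    and "u \<in> admissible_controls M (completed_natural_filtration M B) U"
    and "v \<in> admissible_controls M (completed_natural_filtration M B) V"
    and "solves_sde M (completed_natural_filtration M B) B x
           (\<lambda>t \<omega>. b (X t \<omega>) (u t \<omega>) (v t \<omega>))
           (\<lambda>t \<omega>. \<sigma> (X t \<omega>) (u t \<omega>) (v t \<omega>)) X"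
    and "solves_sde M (completed_natural_filtration M (joint_process B B1)) (joint_process B B1) x
           (\<lambda>t \<omega>. - (K / 2) *\<^sub>R (Xr t \<omega> - X t \<omega>) + b (X t \<omega>) (u t \<omega>) (v t \<omega>))
           (\<lambda>t \<omega>. sigma_r r \<sigma> (X t \<omega>) (u t \<omega>) (v t \<omega>)) Xr"
    and "D \<in> sets borel" and "s > 0"
  shows "emeasure M {\<omega> \<in> space M. Xr s \<omega> \<in> D} \<le>
    ennreal ((K / 2) powr (real CARD('n) / 2) * r powr (- real CARD('n)) *
      (1 - exp (- K * s)) powr (- real CARD('n) / 2)) * emeasure lborel D"
proof -
  interpret prob_space M by fact
  note B = assms(3) and B1 = assms(4) and ind = assms(5)
  note SX = assms(20) and SXr = assms(21)
  let ?F = "completed_natural_filtration M (joint_process B B1)" and ?FB = "completed_natural_filtration M B"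
  have K: "0 < K" using assms(14) zero_le_power2[of C\<^sub>\<sigma>] by linarith
  have r: "0 < r" and s: "0 < s" using assms by auto
  define Z where "Z t \<omega> = Xr t \<omega> - X t \<omega>" for t \<omega>
  have B1m: "B1 t \<in> borel_measurable M" and Bm: "B t \<in> borel_measurable M" if "0 \<le> t" for t
    using brownian_motion_measurable B B1 that by auto
  have Wm: "joint_process B B1 t \<in> borel_measurable M" if "0 \<le> t" for t
    using Bm[OF that] B1m[OF that] by (rule measurable_joint_process)
  have XF: "X s \<in> borel_measurable (?FB s)"
    using SX s by (intro progressively_measurable_at) (auto simp: solves_sde_def)
  have Xm: "X s \<in> borel_measurable M"
    using XF sets_completed_filtration_subset[of B M s] Bm measurable_mono[of borel borel "?FB s" M] by auto
  have "Xr s \<in> borel_measurable (?F s)"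
    using SXr s by (intro progressively_measurable_at) (auto simp: solves_sde_def)
  then have Xrm: "Xr s \<in> borel_measurable M"
    using sets_completed_filtration_subset[of "joint_process B B1" M s] Wm measurable_mono[of borel borel "?F s" M] by auto

  obtain Y where Y: "ito_integral M ?FB B (\<lambda>t \<omega>. \<sigma> (X t \<omega>) (u t \<omega>) (v t \<omega>)) Y"
    and XY: "AE \<omega> in M. \<forall>t\<ge>0. X t \<omega> = x + (LINT q:{0..t}|lborel. b (X q \<omega>) (u q \<omega>) (v q \<omega>)) + Y t \<omega>"
    using SX by (auto simp: solves_sde_def)
  obtain Yr where Yr: "ito_integral M ?F (joint_process B B1) (\<lambda>t \<omega>. sigma_r r \<sigma> (X t \<omega>) (u t \<omega>) (v t \<omega>)) Yr"
    and XrYr: "AE \<omega> in M. \<forall>t\<ge>0. Xr t \<omega> = x + (LINT q:{0..t}|lborel. - (K / 2) *\<^sub>R (Xr q \<omega> - X q \<omega>) + b (X q \<omega>) (u q \<omega>) (v q \<omega>)) + Yr t \<omega>"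
    using SXr by (auto simp: solves_sde_def)
  \<comment> \<open>The stochastic integrals differ by the auxiliary noise alone.\<close>
  have diff: "AE \<omega> in M. Yr t \<omega> - Y t \<omega> - r *\<^sub>R (B1 t \<omega> - B1 0 \<omega>) = 0" if "0 \<le> t" for t
    using ito_integral_block_row_minus_ito_integral[OF B B1 ind Y Yr[unfolded sigma_r_eq_block_row] that]
    by (simp add: scaleR_matrix_vector_assoc[symmetric])
  \<comment> \<open>Only partition points are needed, and these are countably many; so one null set suffices.\<close>
  have "AE \<omega> in M. \<forall>m i. Yr (real i * s / real m) \<omega> - Y (real i * s / real m) \<omega> - r *\<^sub>R (B1 (real i * s / real m) \<omega> - B1 0 \<omega>) = 0"
    unfolding AE_all_countable using s by (intro allI diff) auto
  moreover have "AE \<omega> in M. continuous_on {0..} (\<lambda>t. X t \<omega>)" "AE \<omega> in M. continuous_on {0..} (\<lambda>t. Xr t \<omega>)"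
    using SX SXr by (auto simp: solves_sde_def)
  moreover have "AE \<omega> in M. \<forall>t\<ge>0. set_integrable lborel {0..t} (\<lambda>q. b (X q \<omega>) (u q \<omega>) (v q \<omega>))"
    using SX by (auto simp: solves_sde_def)
  moreover have "AE \<omega> in M. \<forall>t\<ge>0. set_integrable lborel {0..t} (\<lambda>q. - (K / 2) *\<^sub>R (Xr q \<omega> - X q \<omega>) + b (X q \<omega>) (u q \<omega>) (v q \<omega>))"
    using SXr by (auto simp: solves_sde_def)
  ultimately have path: "AE \<omega> in M. continuous_on {0..s} (\<lambda>t. Z t \<omega>) \<and>
     (\<forall>m i. Z (real i * s / real m) \<omega> = - (K / 2) *\<^sub>R integral {0..real i * s / real m} (\<lambda>t. Z t \<omega>) + r *\<^sub>R (B1 (real i * s / real m) \<omega> - B1 0 \<omega>))"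
    using XY XrYr
  proof eventually_elim
    case (elim \<omega>)
    have cont: "continuous_on {0..t} (\<lambda>t. Z t \<omega>)" for t
      unfolding Z_def using elim(2,3) by (intro continuous_on_diff) (auto intro: continuous_on_subset)
    moreover have "Z t \<omega> = - (K / 2) *\<^sub>R integral {0..t} (\<lambda>t. Z t \<omega>) + r *\<^sub>R (B1 t \<omega> - B1 0 \<omega>)"
      if t: "0 \<le> t" and eq: "Yr t \<omega> - Y t \<omega> - r *\<^sub>R (B1 t \<omega> - B1 0 \<omega>) = 0" for t
    proof -
      let ?\<beta> = "\<lambda>q. b (X q \<omega>) (u q \<omega>) (v q \<omega>)"
      have int: "set_integrable lborel {0..t} ?\<beta>" "set_integrable lborel {0..t} (\<lambda>q. - (K / 2) *\<^sub>R (Xr q \<omega> - X q \<omega>) + ?\<beta> q)"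
        using elim t by auto
      have "(LINT q:{0..t}|lborel. - (K / 2) *\<^sub>R (Xr q \<omega> - X q \<omega>) + ?\<beta> q) - (LINT q:{0..t}|lborel. ?\<beta> q)
          = (LINT q:{0..t}|lborel. - (K / 2) *\<^sub>R Z q \<omega>)"
        unfolding set_integral_diff(2)[OF int(2,1), symmetric] by (simp add: Z_def)
      also have "\<dots> = integral {0..t} (\<lambda>q. - (K / 2) *\<^sub>R Z q \<omega>)"
      proof (rule set_borel_integral_eq_integral(2))
        show "set_integrable lborel {0..t} (\<lambda>q. - (K / 2) *\<^sub>R Z q \<omega>)"
          using set_integral_diff(1)[OF int(2,1)] by (simp add: Z_def)
      qed
      also have "\<dots> = - (K / 2) *\<^sub>R integral {0..t} (\<lambda>q. Z q \<omega>)"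
        by (rule integral_cmul)
      finally have "(LINT q:{0..t}|lborel. - (K / 2) *\<^sub>R (Xr q \<omega> - X q \<omega>) + ?\<beta> q) =
          (LINT q:{0..t}|lborel. ?\<beta> q) + - (K / 2) *\<^sub>R integral {0..t} (\<lambda>q. Z q \<omega>)" by (simp add: algebra_simps)
      then have "Z t \<omega> = - (K / 2) *\<^sub>R integral {0..t} (\<lambda>q. Z q \<omega>) + (Yr t \<omega> - Y t \<omega>)"
        using elim t by (simp add: Z_def)
      then show ?thesis using eq by simp
    qed
    ultimately show ?case using elim(1) s by simp
  qed

  \<comment> \<open>Riemann sums of the Wiener integral of \<open>r exp (- (K / 2) (s - t))\<close>, with right endpoints.\<close>
  define S where "S m \<omega> = (\<Sum>i<m. (r * exp (- (K / 2) * (s - real (Suc i) * s / real m))) *\<^sub>R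
      (B1 (real (Suc i) * s / real m) \<omega> - B1 (real i * s / real m) \<omega>))" for m \<omega>
  have lim: "AE \<omega> in M. (\<lambda>m. S m \<omega>) \<longlonglongrightarrow> Z s \<omega>"
    using path
  proof eventually_elim
    case (elim \<omega>)
    have "(\<lambda>m. \<Sum>i<m. exp (- (K / 2) * (s - real (Suc i) * s / real m)) *\<^sub>R
        (r *\<^sub>R (B1 (real (Suc i) * s / real m) \<omega> - B1 0 \<omega>) - r *\<^sub>R (B1 (real i * s / real m) \<omega> - B1 0 \<omega>))) \<longlonglongrightarrow> Z s \<omega>"
      using elim K s by (intro exp_weighted_sum_tendsto[where g = "\<lambda>t. r *\<^sub>R (B1 t \<omega> - B1 0 \<omega>)" and z = "\<lambda>t. Z t \<omega>"]) auto
    then show ?case by (simp add: S_def scaleR_diff_right[symmetric] mult.commute)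
  qed
  define w where "w m = (\<Sum>i<m. (r * exp (- (K / 2) * (s - real (Suc i) * s / real m)))\<^sup>2 * (real (Suc i) * s / real m - real i * s / real m))" for m
  have gauss: "distributed M lborel (S (Suc m)) (\<lambda>y. ennreal (gaussian_vec_density (sqrt (w (Suc m))) y))" for m
    unfolding S_def[abs_def] w_def using s r
    by (intro brownian_weighted_sum_gaussian[OF B1, where t = "\<lambda>i. real i * s / real (Suc m)"
          and c = "\<lambda>i. r * exp (- (K / 2) * (s - real (Suc i) * s / real (Suc m)))"]) (auto simp: divide_strict_right_mono)
  define c where "c = (K / 2) powr (real CARD('n) / 2) * r powr (- real CARD('n)) *
      (1 - exp (- K * s)) powr (- real CARD('n) / 2)"
  have e1: "0 < 1 - exp (- K * s)" using K s by simp
  have c0: "0 < c" unfolding c_def using K r e1 by (intro mult_pos_pos; simp only: powr_gt_zero)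
  have w: "r\<^sup>2 * (1 - exp (- K * s)) / K \<le> w (Suc m)" for m
  proof -
    have "w (Suc m) = r\<^sup>2 * (\<Sum>i<Suc m. (exp (- (K / 2) * (s - real (Suc i) * s / real (Suc m))))\<^sup>2 * (real (Suc i) * s / real (Suc m) - real i * s / real (Suc m)))"
      unfolding w_def sum_distrib_left power_mult_distrib mult.assoc ..
    moreover have "r\<^sup>2 * ((1 - exp (- K * s)) / K) \<le> r\<^sup>2 * (\<Sum>i<Suc m. (exp (- (K / 2) * (s - real (Suc i) * s / real (Suc m))))\<^sup>2 * (real (Suc i) * s / real (Suc m) - real i * s / real (Suc m)))"
      by (intro mult_left_mono exp_weighted_variance_ge K s) auto
    ultimately show ?thesis by simp
  qed
  have ind_XS: "indep_var borel (X s) borel (S (Suc m))" for m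
  proof (rule indep_varI_indep_set[OF independent_processes_completed[OF ind Bm B1m]])
    show "X s \<in> borel_measurable M" by (rule Xm)
    show "S (Suc m) \<in> borel_measurable M" using distributed_measurable[OF gauss] by simp
    show "X s -` A \<inter> space M \<in> sigma_sets (space M) (process_events M {0..} B \<union> null_sets M)" if "A \<in> sets borel" for A
      using measurable_sets[OF XF that] sets_completed_filtration_subset_process_sigma[of M B s] by auto
    have "S (Suc m) \<in> borel_measurable (completed_natural_filtration M B1 s)"
      unfolding S_def[abs_def] using s
      by (intro borel_measurable_sum borel_measurable_scaleR borel_measurable_diff measurable_completed_filtration) (auto simp: divide_le_eq)
    from measurable_sets[OF this] sets_completed_filtration_subset_process_sigma[of M B1 s]
    show "S (Suc m) -` A \<inter> space M \<in> sigma_sets (space M) (process_events M {0..} B1 \<union> null_sets M)" if "A \<in> sets borel" for A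
      using that by auto
  qed auto
  have "emeasure M {\<omega> \<in> space M. Xr s \<omega> \<in> D} \<le> ennreal c * emeasure lborel D"
  proof (rule emeasure_limit_le_lborel[OF Xrm _ _ _ c0 assms(22)])
    show "(\<lambda>\<omega>. X s \<omega> + S (Suc m) \<omega>) \<in> borel_measurable M" for m
      using Xm distributed_measurable[OF gauss[of m]] by (intro borel_measurable_add) auto
    show "AE \<omega> in M. (\<lambda>m. X s \<omega> + S (Suc m) \<omega>) \<longlonglongrightarrow> Xr s \<omega>"
      using lim
    proof eventually_elim
      case (elim \<omega>)
      have "(\<lambda>m. X s \<omega> + S (Suc m) \<omega>) \<longlonglongrightarrow> X s \<omega> + Z s \<omega>"
        by (intro tendsto_add tendsto_const LIMSEQ_Suc elim)
      then show ?case by (simp add: Z_def)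
    qed
    show "emeasure M {\<omega> \<in> space M. X s \<omega> + S (Suc m) \<omega> \<in> A} \<le> ennreal c * emeasure lborel A" if "open A" for m A
      using that gaussian_vec_density_le[OF K r e1 w]
      by (intro emeasure_indep_sum_le_density_bound[OF ind_XS gauss]) (auto simp: c_def intro!: ennreal_leI)
  qed
  then show ?thesis by (simp add: c_def)
qed

end
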